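(* Let $A=A^T\in\mathbb C^{n\times n}$, $B=B^*\in\mathbb C^{n\times n}$, $h\in\mathbb C^n$, and let $U_t=e^{i\widehat Ht}$ be the unitary group (squeezing) generated by the Hamiltonian $$\widehat H=\tfrac{i}{2}\bigl((a^\dagger,Aa^\dagger)-(a,\overline A a)\bigr)+(a^\dagger,Ba)+i(a^\dagger,h)-i(a,\overline h).$$ Let $G$, $\Phi_t$, $\Psi_t$, $h_t$ be as defined in the context. Then the vector-valued and matrix-valued coefficients of the normal decomposition $$U_t=e^{i\widehat Ht}=e^{s_t}\,e^{-\frac12(a^\dagger,R_ta^\dagger)-(g_t,a^\dagger)}\,e^{(a^\dagger,C_ta)}\,e^{\frac12(a,\overline\rho_ta)+(\overline f_t,a)},\qquad U_0=I,\quad s_t\in\mathbb C,$$ namely $$R_t=\Phi_t^{-1}\Psi_t,\quad \overline\rho_t=\overline\Psi_t\Phi_t^{-1},\quad C_t=-\ln\Phi_t,\quad g_t=\Phi_t^{-1}h_t,\quad f_t=h_t-\rho_t\overline h_t,$$ are well defined in terms of $\Phi_t$ and $\Psi_t$. The matrices $\Phi_t^{-1}$ and $G^{-1}(e^{Gt}-I)$ are well defined for any given $A=A^T$, $B=B^*$ at any time $t\in\mathbb R$.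
   Context: $a=\{a_i\}_1^n$ and $a^\dagger=\{a_i^\dagger\}_1^n$ are the multimode annihilation and creation operators with canonical commutation relations $[a_i,a_j^\dagger]=\delta_{ij}$, acting in the Hilbert state space $\mathcal H=\otimes_1^n\ell_2$. $(\cdot,\cdot)$ is the bilinear (not sesquilinear) form $(u,v)=\sum_iu_iv_i$, also used for tuples of operators, e.g. $(a^\dagger,Ma)=\sum_{ij}M_{ij}a_i^\dagger a_j$. A bar denotes complex conjugation, $T$ transposition, $*$ Hermitian conjugation. Define the $(2n\times2n)$-block matrix $G=\begin{pmatrix}-iB&A\\ \overline A&i\overline B\end{pmatrix}$ and the $(n\times n)$-matrices $\Phi_t,\Psi_t$ by $e^{Gt}=\begin{pmatrix}\Phi_t&\Psi_t\\ \overline\Psi_t&\overline\Phi_t\end{pmatrix}$, $t\in\mathbb R$. The vector $h_t\in\mathbb C^n$ is defined by $$\begin{pmatrix}h_t\\ \overline h_t\end{pmatrix}=\int_0^te^{G\tau}\begin{pmatrix}h\\ \overline h\end{pmatrix}d\tau=G^{-1}(e^{Gt}-I)\begin{pmatrix}h\\ \overline h\end{pmatrix},$$ where $G^{-1}(e^{Gt}-I)$ is understood, also for degenerate $G$, as $\int_0^te^{G\tau}d\tau=\sum_{k\ge1}t^kG^{k-1}/k!$. The equality $C_t=-\ln\Phi_t$ means $\Phi_t=e^{-C_t}$. *)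

theory Defs
  imports "HOL-Analysis.Analysis"
begin

section \<open>Matrices\<close>

definition cnj_mat :: "complex^'m^'n \<Rightarrow> complex^'m^'n" where
  "cnj_mat M = map_matrix cnj M"

definition cnj_vec :: "complex^'n \<Rightarrow> complex^'n" where
  "cnj_vec v = (\<chi> i. cnj (v $ i))"

definition block_mat ::
    "complex^'n^'n \<Rightarrow> complex^'n^'n \<Rightarrow> complex^'n^'n \<Rightarrow> complex^'n^'n
      \<Rightarrow> complex^('n + 'n)^('n + 'n)" where
  "block_mat P Q R S = (\<chi> i j. case i of
      Inl p \<Rightarrow> (case j of Inl q \<Rightarrow> P $ p $ q | Inr q \<Rightarrow> Q $ p $ q)
    | Inr p \<Rightarrow> (case j of Inl q \<Rightarrow> R $ p $ q | Inr q \<Rightarrow> S $ p $ q))"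

definition block_vec :: "complex^'n \<Rightarrow> complex^'n \<Rightarrow> complex^('n + 'n)" where
  "block_vec u v = (\<chi> i. case i of Inl p \<Rightarrow> u $ p | Inr p \<Rightarrow> v $ p)"

primrec mat_pow :: "complex^'n^'n \<Rightarrow> nat \<Rightarrow> complex^'n^'n" where
  "mat_pow M 0 = mat 1"
| "mat_pow M (Suc k) = M ** mat_pow M k"

text \<open>The type class function \<open>exp\<close> is not available here: the product \<open>*\<close> of
  \<open>complex^'n^'n\<close> is the entrywise one.\<close>

definition mat_exp :: "complex^'n^'n \<Rightarrow> complex^'n^'n" where
  "mat_exp M = (\<Sum>k. (1 / fact k) *\<^sub>R mat_pow M k)"

definition G_mat :: "complex^'n^'n \<Rightarrow> complex^'n^'n \<Rightarrow> complex^('n + 'n)^('n + 'n)" where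
  "G_mat A B = block_mat (\<chi> p q. - \<i> * B $ p $ q) A (cnj_mat A) (\<chi> p q. \<i> * cnj_mat B $ p $ q)"

definition Phi :: "complex^'n^'n \<Rightarrow> complex^'n^'n \<Rightarrow> real \<Rightarrow> complex^'n^'n" where
  "Phi A B t = (\<chi> p q. mat_exp (t *\<^sub>R G_mat A B) $ Inl p $ Inl q)"

definition Psi :: "complex^'n^'n \<Rightarrow> complex^'n^'n \<Rightarrow> real \<Rightarrow> complex^'n^'n" where
  "Psi A B t = (\<chi> p q. mat_exp (t *\<^sub>R G_mat A B) $ Inl p $ Inr q)"

text \<open>The meaning of \<open>G\<^sup>-\<^sup>1 (e\<^sup>G\<^sup>t - I)\<close> when \<open>G\<close> may be singular.\<close>

definition exp_quotient :: "complex^'n^'n \<Rightarrow> real \<Rightarrow> complex^'n^'n" where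
  "exp_quotient G t = (\<Sum>k. (t ^ Suc k / fact (Suc k)) *\<^sub>R mat_pow G k)"

definition h_path :: "complex^'n^'n \<Rightarrow> complex^'n^'n \<Rightarrow> complex^'n \<Rightarrow> real \<Rightarrow> complex^'n" where
  "h_path A B h t =
     (\<chi> p. (LBINT \<tau>=0..t. mat_exp (\<tau> *\<^sub>R G_mat A B) *v block_vec h (cnj_vec h)) $ Inl p)"

definition R_coeff :: "complex^'n^'n \<Rightarrow> complex^'n^'n \<Rightarrow> real \<Rightarrow> complex^'n^'n" where
  "R_coeff A B t = matrix_inv (Phi A B t) ** Psi A B t"

text \<open>The defining formula is one for the conjugate of \<open>\<rho>\<close>.\<close>

definition rho_coeff :: "complex^'n^'n \<Rightarrow> complex^'n^'n \<Rightarrow> real \<Rightarrow> complex^'n^'n" where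
  "rho_coeff A B t = cnj_mat (cnj_mat (Psi A B t) ** matrix_inv (Phi A B t))"

definition g_coeff :: "complex^'n^'n \<Rightarrow> complex^'n^'n \<Rightarrow> complex^'n \<Rightarrow> real \<Rightarrow> complex^'n" where
  "g_coeff A B h t = matrix_inv (Phi A B t) *v h_path A B h t"

definition f_coeff :: "complex^'n^'n \<Rightarrow> complex^'n^'n \<Rightarrow> complex^'n \<Rightarrow> real \<Rightarrow> complex^'n" where
  "f_coeff A B h t = h_path A B h t - rho_coeff A B t *v cnj_vec (h_path A B h t)"


section \<open>The state space\<close>

text \<open>The \<open>n\<close>-fold tensor power of \<open>\<ell>\<^sub>2\<close> is realised as the space of square summable functions
  of the occupation numbers. Operators are given by their action on arbitrary functions of the
  occupation numbers; as operators on the Hilbert space they are unbounded, and every definition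
  below that uses them requires the vectors involved to be square summable.\<close>

type_synonym 'n state = "('n \<Rightarrow> nat) \<Rightarrow> complex"

definition fock :: "('n::finite) state set" where
  "fock = {\<psi>. (\<lambda>k. (cmod (\<psi> k))\<^sup>2) summable_on UNIV}"

definition fock_norm :: "('n::finite) state \<Rightarrow> real" where
  "fock_norm \<psi> = sqrt (\<Sum>\<^sub>\<infinity>k. (cmod (\<psi> k))\<^sup>2)"

text \<open>Finite linear combinations of number states.\<close>

definition finite_states :: "('n::finite) state set" where
  "finite_states = {\<psi>. finite {k. \<psi> k \<noteq> 0}}"

definition annih :: "'n::finite \<Rightarrow> 'n state \<Rightarrow> 'n state" where
  "annih i \<psi> = (\<lambda>k. of_real (sqrt (real (Suc (k i)))) * \<psi> (k(i := Suc (k i))))"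

definition creat :: "'n::finite \<Rightarrow> 'n state \<Rightarrow> 'n state" where
  "creat i \<psi> = (\<lambda>k. if k i = 0 then 0 else of_real (sqrt (real (k i))) * \<psi> (k(i := k i - 1)))"

lemma canonical_commutation:
  "annih i (creat j \<psi>) k - creat j (annih i \<psi>) k = (if i = j then \<psi> k else 0)"
proof (cases "i = j")
  case True
  have *: "complex_of_real (sqrt (real m)) * (complex_of_real (sqrt (real m)) * z) = of_nat m * z"
    for m z
    by (simp flip: mult.assoc of_real_mult)
  have "annih i (creat j \<psi>) k = of_nat (Suc (k j)) * \<psi> k"
    using True by (simp only: annih_def creat_def fun_upd_same fun_upd_upd diff_Suc_1 *
        fun_upd_triv nat.distinct if_False)
  moreover have "creat j (annih i \<psi>) k = of_nat (k j) * \<psi> k"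
  proof (cases "k j")
    case 0
    then show ?thesis by (simp add: creat_def)
  next
    case (Suc m)
    then have "k(j := Suc m) = k" by (simp add: fun_upd_idem)
    then show ?thesis
      using True Suc by (simp only: annih_def creat_def fun_upd_same fun_upd_upd diff_Suc_1 *
          nat.distinct if_False)
  qed
  ultimately show ?thesis
    using True by (simp add: algebra_simps)
next
  case False
  then show ?thesis
    by (auto simp: annih_def creat_def fun_upd_twist)
qed

definition bilin_op ::
    "('n \<Rightarrow> 'n state \<Rightarrow> 'n state) \<Rightarrow> complex^'n^'n \<Rightarrow> ('n \<Rightarrow> 'n state \<Rightarrow> 'n state)
      \<Rightarrow> ('n::finite) state \<Rightarrow> 'n state" where
  "bilin_op P M Q \<psi> = (\<lambda>k. \<Sum>i\<in>UNIV. \<Sum>j\<in>UNIV. M $ i $ j * P i (Q j \<psi>) k)"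

definition lin_op ::
    "('n \<Rightarrow> 'n state \<Rightarrow> 'n state) \<Rightarrow> complex^'n \<Rightarrow> ('n::finite) state \<Rightarrow> 'n state" where
  "lin_op P v \<psi> = (\<lambda>k. \<Sum>i\<in>UNIV. v $ i * P i \<psi> k)"

definition hamiltonian ::
    "complex^'n^'n \<Rightarrow> complex^'n^'n \<Rightarrow> complex^'n \<Rightarrow> ('n::finite) state \<Rightarrow> 'n state" where
  "hamiltonian A B h \<psi> = (\<lambda>k.
      \<i> / 2 * (bilin_op creat A creat \<psi> k - bilin_op annih (cnj_mat A) annih \<psi> k)
    + bilin_op creat B annih \<psi> k
    + \<i> * lin_op creat h \<psi> k - \<i> * lin_op annih (cnj_vec h) \<psi> k)"


section \<open>Unitary groups and operator exponentials\<close>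

text \<open>By polarization an isometric linear surjection preserves the inner product.\<close>

definition unitary_op :: "(('n::finite) state \<Rightarrow> 'n state) \<Rightarrow> bool" where
  "unitary_op V \<longleftrightarrow> V ` fock = fock
     \<and> (\<forall>\<phi>\<in>fock. \<forall>\<psi>\<in>fock. \<forall>c. V (\<lambda>k. c * \<phi> k + \<psi> k) = (\<lambda>k. c * V \<phi> k + V \<psi> k))
     \<and> (\<forall>\<psi>\<in>fock. fock_norm (V \<psi>) = fock_norm \<psi>)"

definition unitary_group :: "(real \<Rightarrow> ('n::finite) state \<Rightarrow> 'n state) \<Rightarrow> bool" where
  "unitary_group U \<longleftrightarrow> (\<forall>t. unitary_op (U t))
     \<and> (\<forall>\<psi>\<in>fock. U 0 \<psi> = \<psi>)
     \<and> (\<forall>s t. \<forall>\<psi>\<in>fock. U (s + t) \<psi> = U s (U t \<psi>))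
     \<and> (\<forall>\<psi>\<in>fock. ((\<lambda>t. fock_norm (\<lambda>k. U t \<psi> k - \<psi> k)) \<longlongrightarrow> 0) (at 0))"

text \<open>The graph of the self-adjoint operator \<open>H\<close> with \<open>U t = e\<^sup>i\<^sup>H\<^sup>t\<close> (Stone's theorem).\<close>

definition stone_generator ::
    "(real \<Rightarrow> ('n::finite) state \<Rightarrow> 'n state) \<Rightarrow> ('n state \<times> 'n state) set" where
  "stone_generator U = {(\<psi>, \<eta>). \<psi> \<in> fock \<and> \<eta> \<in> fock
     \<and> ((\<lambda>t. fock_norm (\<lambda>k. (U t \<psi> k - \<psi> k) / (\<i> * of_real t) - \<eta> k)) \<longlongrightarrow> 0) (at 0)}"

text \<open>The formal expression \<open>H\<close>, with the finite states as its initial domain, is realised by the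
  self-adjoint generator of \<open>U\<close>. (A Hamiltonian that is quadratic in the creation and annihilation
  operators is essentially self-adjoint on the finite states, so its closure is the only
  self-adjoint extension; this is not needed as an assumption.)\<close>

definition generated_by ::
    "(real \<Rightarrow> ('n::finite) state \<Rightarrow> 'n state) \<Rightarrow> ('n state \<Rightarrow> 'n state) \<Rightarrow> bool" where
  "generated_by U H \<longleftrightarrow> unitary_group U \<and> (\<forall>\<psi>\<in>finite_states. (\<psi>, H \<psi>) \<in> stone_generator U)"

text \<open>The graph of \<open>e\<^sup>X\<close>: pairs \<open>(\<psi>, \<phi>)\<close> for which the exponential series applied to \<open>\<psi>\<close> makes
  sense in the Hilbert space and converges in norm to \<open>\<phi>\<close>.\<close>

definition op_exp :: "(('n::finite) state \<Rightarrow> 'n state) \<Rightarrow> ('n state \<times> 'n state) set" where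
  "op_exp X = {(\<psi>, \<phi>). (\<forall>m. (X ^^ m) \<psi> \<in> fock) \<and> \<phi> \<in> fock
     \<and> (\<lambda>N. fock_norm (\<lambda>k. (\<Sum>m<N. (X ^^ m) \<psi> k / fact m) - \<phi> k)) \<longlonglongrightarrow> 0}"

text \<open>The graph of the normally ordered product
  \<open>e\<^bsup>-(a\<^sup>\<dagger>,Ra\<^sup>\<dagger>)/2-(g,a\<^sup>\<dagger>)\<^esup> e\<^bsup>(a\<^sup>\<dagger>,Ca)\<^esup> e\<^bsup>(a,Sa)/2+(v,a)\<^esup>\<close>; the rightmost factor acts first, and
  relation composition lists factors in the order in which they act.\<close>

definition normal_product ::
    "complex^'n^'n \<Rightarrow> complex^'n \<Rightarrow> complex^'n^'n \<Rightarrow> complex^'n^'n \<Rightarrow> complex^'n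
      \<Rightarrow> (('n::finite) state \<times> 'n state) set" where
  "normal_product R g C S v =
       op_exp (\<lambda>\<psi> k. bilin_op annih S annih \<psi> k / 2 + lin_op annih v \<psi> k)
     O op_exp (bilin_op creat C annih)
     O op_exp (\<lambda>\<psi> k. - bilin_op creat R creat \<psi> k / 2 - lin_op creat g \<psi> k)"

end

theory Submission
  imports Defs
begin

text \<open>Conjugation by \<open>U\<^sub>t\<close> turns \<open>a\<close> and \<open>a\<^sup>\<dagger>\<close> into linear fields \<open>\<beta>\<close> and \<open>b\<close> whose coefficients are the
  blocks of \<open>e\<^sup>G\<^sup>t\<close> and \<open>h\<^sub>t\<close>. The coefficients \<open>R\<^sub>t\<close> and \<open>g\<^sub>t\<close> are such that the Gaussian vector
  \<open>\<eta>\<^sub>t\<close> obtained from the vacuum by the creation factor is annihilated by \<open>\<beta>\<close>; hence, up to a scalar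
  \<open>exp s\<^sub>t\<close>, it solves the Schroedinger equation. The fields \<open>b\<close> map solutions to solutions, and the
  normally ordered product intertwines \<open>a\<^sup>\<dagger>\<close> with \<open>b\<close>, so both sides of the decomposition solve the
  Schroedinger equation with the same finite initial state. Solutions are unique
  because the flux through the shell of \<open>N\<close> particles grows at most like \<open>N\<close> while the harmonic series
  diverges. The symplectic relations give \<open>\<Phi>\<^sub>t\<close> invertible and the norm of \<open>R\<^sub>t\<close> below \<open>1\<close>, whence
  geometric decay in the particle number and convergence of all the series in norm.\<close>

section \<open>Calculus of complex matrices\<close>

lemma matrix_mult_scaleR_left: "(c *\<^sub>R X) ** Y = c *\<^sub>R (X ** Y)"
  for X :: "complex^'m^'n" and Y :: "complex^'l^'m"
  by (simp add: scalar_matrix_assoc)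

lemma matrix_mult_scaleR_right: "X ** (c *\<^sub>R Y) = c *\<^sub>R (X ** Y)"
  for X :: "complex^'m^'n" and Y :: "complex^'l^'m"
  by (metis matrix_scalar_ac scalar_matrix_assoc)

lemma matrix_add_rdistrib: "(X + Z) ** Y = X ** Y + Z ** Y"
  for X :: "complex^'m^'n" and Y :: "complex^'l^'m"
  by (simp add: matrix_matrix_mult_def vec_eq_iff sum.distrib distrib_right)

lemma matrix_mult_minus_left: "(- X) ** Y = - (X ** Y)"
  for X :: "complex^'m^'n" and Y :: "complex^'l^'m"
  using matrix_mult_scaleR_left[of "-1" X Y] by simp

lemma matrix_mult_minus_right: "X ** (- Y) = - (X ** Y)"
  for X :: "complex^'m^'n" and Y :: "complex^'l^'m"
  using matrix_mult_scaleR_right[of X "-1" Y] by simp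

lemma matrix_mult_diff_left: "(X - Z) ** Y = X ** Y - Z ** Y"
  for X :: "complex^'m^'n" and Y :: "complex^'l^'m"
  using matrix_add_rdistrib[of X "- Z" Y] by (simp add: matrix_mult_minus_left)

lemma matrix_mult_diff_right: "X ** (Y - Z) = X ** Y - X ** Z"
  for X :: "complex^'m^'n" and Y :: "complex^'l^'m"
  using matrix_add_ldistrib[of X Y "- Z"] by (simp add: matrix_mult_minus_right)

lemma matrix_mult_zero_left: "0 ** X = 0" for X :: "complex^'m^'n"
  by (simp add: matrix_matrix_mult_def vec_eq_iff)

lemma matrix_mult_zero_right: "X ** 0 = 0" for X :: "complex^'m^'n"
  by (simp add: matrix_matrix_mult_def vec_eq_iff)

lemmas matrix_ring_simps = matrix_mult_scaleR_left matrix_mult_scaleR_right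
  matrix_mult_minus_left matrix_mult_minus_right matrix_mult_diff_left matrix_mult_diff_right
  matrix_mult_zero_left matrix_mult_zero_right matrix_add_ldistrib matrix_add_rdistrib

lemma bounded_bilinear_matrix_mult:
  "bounded_bilinear ((**) :: complex^'m^'n \<Rightarrow> complex^'l^'m \<Rightarrow> complex^'l^'n)"
  unfolding bilinear_conv_bounded_bilinear[symmetric] bilinear_def
  by (auto intro!: linearI simp: matrix_ring_simps)

lemma matrix_vector_scaleR: "(c *\<^sub>R X) *v x = c *\<^sub>R (X *v x)"
  for X :: "complex^'m^'n"
  by (simp add: matrix_vector_mult_def vec_eq_iff scaleR_sum_right)

lemma matrix_vector_mult_scaleR_right: "X *v (c *\<^sub>R x) = c *\<^sub>R (X *v x)"
  for X :: "complex^'m^'n"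
  by (simp add: matrix_vector_mult_def vec_eq_iff scaleR_sum_right)

lemma bounded_bilinear_matrix_vector_mult:
  "bounded_bilinear ((*v) :: complex^'m^'n \<Rightarrow> complex^'m \<Rightarrow> complex^'n)"
  unfolding bilinear_conv_bounded_bilinear[symmetric] bilinear_def
  by (auto intro!: linearI simp: matrix_vector_scaleR matrix_vector_mult_add_rdistrib
    matrix_vector_right_distrib matrix_vector_mult_scaleR_right)

interpretation mm: bounded_bilinear
  "(**) :: complex^'m^'n \<Rightarrow> complex^'l^'m \<Rightarrow> complex^'l^'n"
  by (rule bounded_bilinear_matrix_mult)

interpretation mv: bounded_bilinear
  "(*v) :: complex^'m^'n \<Rightarrow> complex^'m \<Rightarrow> complex^'n"
  by (rule bounded_bilinear_matrix_vector_mult)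

lemma bounded_linear_entry: "bounded_linear (\<lambda>X :: complex^'m^'n. X $ i $ j)"
  by (rule bounded_linear_compose[OF bounded_linear_vec_nth bounded_linear_vec_nth])

lemma norm_mat_pow_bound:
  fixes M :: "complex^'n^'n"
  obtains L r where "L > 0" "r > 0" "\<And>k. norm (mat_pow M k) \<le> L * r ^ k"
proof -
  obtain K where K: "K > 0" "\<And>(X :: complex^'n^'n) (Y :: complex^'n^'n). norm (X ** Y) \<le> norm X * norm Y * K"
    using mm.pos_bounded by blast
  define L where "L = norm (mat 1 :: complex^'n^'n) + 1"
  define r where "r = norm M * K + 1"
  have "L > 0" "r > 0"
    using K(1) by (auto simp: L_def r_def intro: add_nonneg_pos)
  moreover have "norm (mat_pow M k) \<le> L * r ^ k" for k
  proof (induction k)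
    case 0
    then show ?case by (simp add: L_def)
  next
    case (Suc k)
    have "norm (mat_pow M (Suc k)) \<le> norm M * K * norm (mat_pow M k)"
      using K(2)[of M "mat_pow M k"] by (simp add: ac_simps)
    also have "\<dots> \<le> r * (L * r ^ k)"
      using Suc \<open>r > 0\<close> K(1) by (intro mult_mono) (auto simp: r_def)
    finally show ?case by (simp add: ac_simps)
  qed
  ultimately show ?thesis using that by blast
qed

lemma powser_has_vector_derivative:
  fixes c :: "nat \<Rightarrow> 'a :: euclidean_space"
  assumes "\<And>k. norm (c k) \<le> L * r ^ k / fact k"
  shows "summable (\<lambda>k. t ^ k *\<^sub>R c k)"
    and "summable (\<lambda>k. t ^ k *\<^sub>R (real (Suc k) *\<^sub>R c (Suc k)))"
    and "((\<lambda>t. \<Sum>k. t ^ k *\<^sub>R c k) has_vector_derivative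
           (\<Sum>k. t ^ k *\<^sub>R (real (Suc k) *\<^sub>R c (Suc k)))) (at t)"
proof -
  have ex: "summable (\<lambda>k. L * ((\<bar>t\<bar> * r) ^ k / fact k))" for t
    using summable_exp[of "\<bar>t\<bar> * r"] by (intro summable_mult) (simp add: field_simps)
  show S: "summable (\<lambda>k. t ^ k *\<^sub>R c k)" for t
  proof (rule summable_comparison_test'[OF ex[of t], of 0])
    fix k
    have "norm (t ^ k *\<^sub>R c k) \<le> \<bar>t\<bar> ^ k * (L * r ^ k / fact k)"
      unfolding norm_scaleR real_norm_def power_abs by (intro mult_left_mono assms) simp
    then show "norm (t ^ k *\<^sub>R c k) \<le> L * ((\<bar>t\<bar> * r) ^ k / fact k)"
      by (simp add: power_mult_distrib field_simps)
  qed
  have r0: "summable (\<lambda>k. t ^ k *\<^sub>R (real (Suc k) *\<^sub>R c (Suc k)))" for t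
  proof (rule summable_comparison_test'[OF summable_mult[OF ex[of t], of "r"], of 0])
    fix k
    have "real (Suc k) * norm (c (Suc k)) \<le> real (Suc k) * (L * r ^ Suc k / fact (Suc k))"
      using assms[of "Suc k"] by (intro mult_left_mono) auto
    also have "\<dots> = L * r ^ Suc k / fact k"
      by (simp add: field_simps del: of_nat_Suc)
    finally have "norm (t ^ k *\<^sub>R (real (Suc k) *\<^sub>R c (Suc k))) \<le> \<bar>t\<bar> ^ k * (L * r ^ Suc k / fact k)"
      by (simp add: power_abs abs_mult mult.assoc mult_left_mono del: of_nat_Suc power_Suc times_divide_eq_right)
    then show "norm (t ^ k *\<^sub>R (real (Suc k) *\<^sub>R c (Suc k))) \<le> r * (L * ((\<bar>t\<bar> * r) ^ k / fact k))"
      by (simp add: power_mult_distrib field_simps)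
  qed
  show "summable (\<lambda>k. t ^ k *\<^sub>R (real (Suc k) *\<^sub>R c (Suc k)))" by (rule r0)
  show "((\<lambda>t. \<Sum>k. t ^ k *\<^sub>R c k) has_vector_derivative
           (\<Sum>k. t ^ k *\<^sub>R (real (Suc k) *\<^sub>R c (Suc k)))) (at t)"
    unfolding has_vector_derivative_def
  proof (subst has_derivative_componentwise_within, rule ballI)
    fix b :: 'a assume "b \<in> Basis"
    have eq: "(\<Sum>k. x ^ k *\<^sub>R c k) \<bullet> b = (\<Sum>k. (c k \<bullet> b) * x ^ k)" for x
      using bounded_linear.suminf[OF bounded_linear_inner_left S[of x], of b]
      by (simp add: ac_simps)
    have eq': "(\<Sum>k. x ^ k *\<^sub>R (real (Suc k) *\<^sub>R c (Suc k))) \<bullet> b = (\<Sum>k. diffs (\<lambda>k. c k \<bullet> b) k * x ^ k)" for x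
      using bounded_linear.suminf[OF bounded_linear_inner_left r0[of x], of b]
      by (simp add: ac_simps diffs_def del: of_nat_Suc)
    have sm: "summable (\<lambda>k. (c k \<bullet> b) * x ^ k)" for x
      using bounded_linear.summable[OF bounded_linear_inner_left S[of x], of b]
      by (simp add: ac_simps)
    have "((\<lambda>x. \<Sum>k. (c k \<bullet> b) * x ^ k) has_real_derivative (\<Sum>k. diffs (\<lambda>k. c k \<bullet> b) k * t ^ k)) (at t)"
      by (rule termdiffs_strong_converges_everywhere[OF sm])
    then show "((\<lambda>x. (\<Sum>k. x ^ k *\<^sub>R c k) \<bullet> b) has_derivative
        (\<lambda>x. (x *\<^sub>R (\<Sum>k. t ^ k *\<^sub>R (real (Suc k) *\<^sub>R c (Suc k)))) \<bullet> b)) (at t)"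
      unfolding eq inner_scaleR_left eq'
      by (simp add: has_field_derivative_def mult_commute_abs)
  qed
qed

lemma mat_pow_scaleR: "mat_pow (t *\<^sub>R M) k = t ^ k *\<^sub>R mat_pow M k"
  by (induction k) (simp_all add: matrix_ring_simps)

lemma mat_pow_commute: "X ** M = M ** X \<Longrightarrow> X ** mat_pow M k = mat_pow M k ** X"
  by (induction k) (simp_all, metis matrix_mul_assoc)

lemma mat_exp_coeff_bound:
  fixes M :: "complex^'n^'n"
  shows "\<exists>L r. \<forall>k. norm ((1 / fact k) *\<^sub>R mat_pow M k) \<le> L * r ^ k / fact k
    \<and> norm (case k of 0 \<Rightarrow> 0 | Suc k \<Rightarrow> (1 / fact (Suc k)) *\<^sub>R mat_pow M k) \<le> L * r ^ k / fact k"
proof -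
  obtain L r where Lr: "L > 0" "r > 0" and b: "\<And>k. norm (mat_pow M k) \<le> L * r ^ k"
    using norm_mat_pow_bound[of M] by blast
  have "norm (mat_pow M k) \<le> L * (r+1) ^ k" for k
    using b[of k] Lr power_mono[of r "r+1" k] by (smt (verit) mult_left_mono)
  moreover have "norm (mat_pow M k) \<le> L * (r+1) ^ Suc k" for k
    using calculation[of k] Lr power_increasing[of k "Suc k" "r + 1"] by (smt (verit) lessI less_imp_le mult_left_mono)
  ultimately show ?thesis using Lr
    by (intro exI[of _ L] exI[of _ "r+1"]) (auto simp: divide_right_mono split: nat.split simp del: fact_Suc power_Suc)
qed

lemma mat_exp_scaleR: "mat_exp (t *\<^sub>R M) = (\<Sum>k. t ^ k *\<^sub>R ((1 / fact k) *\<^sub>R mat_pow M k))"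
  by (simp add: mat_exp_def mat_pow_scaleR)

lemma summable_mat_exp_scaleR: "summable (\<lambda>k. t ^ k *\<^sub>R ((1 / fact k) *\<^sub>R mat_pow M k))"
proof -
  obtain L r where "\<forall>k. norm ((1 / fact k) *\<^sub>R mat_pow M k) \<le> L * r ^ k / fact k"
    using mat_exp_coeff_bound[of M] by auto
  then show ?thesis by (intro powser_has_vector_derivative(1)) auto
qed

lemma mat_exp_sums: "(\<lambda>k. (1 / fact k) *\<^sub>R mat_pow M k) sums mat_exp M"
  using summable_mat_exp_scaleR[of 1 M] by (simp add: mat_exp_def summable_sums)

lemma mat_exp_commute:
  assumes "X ** M = M ** X" shows "X ** mat_exp M = mat_exp M ** X"
proof -
  have "(\<lambda>k. X ** ((1 / fact k) *\<^sub>R mat_pow M k)) sums (X ** mat_exp M)"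
    by (rule bounded_linear.sums[OF mm.bounded_linear_right mat_exp_sums])
  moreover have "(\<lambda>k. ((1 / fact k) *\<^sub>R mat_pow M k) ** X) sums (mat_exp M ** X)"
    by (rule bounded_linear.sums[OF mm.bounded_linear_left mat_exp_sums])
  ultimately show ?thesis
    by (simp add: matrix_ring_simps mat_pow_commute[OF assms] sums_unique2)
qed

lemma mat_exp_has_vector_derivative:
  "((\<lambda>t. mat_exp (t *\<^sub>R M)) has_vector_derivative M ** mat_exp (t *\<^sub>R M)) (at t)"
proof -
  obtain L r where *: "\<forall>k. norm ((1 / fact k) *\<^sub>R mat_pow M k) \<le> L * r ^ k / fact k"
    using mat_exp_coeff_bound[of M] by auto
  from powser_has_vector_derivative(3)[OF *[rule_format], of t]
  have "((\<lambda>t. mat_exp (t *\<^sub>R M)) has_vector_derivative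
      (\<Sum>k. t ^ k *\<^sub>R (real (Suc k) *\<^sub>R ((1 / fact (Suc k)) *\<^sub>R mat_pow M (Suc k))))) (at t)"
    by (simp only: mat_exp_scaleR)
  also have "(\<lambda>k. t ^ k *\<^sub>R (real (Suc k) *\<^sub>R ((1 / fact (Suc k)) *\<^sub>R mat_pow M (Suc k))))
      = (\<lambda>k. M ** (t ^ k *\<^sub>R ((1 / fact k) *\<^sub>R mat_pow M k)))"
    by (simp add: matrix_ring_simps field_simps fun_eq_iff del: of_nat_Suc)
  also have "(\<Sum>k. M ** (t ^ k *\<^sub>R ((1 / fact k) *\<^sub>R mat_pow M k))) = M ** mat_exp (t *\<^sub>R M)"
    unfolding mat_exp_scaleR
    by (rule bounded_linear.suminf[OF mm.bounded_linear_right, symmetric])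
       (rule summable_mat_exp_scaleR)
  finally show ?thesis .
qed

lemma mat_exp_0: "mat_exp 0 = mat 1"
proof -
  have "mat_exp (0 *\<^sub>R (0 :: complex^'n^'n)) = (mat 1 :: complex^'n^'n)"
    unfolding mat_exp_scaleR by (subst suminf_finite[of "{0}"]) auto
  then show ?thesis by simp
qed

lemma has_vector_derivative_zero_imp_eq:
  fixes f :: "real \<Rightarrow> 'a :: real_normed_vector"
  assumes "\<And>x. (f has_vector_derivative 0) (at x)" shows "f x = f y"
  using has_vector_derivative_zero_constant[of UNIV f] assms by (metis UNIV_I convex_UNIV)

lemma has_vector_derivative_quotient:
  "(f has_vector_derivative D) (at t) \<longleftrightarrow> ((\<lambda>s. (f s - f t) /\<^sub>R (s - t)) \<longlongrightarrow> D) (at t)"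
proof -
  have *: "norm ((f s - f t) /\<^sub>R (s - t) - D) = norm (f s - f t - (s - t) *\<^sub>R D) / norm (s - t)"
    if "s \<noteq> t" for s
  proof -
    have "(f s - f t) /\<^sub>R (s - t) - D = (f s - f t - (s - t) *\<^sub>R D) /\<^sub>R (s - t)"
      using that by (simp add: scaleR_diff_right)
    then show ?thesis by (simp add: divide_inverse mult.commute)
  qed
  have "((\<lambda>s. (f s - f t) /\<^sub>R (s - t)) \<longlongrightarrow> D) (at t)
      \<longleftrightarrow> ((\<lambda>s. norm ((f s - f t) /\<^sub>R (s - t) - D)) \<longlongrightarrow> 0) (at t)"
    by (simp add: tendsto_norm_zero_iff LIM_zero_iff)
  also have "\<dots> \<longleftrightarrow> ((\<lambda>s. norm (f s - f t - (s - t) *\<^sub>R D) / norm (s - t)) \<longlongrightarrow> 0) (at t)"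
    by (rule filterlim_cong) (auto simp: eventually_at_filter *)
  finally show ?thesis
    by (simp add: has_vector_derivative_def has_derivative_iff_norm bounded_linear_scaleR_left)
qed

lemma mm_has_vector_derivative:
  fixes f :: "real \<Rightarrow> complex^'l^'m" and g :: "real \<Rightarrow> complex^'n^'l"
  assumes "(f has_vector_derivative f') (at t)" "(g has_vector_derivative g') (at t)"
  shows "((\<lambda>t. f t ** g t) has_vector_derivative (f t ** g' + f' ** g t)) (at t)"
  using mm.has_vector_derivative[OF assms] .

lemma mat_exp_minus_scaleR: "mat_exp (t *\<^sub>R M) ** mat_exp ((-t) *\<^sub>R M) = mat 1"
proof -
  have d: "((\<lambda>t. mat_exp ((-t) *\<^sub>R M)) has_vector_derivative - (M ** mat_exp ((-t) *\<^sub>R M))) (at t)" for t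
    using mat_exp_has_vector_derivative[of "- M" t] by (simp add: matrix_ring_simps)
  have c: "M ** mat_exp (t *\<^sub>R M) = mat_exp (t *\<^sub>R M) ** M" for t
    by (rule mat_exp_commute) (simp add: matrix_ring_simps)
  have "((\<lambda>t. mat_exp (t *\<^sub>R M) ** mat_exp ((-t) *\<^sub>R M)) has_vector_derivative 0) (at t)" for t
    using mm_has_vector_derivative[OF mat_exp_has_vector_derivative[of M t] d[of t]]
    by (simp add: matrix_ring_simps matrix_mul_assoc c[of t] del: scaleR_minus_left)
  from has_vector_derivative_zero_imp_eq[OF this, of t 0] show ?thesis
    by (simp add: mat_exp_0)
qed

lemma mat_exp_minus: "mat_exp M ** mat_exp (- M) = mat 1" "mat_exp (- M) ** mat_exp M = mat 1"
  using mat_exp_minus_scaleR[of 1 M] mat_exp_minus_scaleR[of "-1" M] by simp_all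

lemma mat_exp_add_commuting:
  fixes X Y :: "complex^'n^'n"
  assumes XY: "X ** Y = Y ** X"
  shows "mat_exp (X + Y) = mat_exp X ** mat_exp Y"
proof -
  define E F where "E = (\<lambda>t. mat_exp (t *\<^sub>R (- X)))" and "F = (\<lambda>t. mat_exp (t *\<^sub>R (- Y)))"
  define D where "D = (\<lambda>t. mat_exp (t *\<^sub>R (X + Y)))"
  have dE: "(E has_vector_derivative (- X) ** E t) (at t)" and dF: "(F has_vector_derivative (- Y) ** F t) (at t)"
    and dD: "(D has_vector_derivative (X + Y) ** D t) (at t)" for t
    unfolding E_def F_def D_def by (rule mat_exp_has_vector_derivative)+
  have cE: "Z ** E t = E t ** Z" if "Z ** X = X ** Z" for Z t
    unfolding E_def using that by (intro mat_exp_commute) (simp add: matrix_ring_simps)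
  have cF: "Z ** F t = F t ** Z" if "Z ** Y = Y ** Z" for Z t
    unfolding F_def using that by (intro mat_exp_commute) (simp add: matrix_ring_simps)
  have EF: "((\<lambda>t. F t ** E t) has_vector_derivative - ((X + Y) ** (F t ** E t))) (at t)" for t
    using mm_has_vector_derivative[OF dF dE, of t]
    by (simp add: matrix_ring_simps matrix_mul_assoc cF[OF XY] algebra_simps)
  have cEF: "(X + Y) ** (F t ** E t) = (F t ** E t) ** (X + Y)" for t
  proof -
    have "(X + Y) ** F t = F t ** (X + Y)" "(X + Y) ** E t = E t ** (X + Y)"
      by (intro cF cE; simp add: matrix_ring_simps XY)+
    then show ?thesis by (metis matrix_mul_assoc)
  qed
  have "((\<lambda>t. F t ** E t ** D t) has_vector_derivative 0) (at t)" for t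
    using mm_has_vector_derivative[OF EF dD, of t]
    by (simp only: matrix_mult_minus_left cEF) (simp add: matrix_mul_assoc)
  from has_vector_derivative_zero_imp_eq[OF this, of 1 0]
  have "F 1 ** E 1 ** D 1 = mat 1" by (simp add: E_def F_def D_def mat_exp_0)
  then have "mat_exp (- Y) ** mat_exp (- X) ** mat_exp (X + Y) = mat 1"
    by (simp add: E_def F_def D_def)
  then have "mat_exp X ** (mat_exp Y ** mat_exp (- Y)) ** mat_exp (- X) ** mat_exp (X + Y) = mat_exp X ** mat_exp Y"
    by (metis matrix_mul_assoc matrix_mul_rid)
  then show ?thesis by (simp add: mat_exp_minus)
qed


lemma mat_exp_remainder:
  obtains c where "\<And>X :: complex^'n^'n. norm X \<le> 1 \<Longrightarrow> norm (mat_exp X - mat 1 - X) \<le> c * (norm X)\<^sup>2"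
proof -
  obtain K where K: "K > 0" "\<And>(X :: complex^'n^'n) (Y :: complex^'n^'n). norm (X ** Y) \<le> norm X * norm Y * K"
    using mm.pos_bounded by blast
  define N where "N = norm (mat 1 :: complex^'n^'n)"
  have b: "norm (mat_pow X k) \<le> N * (norm X * K) ^ k" for X :: "complex^'n^'n" and k
  proof (induction k)
    case (Suc k)
    have "norm (mat_pow X (Suc k)) \<le> norm X * K * norm (mat_pow X k)"
      using K(2)[of X "mat_pow X k"] by (simp add: ac_simps)
    also have "\<dots> \<le> norm X * K * (N * (norm X * K) ^ k)"
      using Suc K(1) by (intro mult_left_mono) auto
    finally show ?case by (simp add: ac_simps)
  qed (simp add: N_def)
  show ?thesis
  proof (rule that)
    fix X :: "complex^'n^'n" assume X: "norm X \<le> 1"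
    have 1: "(\<lambda>k. (1 / fact (k + 2)) *\<^sub>R mat_pow X (k + 2)) sums (mat_exp X - mat 1 - X)"
      using sums_split_initial_segment[OF mat_exp_sums[of X], of 2]
      by (simp add: numeral_2_eq_2 algebra_simps)
    have 2: "(\<lambda>k. N * (norm X)\<^sup>2 * K\<^sup>2 * (K ^ k / fact k)) sums (N * (norm X)\<^sup>2 * K\<^sup>2 * exp K)"
      using exp_converges[of K] by (intro sums_mult) (simp add: field_simps)
    have 3: "norm ((1 / fact (k + 2)) *\<^sub>R mat_pow X (k + 2)) \<le> N * (norm X)\<^sup>2 * K\<^sup>2 * (K ^ k / fact k)" for k
    proof -
      have "norm (mat_pow X (k + 2)) \<le> N * (norm X * K) ^ (k + 2)" by (rule b)
      also have "\<dots> = N * K ^ (k+2) * (norm X)\<^sup>2 * norm X ^ k"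
        by (simp add: power_mult_distrib power_add power2_eq_square)
      also have "\<dots> \<le> N * K ^ (k+2) * (norm X)\<^sup>2 * 1"
        using K(1) X by (intro mult_left_mono power_le_one) (auto simp: N_def)
      finally have "norm (mat_pow X (k + 2)) / fact (k + 2) \<le> N * K ^ (k+2) * (norm X)\<^sup>2 / fact (k + 2)"
        by (intro divide_right_mono) auto
      also have "\<dots> \<le> N * K ^ (k+2) * (norm X)\<^sup>2 / fact k"
        using K(1) by (intro divide_left_mono fact_mono) (auto simp: N_def simp del: fact_Suc)
      finally show ?thesis by (simp add: power_add power2_eq_square field_simps)
    qed
    have "norm (mat_exp X - mat 1 - X) \<le> N * (norm X)\<^sup>2 * K\<^sup>2 * exp K"
      by (rule norm_sums_le[OF 1 2 3])
    then show "norm (mat_exp X - mat 1 - X) \<le> (N * K\<^sup>2 * exp K) * (norm X)\<^sup>2"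
      by (simp only: ac_simps)
  qed
qed

lemma mat_exp_commuting_path:
  fixes C :: "real \<Rightarrow> complex^'n^'n"
  assumes C: "(C has_vector_derivative L) (at t)" and comm: "\<And>s t. C s ** C t = C t ** C s"
  shows "((\<lambda>t. mat_exp (C t)) has_vector_derivative mat_exp (C t) ** L) (at t)"
proof -
  obtain c where c: "\<And>X :: complex^'n^'n. norm X \<le> 1 \<Longrightarrow> norm (mat_exp X - mat 1 - X) \<le> c * (norm X)\<^sup>2"
    using mat_exp_remainder by blast
  have c0: "0 \<le> \<bar>c\<bar>" by simp
  define Y where "Y s = C s - C t" for s
  have e0: "(mat_exp has_derivative (\<lambda>X. X)) (at (0 :: complex^'n^'n))"
    unfolding has_derivative_at
  proof (intro conjI bounded_linear_ident)
    have "\<forall>\<^sub>F X in at (0 :: complex^'n^'n). norm X < 1"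
      by (rule eventually_at_ball'[of 1 0 UNIV, THEN eventually_mono]) (auto simp: dist_norm)
    moreover have "norm (norm (mat_exp (0 + X) - mat_exp 0 - X) / norm X) \<le> \<bar>c\<bar> * norm X"
      if "norm X < 1" for X :: "complex^'n^'n"
    proof -
      have "norm (mat_exp X - mat 1 - X) \<le> c * (norm X)\<^sup>2" using c[of X] that by simp
      also have "\<dots> \<le> \<bar>c\<bar> * (norm X)\<^sup>2" by (intro mult_right_mono) auto
      finally show ?thesis by (cases "X = 0") (auto simp: mat_exp_0 field_simps power2_eq_square)
    qed
    ultimately have ev: "\<forall>\<^sub>F X in at (0 :: complex^'n^'n).
        norm (norm (mat_exp (0 + X) - mat_exp 0 - X) / norm X) \<le> \<bar>c\<bar> * norm X"
      by (rule eventually_mono)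
    have lim: "((\<lambda>X. \<bar>c\<bar> * norm X) \<longlongrightarrow> 0) (at (0 :: complex^'n^'n))"
      by (auto intro!: tendsto_eq_intros)
    show "(\<lambda>X :: complex^'n^'n. norm (mat_exp (0 + X) - mat_exp 0 - X) / norm X) \<midarrow>0\<rightarrow> (0 :: real)"
      by (rule Lim_null_comparison[OF ev lim])
  qed
  have "(Y has_derivative (\<lambda>x. x *\<^sub>R L)) (at t)"
    using C unfolding Y_def has_vector_derivative_def by (auto intro!: derivative_eq_intros)
  then have "((\<lambda>s. mat_exp (Y s)) has_derivative (\<lambda>x. x *\<^sub>R L)) (at t)"
    using has_derivative_compose[of Y "\<lambda>x. x *\<^sub>R L" t UNIV mat_exp "\<lambda>x. x"] e0 by (simp add: Y_def)
  then have "((\<lambda>s. mat_exp (C t) ** mat_exp (Y s)) has_vector_derivative mat_exp (C t) ** L) (at t)"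
    using mm_has_vector_derivative[OF has_vector_derivative_const, of _ L t "mat_exp (C t)"]
    by (simp add: has_vector_derivative_def matrix_ring_simps)
  moreover have "mat_exp (C t) ** mat_exp (Y s) = mat_exp (C s)" for s
    using mat_exp_add_commuting[of "C t" "Y s"] by (simp add: Y_def matrix_ring_simps comm)
  ultimately show ?thesis by simp
qed

lemma matrix_inverse_has_vector_derivative:
  fixes P N :: "real \<Rightarrow> complex^'n^'n"
  assumes P: "(P has_vector_derivative P') (at t)"
    and PN: "\<And>s. P s ** N s = mat 1" and NP: "\<And>s. N s ** P s = mat 1"
  shows "(N has_vector_derivative - (N t ** P' ** N t)) (at t)"
proof -
  obtain K where K: "K > 0" "\<And>(X :: complex^'n^'n) (Y :: complex^'n^'n). norm (X ** Y) \<le> norm X * norm Y * K"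
    using mm.pos_bounded by blast
  have diff: "N s - N t = - (N s ** (P s - P t) ** N t)" for s
    using PN[of t] NP[of s] by (simp add: matrix_ring_simps flip: matrix_mul_assoc)
  have Pc: "(\<lambda>s. P s - P t) \<midarrow>t\<rightarrow> 0"
    using has_vector_derivative_continuous[OF P] by (simp add: isCont_def LIM_zero_iff)
  define e where "e = 1 / (2 * K * K * (norm (N t) + 1))"
  have e: "e > 0" using K by (simp add: e_def add_nonneg_pos)
  have "\<forall>\<^sub>F s in at t. norm (P s - P t) < e"
    using tendstoD[OF Pc e] by (simp add: dist_norm)
  then have bd: "\<forall>\<^sub>F s in at t. norm (N s) \<le> 2 * norm (N t)"
  proof eventually_elim
    case (elim s)
    have "norm (N s) \<le> norm (N t) + norm (N s - N t)" by (metis add.commute diff_add_cancel norm_triangle_ineq)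
    also have "norm (N s - N t) = norm (N s ** (P s - P t) ** N t)" by (simp only: diff norm_minus_cancel)
    also have "\<dots> \<le> norm (N s ** (P s - P t)) * norm (N t) * K" by (rule K)
    also have "\<dots> \<le> (norm (N s) * norm (P s - P t) * K) * norm (N t) * K"
      using K by (intro mult_right_mono) auto
    also have "\<dots> \<le> (norm (N s) * e * K) * (norm (N t) + 1) * K"
      using elim K e by (intro mult_right_mono mult_mono) auto
    also have "\<dots> = norm (N s) * (e * (2 * K * K * (norm (N t) + 1))) / 2" by simp
    also have "e * (2 * K * K * (norm (N t) + 1)) = 1"
    proof -
      have "norm (N t) + 1 \<noteq> 0" using norm_ge_zero[of "N t"] by linarith
      then show ?thesis using K(1) by (simp add: e_def)
    qed
    finally show ?case by simp
  qed
  have Nc: "N \<midarrow>t\<rightarrow> N t"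
  proof -
    have "(\<lambda>s. N s - N t) \<midarrow>t\<rightarrow> 0"
    proof (rule Lim_null_comparison)
      show "\<forall>\<^sub>F s in at t. norm (N s - N t) \<le> 2 * norm (N t) * norm (P s - P t) * K * norm (N t) * K"
        using bd
      proof eventually_elim
        case (elim s)
        have "norm (N s - N t) \<le> norm (N s ** (P s - P t)) * norm (N t) * K" unfolding diff norm_minus_cancel by (rule K)
        also have "\<dots> \<le> (norm (N s) * norm (P s - P t) * K) * norm (N t) * K"
          using K by (intro mult_right_mono) auto
        also have "\<dots> \<le> (2 * norm (N t) * norm (P s - P t) * K) * norm (N t) * K"
          using elim K by (intro mult_right_mono) auto
        finally show ?case by simp
      qed
      show "(\<lambda>s. 2 * norm (N t) * norm (P s - P t) * K * norm (N t) * K) \<midarrow>t\<rightarrow> 0"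
        using tendsto_mult_right_zero[OF tendsto_norm_zero[OF Pc], of "2 * norm (N t) * K * norm (N t) * K"]
        by (simp add: ac_simps)
    qed
    then show ?thesis by (simp add: LIM_zero_iff)
  qed
  have "(\<lambda>s. - (N s ** ((P s - P t) /\<^sub>R (s - t)) ** N t)) \<midarrow>t\<rightarrow> - (N t ** P' ** N t)"
    using P unfolding has_vector_derivative_quotient
    by (intro tendsto_minus mm.tendsto Nc tendsto_const)
  then show ?thesis
    unfolding has_vector_derivative_quotient diff
    by (simp only: matrix_mult_scaleR_left matrix_mult_scaleR_right scaleR_minus_right)
qed

lemma ex_antiderivative:
  fixes f :: "real \<Rightarrow> 'a :: euclidean_space"
  assumes "continuous_on UNIV f"
  obtains F where "\<And>x. (F has_vector_derivative f x) (at x)"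
proof -
  have "\<exists>F. \<forall>x :: real. (-\<infinity> :: ereal) < x \<longrightarrow> x < (\<infinity> :: ereal) \<longrightarrow> (F has_vector_derivative f x) (at x)"
    using assms by (intro einterval_antiderivative) (auto simp: continuous_on_eq_continuous_at)
  then show ?thesis using that by auto
qed

lemma matrix_mult_matrix_inv:
  fixes X :: "complex^'n^'n" assumes "invertible X"
  shows "X ** matrix_inv X = mat 1" "matrix_inv X ** X = mat 1"
  using someI_ex[OF assms[unfolded invertible_def]] by (simp_all add: matrix_inv_def)

lemma mat_mult_commute: "mat c ** X = X ** mat c" for X :: "complex^'n^'n"
  by (simp add: matrix_matrix_mult_def mat_def vec_eq_iff if_distrib if_distribR cong: if_cong)

lemma finite_zeros_det_segment:
  fixes M :: "complex^'n^'n"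
  shows "finite {z. det (mat (1 - z) + mat z ** M) = 0}"
proof -
  define q where "q = (\<Sum>\<sigma> | \<sigma> permutes (UNIV :: 'n set). smult (of_int (sign \<sigma>))
    (\<Prod>i\<in>UNIV. [: mat 1 $ i $ \<sigma> i, M $ i $ \<sigma> i - mat 1 $ i $ \<sigma> i :]))"
  have "(mat (1 - z) + mat z ** M) $ i $ j = poly [: mat 1 $ i $ j, M $ i $ j - mat 1 $ i $ j :] z" for z i j
    by (simp add: matrix_matrix_mult_def mat_def if_distrib if_distribR algebra_simps cong: if_cong)
  then have *: "det (mat (1 - z) + mat z ** M) = poly q z" for z
    by (simp only: q_def det_def poly_sum poly_smult poly_prod)
  have "q \<noteq> 0" using *[of 0] by (auto simp: matrix_mult_zero_left)
  then show ?thesis by (simp add: * poly_roots_finite)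
qed

text \<open>The logarithm is obtained by integrating \<open>P' P\<^sup>-\<^sup>1\<close> along a path \<open>P\<close> from the identity to
  \<open>M\<close> inside the affine complex line through both; the path avoids the finitely many singular
  matrices on that line, and everything commutes with everything.\<close>

lemma ex_mat_log:
  fixes M :: "complex^'n^'n"
  assumes "invertible M"
  shows "\<exists>C. mat_exp (- C) = M"
proof -
  define Z where "Z = {z. det (mat (1 - z) + mat z ** M) = 0}"
  have Z: "finite Z" unfolding Z_def by (rule finite_zeros_det_segment)
  define bad where "bad = (\<lambda>z. Im z / (Re z * (1 - Re z))) ` Z"
  have "\<exists>\<kappa> :: real. \<kappa> \<notin> bad"
    using Z ex_new_if_finite[OF infinite_UNIV_char_0, of bad] by (simp add: bad_def)
  then obtain \<kappa> where \<kappa>: "\<kappa> \<notin> bad" by blast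
  define \<gamma> where "\<gamma> = (\<lambda>\<tau> :: real. Complex \<tau> (\<kappa> * (\<tau> * (1 - \<tau>))))"
  define P where "P = (\<lambda>\<tau>. mat (1 - \<gamma> \<tau>) + mat (\<gamma> \<tau>) ** M)"
  have "\<gamma> \<tau> \<notin> Z" for \<tau>
  proof
    assume a: "\<gamma> \<tau> \<in> Z"
    show False
    proof (cases "\<tau> = 0 \<or> \<tau> = 1")
      case True
      then have "\<gamma> \<tau> = 0 \<or> \<gamma> \<tau> = 1" by (auto simp: \<gamma>_def complex_eq_iff)
      then show False using a assms by (auto simp: Z_def matrix_mult_zero_left invertible_det_nz)
    next
      case False
      then have "\<kappa> = Im (\<gamma> \<tau>) / (Re (\<gamma> \<tau>) * (1 - Re (\<gamma> \<tau>)))" by (simp add: \<gamma>_def)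
      then show False using a \<kappa> by (auto simp: bad_def)
    qed
  qed
  then have inv: "invertible (P \<tau>)" for \<tau>
    by (simp add: Z_def P_def invertible_det_nz)
  define N where "N = (\<lambda>\<tau>. matrix_inv (P \<tau>))"
  have PN: "P \<tau> ** N \<tau> = mat 1" "N \<tau> ** P \<tau> = mat 1" for \<tau>
    using matrix_mult_matrix_inv[OF inv] by (auto simp: N_def)
  define \<gamma>' where "\<gamma>' = (\<lambda>\<tau> :: real. Complex 1 (\<kappa> * (1 - 2 * \<tau>)))"
  define P' where "P' = (\<lambda>\<tau>. mat (\<gamma>' \<tau>) ** (M - mat 1))"
  have blmat: "bounded_linear (mat :: complex \<Rightarrow> complex^'n^'n)"
    by (rule linear_conv_bounded_linear[THEN iffD1], rule linearI) (auto simp: mat_def vec_eq_iff)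
  have \<gamma>d: "(\<gamma> has_vector_derivative \<gamma>' \<tau>) (at \<tau>)" for \<tau>
    unfolding \<gamma>_def \<gamma>'_def has_vector_derivative_complex_iff
    by (auto intro!: derivative_eq_intros simp: algebra_simps)
  have P\<gamma>: "P \<tau> = mat 1 + mat (\<gamma> \<tau>) ** (M - mat 1)" for \<tau>
    using linear_diff[OF bounded_linear.linear[OF blmat], of 1 "\<gamma> \<tau>"]
    by (simp add: P_def matrix_ring_simps)
  have Pd: "(P has_vector_derivative P' \<tau>) (at \<tau>)" for \<tau>
  proof -
    have "bounded_linear (\<lambda>c. (mat c :: complex^'n^'n) ** (M - mat 1))"
      by (rule bounded_linear_compose[OF mm.bounded_linear_left blmat])
    from bounded_linear.has_vector_derivative[OF this \<gamma>d]
    have "((\<lambda>\<tau>. mat 1 + mat (\<gamma> \<tau>) ** (M - mat 1)) has_vector_derivative P' \<tau>) (at \<tau>)"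
      by (auto simp: P'_def intro!: derivative_eq_intros)
    then show ?thesis by (simp add: P\<gamma>[abs_def])
  qed
  have Nc: "continuous_on UNIV N"
    using has_vector_derivative_continuous[OF matrix_inverse_has_vector_derivative[OF Pd PN]]
    by (simp add: continuous_on_eq_continuous_at)
  define L where "L = (\<lambda>\<tau>. P' \<tau> ** N \<tau>)"
  have P'c: "continuous_on UNIV P'"
  proof -
    have "continuous_on UNIV (\<lambda>\<tau>. Complex 1 (\<kappa> * (1 - 2 * \<tau>)))"
      by (intro continuous_intros)
    then show ?thesis unfolding P'_def \<gamma>'_def
      by (intro mm.continuous_on bounded_linear.continuous_on[OF blmat] continuous_intros)
  qed
  have "continuous_on UNIV L"
    unfolding L_def by (intro mm.continuous_on P'c Nc)
  then obtain F where F: "\<And>\<tau>. (F has_vector_derivative L \<tau>) (at \<tau>)"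
    using ex_antiderivative by blast
  define C where "C = (\<lambda>\<tau>. F \<tau> - F 0)"
  have C: "(C has_vector_derivative L \<tau>) (at \<tau>)" for \<tau>
    unfolding C_def using F[of \<tau>] by (auto intro!: derivative_eq_intros)
  have comP: "X ** P \<tau> = P \<tau> ** X" and comP': "X ** P' \<tau> = P' \<tau> ** X" if "X ** M = M ** X" for X \<tau>
  proof -
    have *: "X ** (mat c ** (M - mat 1)) = (mat c ** (M - mat 1)) ** X" for c
    proof -
      have "X ** (mat c ** (M - mat 1)) = mat c ** (X ** (M - mat 1))"
        by (metis mat_mult_commute matrix_mul_assoc)
      also have "X ** (M - mat 1) = (M - mat 1) ** X" by (simp add: matrix_ring_simps that)
      finally show ?thesis by (simp add: matrix_mul_assoc)
    qed
    show "X ** P \<tau> = P \<tau> ** X" "X ** P' \<tau> = P' \<tau> ** X"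
      by (simp_all only: P\<gamma> P'_def matrix_add_ldistrib matrix_add_rdistrib *) simp
  qed
  have comL: "X ** L \<tau> = L \<tau> ** X" if "X ** M = M ** X" for X \<tau>
  proof -
    have "N \<tau> ** (P \<tau> ** X) ** N \<tau> = N \<tau> ** (X ** P \<tau>) ** N \<tau>" by (simp add: comP[OF that])
    then have "X ** N \<tau> = N \<tau> ** X"
      by (metis PN matrix_mul_assoc matrix_mul_lid matrix_mul_rid)
    then show ?thesis unfolding L_def by (metis comP'[OF that] matrix_mul_assoc)
  qed
  have comC: "X ** C \<tau> = C \<tau> ** X" if "X ** M = M ** X" for X \<tau>
  proof -
    have "((\<lambda>\<tau>. X ** C \<tau> - C \<tau> ** X) has_vector_derivative 0) (at \<tau>)" for \<tau>
      using bounded_linear.has_vector_derivative[OF mm.bounded_linear_right C, of X \<tau>]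
        bounded_linear.has_vector_derivative[OF mm.bounded_linear_left C, of X \<tau>]
      by (auto intro!: derivative_eq_intros simp: comL[OF that])
    from has_vector_derivative_zero_imp_eq[OF this, of \<tau> 0]
    show ?thesis by (simp add: C_def matrix_ring_simps)
  qed
  have CC: "C s ** C t = C t ** C s" for s t
    by (intro comC comC[symmetric] refl)
  have PC: "P s ** C t = C t ** P s" for s t
    by (intro comC comP[symmetric] refl)
  define E where "E = (\<lambda>\<tau>. mat_exp (- C \<tau>))"
  have E: "(E has_vector_derivative - (E \<tau> ** L \<tau>)) (at \<tau>)" for \<tau>
    using mat_exp_commuting_path[of "\<lambda>\<tau>. - C \<tau>" "- L \<tau>" \<tau>] has_vector_derivative_minus[OF C[of \<tau>]]
    by (simp add: E_def matrix_ring_simps CC)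
  have "((\<lambda>\<tau>. E \<tau> ** P \<tau>) has_vector_derivative 0) (at \<tau>)" for \<tau>
  proof -
    have "L \<tau> ** P \<tau> = P' \<tau>"
      by (simp add: L_def PN flip: matrix_mul_assoc)
    then show ?thesis
      using mm_has_vector_derivative[OF E Pd, of \<tau>] by (simp add: matrix_ring_simps flip: matrix_mul_assoc)
  qed
  from has_vector_derivative_zero_imp_eq[OF this, of 1 0]
  moreover have "\<gamma> 0 = 0" "\<gamma> 1 = 1" by (auto simp: \<gamma>_def complex_eq_iff)
  ultimately have "E 1 ** P 1 = mat 1" "P 1 = M" by (simp_all add: E_def C_def P_def mat_exp_0 matrix_mult_zero_left)
  then have "mat_exp (C 1) ** (mat_exp (- C 1) ** M) = mat_exp (C 1)" by (simp add: E_def)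
  then have "M = mat_exp (C 1)" by (simp add: matrix_mul_assoc mat_exp_minus)
  then show ?thesis by (intro exI[of _ "- C 1"]) simp
qed

lemma row_mult: "(X ** Y) $ l = X $ l v* Y" for X Y :: "complex^'n^'n"
  by (simp add: vec_eq_iff matrix_matrix_mult_def vector_matrix_mult_def mult.commute)

lemma sum_vector_matrix:
  "(\<Sum>j\<in>UNIV. c $ j * (\<Sum>i\<in>UNIV. M $ j $ i * f i)) = (\<Sum>i\<in>UNIV. (c v* M) $ i * f i)"
  for c :: "complex^'n" and M :: "complex^'n^'n"
proof -
  have "(\<Sum>j\<in>UNIV. c $ j * (\<Sum>i\<in>UNIV. M $ j $ i * f i)) = (\<Sum>j\<in>UNIV. \<Sum>i\<in>UNIV. c $ j * M $ j $ i * f i)"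
    by (simp only: sum_distrib_left mult.assoc)
  also have "\<dots> = (\<Sum>i\<in>UNIV. \<Sum>j\<in>UNIV. c $ j * M $ j $ i * f i)" by (rule sum.swap)
  finally show ?thesis by (simp only: vector_matrix_mult_def vec_lambda_beta sum_distrib_right)
qed

section \<open>The symplectic flow\<close>

lemma exp_quotient_has_vector_derivative:
  "((\<lambda>t. exp_quotient M t) has_vector_derivative mat_exp (t *\<^sub>R M)) (at t)"
  and exp_quotient_sums: "(\<lambda>k. (t ^ Suc k / fact (Suc k)) *\<^sub>R mat_pow M k) sums exp_quotient M t"
proof -
  define c where "c = (\<lambda>k. case k of 0 \<Rightarrow> 0 | Suc k \<Rightarrow> (1 / fact (Suc k)) *\<^sub>R mat_pow M k)"
  obtain L r where *: "\<forall>k. norm (c k) \<le> L * r ^ k / fact k"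
    using mat_exp_coeff_bound[of M] by (auto simp: c_def)
  note p = powser_has_vector_derivative[OF *[rule_format]]
  have s: "(\<lambda>k. (t ^ Suc k / fact (Suc k)) *\<^sub>R mat_pow M k) sums (\<Sum>k. t ^ k *\<^sub>R c k)" for t
    using summable_sums[OF p(1), of t] sums_Suc_iff[of "\<lambda>k. t ^ k *\<^sub>R c k"]
    by (simp add: c_def del: fact_Suc power_Suc)
  then have e: "(\<Sum>k. t ^ k *\<^sub>R c k) = exp_quotient M t" for t
    unfolding exp_quotient_def by (rule sums_unique)
  show "(\<lambda>k. (t ^ Suc k / fact (Suc k)) *\<^sub>R mat_pow M k) sums exp_quotient M t"
    using s[of t] by (simp only: e)
  have "(\<lambda>k. t ^ k *\<^sub>R (real (Suc k) *\<^sub>R c (Suc k))) = (\<lambda>k. t ^ k *\<^sub>R ((1 / fact k) *\<^sub>R mat_pow M k))"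
    by (simp add: c_def fun_eq_iff field_simps del: of_nat_Suc)
  then show "((\<lambda>t. exp_quotient M t) has_vector_derivative mat_exp (t *\<^sub>R M)) (at t)"
    using p(3)[of t] by (simp only: e mat_exp_scaleR)
qed

lemma exp_quotient_0: "exp_quotient M 0 = 0"
  unfolding exp_quotient_def by simp

lemma continuous_on_mat_exp_scaleR: "continuous_on S (\<lambda>t. mat_exp (t *\<^sub>R M))"
  using has_vector_derivative_continuous[OF mat_exp_has_vector_derivative]
  by (intro continuous_at_imp_continuous_on) blast

lemma interval_integral_mat_exp: "(LBINT \<tau>=0..t. mat_exp (\<tau> *\<^sub>R M)) = exp_quotient M t"
  using interval_integral_FTC_finite[of 0 t "\<lambda>\<tau>. mat_exp (\<tau> *\<^sub>R M)" "exp_quotient M"]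
  by (simp add: continuous_on_mat_exp_scaleR exp_quotient_0 zero_ereal_def
      has_vector_derivative_at_within[OF exp_quotient_has_vector_derivative])

lemma interval_integral_mat_exp_vec:
  "(LBINT \<tau>=0..t. mat_exp (\<tau> *\<^sub>R M) *v v) = exp_quotient M t *v v"
  using interval_integral_FTC_finite[of 0 t "\<lambda>\<tau>. mat_exp (\<tau> *\<^sub>R M) *v v" "\<lambda>t. exp_quotient M t *v v"]
  by (simp add: continuous_on_mat_exp_scaleR mv.continuous_on exp_quotient_0 zero_ereal_def
      has_vector_derivative_at_within[OF bounded_linear.has_vector_derivative[OF mv.bounded_linear_left
          exp_quotient_has_vector_derivative]])

lemma interval_integrable_mat_exp:
  "interval_lebesgue_integrable lborel 0 (ereal t) (\<lambda>\<tau>. mat_exp (\<tau> *\<^sub>R M))"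
  unfolding zero_ereal_def using continuous_on_mat_exp_scaleR[of UNIV M]
  by (intro interval_integrable_isCont) (simp add: continuous_on_eq_continuous_at)

lemma matrix_mult_exp_quotient: "M ** exp_quotient M t = mat_exp (t *\<^sub>R M) - mat 1"
proof -
  have "((\<lambda>t. M ** exp_quotient M t - mat_exp (t *\<^sub>R M)) has_vector_derivative 0) (at t)" for t
    using bounded_linear.has_vector_derivative[OF mm.bounded_linear_right
          exp_quotient_has_vector_derivative, of M M t] mat_exp_has_vector_derivative[of M t]
    by (auto intro!: derivative_eq_intros)
  from has_vector_derivative_zero_imp_eq[OF this, of t 0]
  show ?thesis by (simp add: exp_quotient_0 mat_exp_0 algebra_simps)
qed

lemma exp_quotient_invertible:
  assumes "invertible M"
  shows "exp_quotient M t = matrix_inv M ** (mat_exp (t *\<^sub>R M) - mat 1)"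
  by (simp add: matrix_mult_matrix_inv[OF assms] matrix_mul_assoc flip: matrix_mult_exp_quotient)

lemma mat_exp_image:
  fixes M :: "complex^'n^'n" and T :: "complex^'n^'n \<Rightarrow> complex^'n^'n"
  assumes T: "linear T" and "\<And>k. T (mat_pow M k) = mat_pow (T M) k"
  shows "T (mat_exp M) = mat_exp (T M)"
proof -
  interpret T: bounded_linear T using T by (rule linear_conv_bounded_linear[THEN iffD1])
  have "(\<lambda>k. (1 / fact k) *\<^sub>R mat_pow (T M) k) sums T (mat_exp M)"
    using T.sums[OF mat_exp_sums[of M]] by (simp add: T.scaleR assms(2))
  then show ?thesis using mat_exp_sums sums_unique2 by blast
qed

lemma mat_pow_Suc2: "mat_pow M (Suc k) = mat_pow M k ** M"
  by (metis mat_pow.simps(2) mat_pow_commute)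

lemma block_mat_nth [simp]:
  "block_mat P Q R S $ Inl p $ Inl q = P $ p $ q" "block_mat P Q R S $ Inl p $ Inr q = Q $ p $ q"
  "block_mat P Q R S $ Inr p $ Inl q = R $ p $ q" "block_mat P Q R S $ Inr p $ Inr q = S $ p $ q"
  by (simp_all add: block_mat_def)

lemma block_vec_nth [simp]: "block_vec u v $ Inl p = u $ p" "block_vec u v $ Inr p = v $ p"
  by (simp_all add: block_vec_def)

lemma cnj_mat_nth [simp]: "cnj_mat M $ i $ j = cnj (M $ i $ j)"
  by (simp add: cnj_mat_def)

lemma cnj_vec_nth [simp]: "cnj_vec v $ i = cnj (v $ i)"
  by (simp add: cnj_vec_def)

lemma all_sum_type: "(\<forall>x :: 'a + 'b. P x) \<longleftrightarrow> (\<forall>a. P (Inl a)) \<and> (\<forall>b. P (Inr b))"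
  by (metis obj_sumE)

lemma sum_UNIV_sum_type:
  fixes f :: "'a :: finite + 'b :: finite \<Rightarrow> 'c :: comm_monoid_add"
  shows "sum f UNIV = (\<Sum>a\<in>UNIV. f (Inl a)) + (\<Sum>b\<in>UNIV. f (Inr b))"
  by (simp flip: UNIV_Plus_UNIV add: sum.Plus)

lemma block_mat_eq_iff: "block_mat P Q R S = block_mat P' Q' R' S' \<longleftrightarrow> P = P' \<and> Q = Q' \<and> R = R' \<and> S = S'"
  by (auto simp: vec_eq_iff all_sum_type)

lemma block_mat_mult: "block_mat P Q R S ** block_mat P' Q' R' S' =
    block_mat (P ** P' + Q ** R') (P ** Q' + Q ** S') (R ** P' + S ** R') (R ** Q' + S ** S')"
  by (simp add: vec_eq_iff all_sum_type matrix_matrix_mult_def sum_UNIV_sum_type)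

lemma block_mat_mult_vec: "block_mat P Q R S *v block_vec u v = block_vec (P *v u + Q *v v) (R *v u + S *v v)"
  by (simp add: vec_eq_iff all_sum_type matrix_vector_mult_def sum_UNIV_sum_type)

lemma mat_1_block: "mat 1 = block_mat (mat 1) 0 0 (mat 1)"
  by (simp add: vec_eq_iff all_sum_type mat_def)

lemma cnj_mat_mult: "cnj_mat (X ** Y) = cnj_mat X ** cnj_mat Y"
  by (simp add: vec_eq_iff matrix_matrix_mult_def)

lemma cnj_mat_mult_vec: "cnj_vec (X *v x) = cnj_mat X *v cnj_vec x"
  by (simp add: vec_eq_iff matrix_vector_mult_def)

lemma cnj_mat_simps [simp]: "cnj_mat (cnj_mat X) = X" "cnj_mat (mat 1) = mat 1"
  "cnj_mat (X + Y) = cnj_mat X + cnj_mat Y" "cnj_mat (X - Y) = cnj_mat X - cnj_mat Y"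
  "cnj_mat (- X) = - cnj_mat X" "cnj_mat 0 = 0"
  by (simp_all add: vec_eq_iff mat_def)

lemma cnj_vec_simps [simp]: "cnj_vec (cnj_vec x) = x"
  "cnj_vec (x + y) = cnj_vec x + cnj_vec y" "cnj_vec (x - y) = cnj_vec x - cnj_vec y"
  by (simp_all add: vec_eq_iff)

lemma cnj_mat_transpose: "cnj_mat (transpose X) = transpose (cnj_mat X)"
  by (simp add: vec_eq_iff transpose_def)

lemma transpose_simps: "transpose (X + Y) = transpose X + transpose Y"
  "transpose (- Z) = - transpose Z" for X Y :: "complex^'n^'m" and Z :: "complex^'n^'m"
  by (simp_all add: vec_eq_iff transpose_def)

lemma mat_exp_G_block:
  "mat_exp (t *\<^sub>R G_mat A B) =
     block_mat (Phi A B t) (Psi A B t) (cnj_mat (Psi A B t)) (cnj_mat (Phi A B t))"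
proof -
  define \<sigma> :: "'a + 'a \<Rightarrow> 'a + 'a" where "\<sigma> = case_sum Inr Inl"
  have \<sigma>: "\<sigma> (Inl p) = Inr p" "\<sigma> (Inr p) = Inl p" for p by (simp_all add: \<sigma>_def)
  have bij: "bij \<sigma>"
    by (rule o_bij[of \<sigma>]) (auto simp: fun_eq_iff \<sigma>_def split: sum.split)
  define T :: "complex^('a + 'a)^('a + 'a) \<Rightarrow> complex^('a + 'a)^('a + 'a)"
    where "T X = (\<chi> i j. cnj (X $ \<sigma> i $ \<sigma> j))" for X
  have T1: "T (mat 1) = mat 1" using bij by (auto simp: T_def mat_def vec_eq_iff bij_def inj_eq)
  have Tm: "T (X ** Y) = T X ** T Y" for X Y
  proof -
    have "(\<Sum>k\<in>UNIV. X $ \<sigma> i $ k * Y $ k $ \<sigma> j) = (\<Sum>k\<in>UNIV. X $ \<sigma> i $ \<sigma> k * Y $ \<sigma> k $ \<sigma> j)" for i j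
      by (rule sum.reindex_bij_betw[OF bij, symmetric])
    then show ?thesis by (simp add: T_def vec_eq_iff matrix_matrix_mult_def flip: complex_cnj_mult cnj_sum)
  qed
  have TG: "T (t *\<^sub>R G_mat A B) = t *\<^sub>R G_mat A B"
    by (simp add: T_def vec_eq_iff all_sum_type \<sigma> G_mat_def)
  have "T (mat_exp (t *\<^sub>R G_mat A B)) = mat_exp (T (t *\<^sub>R G_mat A B))"
  proof (rule mat_exp_image)
    show "linear T" by (rule linearI) (auto simp: T_def vec_eq_iff)
    show "T (mat_pow (t *\<^sub>R G_mat A B) k) = mat_pow (T (t *\<^sub>R G_mat A B)) k" for k
      by (induction k) (simp_all add: T1 Tm)
  qed
  then have "T (mat_exp (t *\<^sub>R G_mat A B)) = mat_exp (t *\<^sub>R G_mat A B)" by (simp add: TG)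
  then have "mat_exp (t *\<^sub>R G_mat A B) $ i $ j = cnj (mat_exp (t *\<^sub>R G_mat A B) $ \<sigma> i $ \<sigma> j)" for i j
    by (metis (no_types, lifting) T_def vec_lambda_beta)
  from this[of "Inr _" "Inl _"] this[of "Inr _" "Inr _"] show ?thesis
    by (simp add: vec_eq_iff all_sum_type Phi_def Psi_def \<sigma>)
qed

lemma mat_exp_minus_G_block:
  assumes "transpose A = A" "cnj_mat (transpose B) = B"
  shows "mat_exp ((- t) *\<^sub>R G_mat A B) =
     block_mat (cnj_mat (transpose (Phi A B t))) (- transpose (Psi A B t))
       (- cnj_mat (transpose (Psi A B t))) (transpose (Phi A B t))"
proof -
  define \<epsilon> :: "'a + 'a \<Rightarrow> complex" where "\<epsilon> = case_sum (\<lambda>_. 1) (\<lambda>_. -1)"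
  have \<epsilon>: "\<epsilon> (Inl p) = 1" "\<epsilon> (Inr p) = -1" for p by (simp_all add: \<epsilon>_def)
  have \<epsilon>2: "\<epsilon> i * \<epsilon> i = 1" for i by (cases i) (auto simp: \<epsilon>)
  define T :: "complex^('a + 'a)^('a + 'a) \<Rightarrow> complex^('a + 'a)^('a + 'a)"
    where "T X = (\<chi> i j. \<epsilon> i * \<epsilon> j * cnj (X $ j $ i))" for X
  have T1: "T (mat 1) = mat 1" by (auto simp: T_def mat_def vec_eq_iff \<epsilon>2)
  have Tm: "T (X ** Y) = T Y ** T X" for X Y
  proof -
    have "\<epsilon> i * \<epsilon> j * (cnj (X $ j $ k) * cnj (Y $ k $ i))
        = \<epsilon> i * \<epsilon> k * cnj (Y $ k $ i) * (\<epsilon> k * \<epsilon> j * cnj (X $ j $ k))" for i j k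
    proof -
      have "\<epsilon> i * \<epsilon> k * cnj (Y $ k $ i) * (\<epsilon> k * \<epsilon> j * cnj (X $ j $ k))
          = (\<epsilon> k * \<epsilon> k) * (\<epsilon> i * \<epsilon> j * (cnj (X $ j $ k) * cnj (Y $ k $ i)))"
        by (simp only: ac_simps)
      then show ?thesis by (simp add: \<epsilon>2)
    qed
    then show ?thesis
      unfolding T_def vec_eq_iff matrix_matrix_mult_def vec_lambda_beta cnj_sum sum_distrib_left complex_cnj_mult
      by (intro allI sum.cong refl)
  qed
  have A: "A $ p $ q = A $ q $ p" for p q using assms(1) by (auto simp: vec_eq_iff transpose_def)
  have B: "cnj (B $ p $ q) = B $ q $ p" for p q using assms(2) by (auto simp: vec_eq_iff transpose_def)
  have B': "B $ p $ q = cnj (B $ q $ p)" for p q using B[of q p] by simp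
  have TG: "T (t *\<^sub>R G_mat A B) = (- t) *\<^sub>R G_mat A B"
    by (auto simp: T_def vec_eq_iff all_sum_type \<epsilon> G_mat_def B intro: A B')
  have "T (mat_exp (t *\<^sub>R G_mat A B)) = mat_exp (T (t *\<^sub>R G_mat A B))"
  proof (rule mat_exp_image)
    show "linear T" by (rule linearI) (auto simp: T_def vec_eq_iff algebra_simps)
    show "T (mat_pow (t *\<^sub>R G_mat A B) k) = mat_pow (T (t *\<^sub>R G_mat A B)) k" for k
    proof (induction k)
      case (Suc k)
      show ?case by (subst mat_pow_Suc2, subst Tm, subst Suc) simp
    qed (simp add: T1)
  qed
  then have "mat_exp ((- t) *\<^sub>R G_mat A B) =
      T (block_mat (Phi A B t) (Psi A B t) (cnj_mat (Psi A B t)) (cnj_mat (Phi A B t)))"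
    by (simp only: TG mat_exp_G_block)
  then show ?thesis
    by (simp only:) (simp add: T_def vec_eq_iff all_sum_type \<epsilon> transpose_def)
qed

definition herm :: "complex^'n \<Rightarrow> complex^'n \<Rightarrow> complex" where
  "herm x y = (\<Sum>i\<in>UNIV. cnj (x $ i) * y $ i)"

lemma herm_self: "herm x x = of_real ((norm x)\<^sup>2)"
proof -
  have "herm x x = (\<Sum>i\<in>UNIV. of_real ((cmod (x $ i))\<^sup>2))"
    by (simp only: herm_def complex_norm_square mult.commute[of "cnj _"])
  then show ?thesis by (simp add: norm_vec_def L2_set_def sum_nonneg)
qed

lemma herm_mult_right: "herm x (M *v y) = herm (cnj_mat (transpose M) *v x) y"
proof -
  have "herm x (M *v y) = (\<Sum>i\<in>UNIV. \<Sum>j\<in>UNIV. cnj (x $ i) * M $ i $ j * y $ j)"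
    by (simp add: herm_def matrix_vector_mult_def sum_distrib_left mult.assoc)
  also have "\<dots> = (\<Sum>j\<in>UNIV. \<Sum>i\<in>UNIV. cnj (x $ i) * M $ i $ j * y $ j)"
    by (rule sum.swap)
  also have "\<dots> = herm (cnj_mat (transpose M) *v x) y"
    by (simp add: herm_def matrix_vector_mult_def transpose_def sum_distrib_right sum_distrib_left ac_simps)
  finally show ?thesis .
qed

lemma herm_diff_right: "herm x (y - z) = herm x y - herm x z"
  by (simp add: herm_def sum_subtractf algebra_simps)

lemma norm_of_gram_difference:
  fixes X Y :: "complex^'n^'n"
  assumes "cnj_mat (transpose X) ** X - cnj_mat (transpose Y) ** Y = mat 1"
  shows "(norm (X *v x))\<^sup>2 = (norm x)\<^sup>2 + (norm (Y *v x))\<^sup>2"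
proof -
  have g: "herm (Z *v x) (Z *v x) = herm x ((cnj_mat (transpose Z) ** Z) *v x)" for Z :: "complex^'n^'n"
    using herm_mult_right[of x "cnj_mat (transpose Z)" "Z *v x"]
    by (simp add: cnj_mat_transpose matrix_vector_mul_assoc)
  have "herm (X *v x) (X *v x) - herm (Y *v x) (Y *v x) = herm x ((mat 1) *v x)"
    by (simp only: g assms[symmetric] matrix_vector_mult_diff_rdistrib herm_diff_right)
  then have "complex_of_real ((norm (X *v x))\<^sup>2 - (norm (Y *v x))\<^sup>2) = of_real ((norm x)\<^sup>2)"
    by (simp only: herm_self matrix_vector_mul_lid of_real_diff)
  then show ?thesis by (simp only: of_real_eq_iff)
qed

locale squeezing =
  fixes A B :: "complex^'n^'n" and h :: "complex^'n"
  assumes A_sym: "transpose A = A" and B_herm: "cnj_mat (transpose B) = B"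
begin

abbreviation "\<Phi> \<equiv> Phi A B"
abbreviation "\<Psi> \<equiv> Psi A B"
abbreviation "hp \<equiv> h_path A B h"

definition Bm :: "complex^'n^'n" where "Bm = (\<chi> p q. - \<i> * B $ p $ q)"

lemma G_block: "G_mat A B = block_mat Bm A (cnj_mat A) (cnj_mat Bm)"
  by (simp add: vec_eq_iff all_sum_type G_mat_def Bm_def)

lemma symplectic:
  "\<Phi> t ** cnj_mat (transpose (\<Phi> t)) - \<Psi> t ** cnj_mat (transpose (\<Psi> t)) = mat 1"
  "\<Phi> t ** transpose (\<Psi> t) = \<Psi> t ** transpose (\<Phi> t)"
  "cnj_mat (transpose (\<Phi> t)) ** \<Phi> t - transpose (\<Psi> t) ** cnj_mat (\<Psi> t) = mat 1"
  "cnj_mat (transpose (\<Phi> t)) ** \<Psi> t = transpose (\<Psi> t) ** cnj_mat (\<Phi> t)"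
  using mat_exp_minus_scaleR[of t "G_mat A B"] mat_exp_minus_scaleR[of "- t" "G_mat A B"]
  by (simp_all add: mat_exp_G_block[of t] mat_exp_minus_G_block[OF A_sym B_herm, of t] block_mat_mult
      mat_1_block block_mat_eq_iff matrix_ring_simps del: scaleR_minus_left)

lemma Phi_Psi_has_vector_derivative:
  "(\<Phi> has_vector_derivative \<Phi> t ** Bm + \<Psi> t ** cnj_mat A) (at t)"
  "(\<Psi> has_vector_derivative \<Phi> t ** A + \<Psi> t ** cnj_mat Bm) (at t)"
proof -
  let ?D = "block_mat (\<Phi> t) (\<Psi> t) (cnj_mat (\<Psi> t)) (cnj_mat (\<Phi> t)) ** block_mat Bm A (cnj_mat A) (cnj_mat Bm)"
  have "G_mat A B ** mat_exp (t *\<^sub>R G_mat A B) = mat_exp (t *\<^sub>R G_mat A B) ** G_mat A B"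
    by (rule mat_exp_commute) (simp add: matrix_ring_simps)
  also have "\<dots> = ?D"
    by (subst mat_exp_G_block) (simp only: G_block)
  finally have *: "G_mat A B ** mat_exp (t *\<^sub>R G_mat A B) = ?D" .
  have *: "((\<lambda>t. mat_exp (t *\<^sub>R G_mat A B)) has_vector_derivative ?D) (at t)"
    using mat_exp_has_vector_derivative[of "G_mat A B" t] by (simp only: *)
  have blk: "bounded_linear (\<lambda>X :: complex^('n + 'n)^('n + 'n). \<chi> p q. X $ Inl p $ f q)" for f :: "'n \<Rightarrow> 'n + 'n"
    by (rule linear_conv_bounded_linear[THEN iffD1], rule linearI) (auto simp: vec_eq_iff)
  have "(\<chi> p q. ?D $ Inl p $ Inl q) = \<Phi> t ** Bm + \<Psi> t ** cnj_mat A"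
    "(\<chi> p q. ?D $ Inl p $ Inr q) = \<Phi> t ** A + \<Psi> t ** cnj_mat Bm"
    by (simp_all add: block_mat_mult vec_eq_iff)
  then show "(\<Phi> has_vector_derivative \<Phi> t ** Bm + \<Psi> t ** cnj_mat A) (at t)"
    "(\<Psi> has_vector_derivative \<Phi> t ** A + \<Psi> t ** cnj_mat Bm) (at t)"
    using bounded_linear.has_vector_derivative[OF blk *, of Inl] bounded_linear.has_vector_derivative[OF blk *, of Inr]
    by (simp_all add: Phi_def[abs_def] Psi_def[abs_def])
qed

lemma Phi_0: "\<Phi> 0 = mat 1" and Psi_0: "\<Psi> 0 = 0"
  by (simp_all add: Phi_def Psi_def mat_exp_0 vec_eq_iff mat_def)

lemma h_path_eq: "hp t = (\<chi> p. (exp_quotient (G_mat A B) t *v block_vec h (cnj_vec h)) $ Inl p)"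
  by (simp add: h_path_def interval_integral_mat_exp_vec)

lemma h_path_has_vector_derivative:
  "(hp has_vector_derivative \<Phi> t *v h + \<Psi> t *v cnj_vec h) (at t)"
proof -
  have *: "((\<lambda>t. exp_quotient (G_mat A B) t *v block_vec h (cnj_vec h)) has_vector_derivative
      mat_exp (t *\<^sub>R G_mat A B) *v block_vec h (cnj_vec h)) (at t)"
    by (rule bounded_linear.has_vector_derivative[OF mv.bounded_linear_left exp_quotient_has_vector_derivative])
  have blk: "bounded_linear (\<lambda>x :: complex^('n + 'n). \<chi> p. x $ Inl p)"
    by (rule linear_conv_bounded_linear[THEN iffD1], rule linearI) (auto simp: vec_eq_iff)
  have "(\<chi> p. (mat_exp (t *\<^sub>R G_mat A B) *v block_vec h (cnj_vec h)) $ Inl p) = \<Phi> t *v h + \<Psi> t *v cnj_vec h"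
    by (simp add: mat_exp_G_block block_mat_mult_vec vec_eq_iff)
  then show ?thesis
    using bounded_linear.has_vector_derivative[OF blk *] by (simp add: h_path_eq[abs_def])
qed

lemma h_path_0: "hp 0 = 0"
  by (simp add: h_path_eq exp_quotient_0 vec_eq_iff)

lemma block_h_path:
  "block_vec (hp t) (cnj_vec (hp t)) = exp_quotient (G_mat A B) t *v block_vec h (cnj_vec h)"
proof -
  define J :: "complex^('n + 'n) \<Rightarrow> complex^('n + 'n)" where
    "J x = (\<chi> i. cnj (x $ (case i of Inl p \<Rightarrow> Inr p | Inr p \<Rightarrow> Inl p)))" for x
  have J_block: "J (block_vec u v) = block_vec (cnj_vec v) (cnj_vec u)" for u v
    by (simp add: J_def vec_eq_iff all_sum_type)
  have "bounded_linear (\<lambda>x. J x - x)"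
    by (rule linear_conv_bounded_linear[THEN iffD1], rule linearI) (auto simp: J_def vec_eq_iff algebra_simps)
  from bounded_linear.has_vector_derivative[OF this
      bounded_linear.has_vector_derivative[OF mv.bounded_linear_left exp_quotient_has_vector_derivative]]
  have "((\<lambda>t. J (exp_quotient (G_mat A B) t *v block_vec h (cnj_vec h)) - exp_quotient (G_mat A B) t *v block_vec h (cnj_vec h))
    has_vector_derivative J (mat_exp (t *\<^sub>R G_mat A B) *v block_vec h (cnj_vec h))
       - mat_exp (t *\<^sub>R G_mat A B) *v block_vec h (cnj_vec h)) (at t)" for t .
  then have "((\<lambda>t. J (exp_quotient (G_mat A B) t *v block_vec h (cnj_vec h)) - exp_quotient (G_mat A B) t *v block_vec h (cnj_vec h))
    has_vector_derivative 0) (at t)" for t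
    by (simp add: mat_exp_G_block block_mat_mult_vec J_block cnj_mat_mult_vec add.commute)
  from has_vector_derivative_zero_imp_eq[OF this, of t 0]
  have "J (exp_quotient (G_mat A B) t *v block_vec h (cnj_vec h)) = exp_quotient (G_mat A B) t *v block_vec h (cnj_vec h)"
    by (simp add: exp_quotient_0) (simp add: J_def vec_eq_iff)
  then have "(exp_quotient (G_mat A B) t *v block_vec h (cnj_vec h)) $ Inr p =
      cnj ((exp_quotient (G_mat A B) t *v block_vec h (cnj_vec h)) $ Inl p)" for p
    by (metis (mono_tags, lifting) J_def sum.case(2) vec_lambda_beta)
  then show ?thesis
    by (simp add: h_path_eq vec_eq_iff all_sum_type)
qed


lemma Phi_expands: "norm x \<le> norm (\<Phi> t *v x)"
proof -
  have "(norm (\<Phi> t *v x))\<^sup>2 = (norm x)\<^sup>2 + (norm (cnj_mat (\<Psi> t) *v x))\<^sup>2"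
    using symplectic(3)[of t] by (intro norm_of_gram_difference) (simp add: cnj_mat_transpose)
  then have "(norm x)\<^sup>2 \<le> (norm (\<Phi> t *v x))\<^sup>2" by simp
  then show ?thesis by (rule power2_le_imp_le) simp
qed

lemma invertible_Phi: "invertible (\<Phi> t)"
proof -
  have "\<Phi> t *v x = 0 \<Longrightarrow> x = 0" for x
    using Phi_expands[of x t] by simp
  then show ?thesis
    by (metis invertible_left_inverse matrix_left_invertible_ker)
qed

definition "\<Theta> t = matrix_inv (\<Phi> t)"

lemma Phi_inverse: "\<Phi> t ** \<Theta> t = mat 1" "\<Theta> t ** \<Phi> t = mat 1"
  using matrix_mult_matrix_inv[OF invertible_Phi] by (auto simp: \<Theta>_def)

abbreviation "R \<equiv> R_coeff A B"
abbreviation "g \<equiv> g_coeff A B h"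

lemma R_eq: "R t = \<Theta> t ** \<Psi> t" and g_eq: "g t = \<Theta> t *v hp t"
  by (simp_all add: R_coeff_def g_coeff_def \<Theta>_def)

lemma transpose_inverse: "transpose (\<Theta> t) ** transpose (\<Phi> t) = mat 1" "transpose (\<Phi> t) ** transpose (\<Theta> t) = mat 1"
  using arg_cong[OF Phi_inverse(1), of transpose] arg_cong[OF Phi_inverse(2), of transpose]
  by (simp_all add: matrix_transpose_mul)

lemma R_eq': "R t = transpose (\<Psi> t) ** transpose (\<Theta> t)"
proof -
  have "R t ** transpose (\<Phi> t) = \<Theta> t ** (\<Phi> t ** transpose (\<Psi> t))"
    by (simp only: R_eq matrix_mul_assoc[symmetric] symplectic(2))
  then have "R t ** transpose (\<Phi> t) = transpose (\<Psi> t)"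
    by (simp only: matrix_mul_assoc Phi_inverse matrix_mul_lid)
  then have "R t ** (transpose (\<Phi> t) ** transpose (\<Theta> t)) = transpose (\<Psi> t) ** transpose (\<Theta> t)"
    by (simp only: matrix_mul_assoc)
  then show ?thesis by (simp only: transpose_inverse matrix_mul_rid)
qed

lemma R_sym: "transpose (R t) = R t"
  using arg_cong[OF R_eq'[of t], of transpose]
  by (simp only: matrix_transpose_mul transpose_transpose R_eq[symmetric])

definition "rb t = cnj_mat (\<Psi> t) ** \<Theta> t"

lemma rb_eq: "cnj_mat (rho_coeff A B t) = rb t"
  by (simp only: rb_def rho_coeff_def \<Theta>_def cnj_mat_simps)

lemma rb_Phi: "rb t ** \<Phi> t = cnj_mat (\<Psi> t)"
  by (simp only: rb_def Phi_inverse matrix_mul_assoc[symmetric] matrix_mul_rid)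

lemma rb_eq': "rb t = transpose (\<Theta> t) ** cnj_mat (transpose (\<Psi> t))"
proof -
  have "cnj_mat (transpose (cnj_mat (transpose (\<Phi> t)) ** \<Psi> t)) = cnj_mat (transpose (transpose (\<Psi> t) ** cnj_mat (\<Phi> t)))"
    by (simp only: symplectic(4))
  then have *: "cnj_mat (transpose (\<Psi> t)) ** \<Phi> t = transpose (\<Phi> t) ** cnj_mat (\<Psi> t)"
    by (simp add: matrix_transpose_mul cnj_mat_mult cnj_mat_transpose)
  have "transpose (\<Phi> t) ** rb t = cnj_mat (transpose (\<Psi> t)) ** (\<Phi> t ** \<Theta> t)"
    by (simp only: rb_def matrix_mul_assoc *)
  then have "transpose (\<Theta> t) ** transpose (\<Phi> t) ** rb t = transpose (\<Theta> t) ** cnj_mat (transpose (\<Psi> t))"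
    by (simp only: Phi_inverse matrix_mul_rid matrix_mul_assoc[symmetric])
  then show ?thesis by (simp only: transpose_inverse matrix_mul_lid)
qed

lemma rb_sym: "transpose (rb t) = rb t"
  using arg_cong[OF rb_eq'[of t], of transpose]
  by (simp only: matrix_transpose_mul cnj_mat_transpose transpose_transpose rb_def[symmetric])

lemma Phi_cnj_eq: "transpose (\<Theta> t) + cnj_mat (\<Psi> t) ** R t = cnj_mat (\<Phi> t)"
proof -
  have "cnj_mat (cnj_mat (transpose (\<Phi> t)) ** \<Phi> t) = cnj_mat (mat 1 + transpose (\<Psi> t) ** cnj_mat (\<Psi> t))"
    using symplectic(3)[of t] by (simp add: algebra_simps)
  then have "transpose (\<Phi> t) ** cnj_mat (\<Phi> t) = mat 1 + cnj_mat (transpose (\<Psi> t)) ** \<Psi> t"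
    by (simp add: cnj_mat_mult)
  then have "transpose (\<Theta> t) ** (transpose (\<Phi> t) ** cnj_mat (\<Phi> t)) = transpose (\<Theta> t) + rb t ** \<Psi> t"
    by (simp add: matrix_add_ldistrib rb_eq' matrix_mul_assoc)
  then show ?thesis
    by (simp add: matrix_mul_assoc transpose_inverse R_eq rb_def)
qed

lemma f_eq: "cnj_vec (f_coeff A B h t) = cnj_vec (hp t) - rb t *v hp t"
  by (simp add: f_coeff_def cnj_mat_mult_vec rb_eq)

lemma Psi_g: "cnj_mat (\<Psi> t) *v g t = rb t *v hp t"
  by (simp add: g_eq rb_def matrix_vector_mul_assoc)

lemma norm_R_less:
  assumes K: "\<And>y. norm (transpose (\<Phi> t) *v y) \<le> K * norm y" and "1 \<le> K"
  shows "norm (R t *v x) \<le> sqrt (1 - 1 / K\<^sup>2) * norm x"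
proof -
  define y where "y = transpose (\<Theta> t) *v x"
  have x: "x = transpose (\<Phi> t) *v y" and Rx: "R t *v x = transpose (\<Psi> t) *v y"
    by (simp_all only: y_def R_eq' matrix_vector_mul_assoc transpose_inverse matrix_vector_mul_lid)
  have "(norm (transpose (\<Phi> t) *v y))\<^sup>2 = (norm y)\<^sup>2 + (norm (transpose (\<Psi> t) *v y))\<^sup>2"
  proof (rule norm_of_gram_difference)
    have "cnj_mat (\<Phi> t ** cnj_mat (transpose (\<Phi> t)) - \<Psi> t ** cnj_mat (transpose (\<Psi> t))) = cnj_mat (mat 1)"
      by (simp only: symplectic(1))
    then show "cnj_mat (transpose (transpose (\<Phi> t))) ** transpose (\<Phi> t)
      - cnj_mat (transpose (transpose (\<Psi> t))) ** transpose (\<Psi> t) = mat 1"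
      by (simp add: cnj_mat_mult)
  qed
  then have 1: "(norm (R t *v x))\<^sup>2 = (norm x)\<^sup>2 - (norm y)\<^sup>2"
    by (simp only: x[symmetric] Rx[symmetric])
  have "norm x \<le> K * norm y" using K[of y] by (simp only: x[symmetric])
  then have "(norm x)\<^sup>2 \<le> K\<^sup>2 * (norm y)\<^sup>2"
    by (metis norm_ge_zero power_mono power_mult_distrib)
  then have "(norm x)\<^sup>2 / K\<^sup>2 \<le> (norm y)\<^sup>2"
    using \<open>1 \<le> K\<close> by (simp add: field_simps)
  then have "(norm (R t *v x))\<^sup>2 \<le> (1 - 1 / K\<^sup>2) * (norm x)\<^sup>2"
    using 1 by (simp add: algebra_simps)
  then have "norm (R t *v x) \<le> sqrt ((1 - 1 / K\<^sup>2) * (norm x)\<^sup>2)"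
    by (rule real_le_rsqrt)
  then show ?thesis by (simp add: real_sqrt_mult)
qed

lemma mv_has_vector_derivative:
  fixes X :: "real \<Rightarrow> complex^'l^'m" and x :: "real \<Rightarrow> complex^'l"
  assumes "(X has_vector_derivative X') (at t)" "(x has_vector_derivative x') (at t)"
  shows "((\<lambda>t. X t *v x t) has_vector_derivative (X t *v x' + X' *v x t)) (at t)"
  using mv.has_vector_derivative[OF assms] .

lemma Theta_has_vector_derivative:
  "(\<Theta> has_vector_derivative - ((Bm + R t ** cnj_mat A) ** \<Theta> t)) (at t)"
  using matrix_inverse_has_vector_derivative[OF Phi_Psi_has_vector_derivative(1) Phi_inverse, of t]
  by (simp add: matrix_add_ldistrib matrix_mul_assoc Phi_inverse R_eq)

lemma R_has_vector_derivative:
  "(R has_vector_derivative A + R t ** cnj_mat Bm - Bm ** R t - R t ** cnj_mat A ** R t) (at t)"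
proof -
  have "\<Theta> t ** (\<Phi> t ** A + \<Psi> t ** cnj_mat Bm) + - ((Bm + R t ** cnj_mat A) ** \<Theta> t) ** \<Psi> t
      = A + R t ** cnj_mat Bm - Bm ** R t - R t ** cnj_mat A ** R t"
    by (simp add: matrix_ring_simps matrix_mul_assoc Phi_inverse R_eq)
  then show ?thesis
    using mm_has_vector_derivative[OF Theta_has_vector_derivative Phi_Psi_has_vector_derivative(2), of t]
    by (simp add: R_eq[abs_def])
qed

lemma g_has_vector_derivative:
  "(g has_vector_derivative h + R t *v cnj_vec h - Bm *v g t - R t *v (cnj_mat A *v g t)) (at t)"
proof -
  have "\<Theta> t *v (\<Phi> t *v h + \<Psi> t *v cnj_vec h) + - ((Bm + R t ** cnj_mat A) ** \<Theta> t) *v hp t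
      = h + R t *v cnj_vec h - Bm *v g t - R t *v (cnj_mat A *v g t)"
    by (simp add: mv.minus_left matrix_vector_right_distrib matrix_vector_mult_add_rdistrib
        matrix_vector_mul_assoc Phi_inverse R_eq g_eq matrix_ring_simps matrix_mul_assoc mv.diff_left mv.minus_left)
  then show ?thesis
    using mv_has_vector_derivative[OF Theta_has_vector_derivative h_path_has_vector_derivative, of t]
    by (simp add: g_eq[abs_def])
qed

lemma R_0: "R 0 = 0" and g_0: "g 0 = 0"
  by (simp_all add: R_eq g_eq Psi_0 h_path_0 matrix_mult_zero_right)

end

section \<open>The ring of formal operators\<close>

text \<open>Operators each of whose matrix rows is finitely supported act on all functions of the occupation
  numbers, without domain questions, and form a ring. They commute with pointwise limits.\<close>

inductive finite_functional :: "(('n :: finite) state \<Rightarrow> complex) \<Rightarrow> bool" where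
  eval: "finite_functional (\<lambda>\<psi>. \<psi> k)"
| zero: "finite_functional (\<lambda>\<psi>. 0)"
| add: "finite_functional f \<Longrightarrow> finite_functional f' \<Longrightarrow> finite_functional (\<lambda>\<psi>. f \<psi> + f' \<psi>)"
| scale: "finite_functional f \<Longrightarrow> finite_functional (\<lambda>\<psi>. c * f \<psi>)"

lemma finite_functional_uminus: "finite_functional f \<Longrightarrow> finite_functional (\<lambda>\<psi>. - f \<psi>)"
  using finite_functional.scale[of f "-1"] by simp

typedef ('n :: finite) fop = "{F :: 'n state \<Rightarrow> 'n state. \<forall>k. finite_functional (\<lambda>\<psi>. F \<psi> k)}"
  morphisms app Fop
  by (rule exI[of _ "\<lambda>\<psi>. \<psi>"]) (simp add: finite_functional.eval)

lemma finite_functional_app: "finite_functional (\<lambda>\<psi>. app X \<psi> k)"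
  using app[of X] by simp

lemma finite_functional_comp:
  assumes "finite_functional f" shows "finite_functional (\<lambda>\<psi>. f (app X \<psi>))"
  using assms by induction (auto intro: finite_functional.intros finite_functional_app)

lemma fop_eqI: "(\<And>\<psi> k. app X \<psi> k = app Y \<psi> k) \<Longrightarrow> X = Y"
  by (metis app_inject ext)

instantiation fop :: (finite) ring_1
begin

definition "0 = Fop (\<lambda>\<psi> k. 0)"
definition "1 = Fop (\<lambda>\<psi>. \<psi>)"
definition "X + Y = Fop (\<lambda>\<psi> k. app X \<psi> k + app Y \<psi> k)"
definition "X * Y = Fop (\<lambda>\<psi>. app X (app Y \<psi>))"
definition "- X = Fop (\<lambda>\<psi> k. -1 * app X \<psi> k)"
definition "X - Y = (X :: 'a fop) + - Y"

lemma app_basic: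
  "app 0 \<psi> k = 0" "app 1 \<psi> = \<psi>" "app (X + Y) \<psi> k = app X \<psi> k + app Y \<psi> k"
  "app (X * Y) \<psi> = app X (app Y \<psi>)" "app (- X) \<psi> k = - app X \<psi> k"
  unfolding zero_fop_def one_fop_def plus_fop_def times_fop_def uminus_fop_def
  by (subst Fop_inverse; auto intro: finite_functional.intros finite_functional_uminus finite_functional_app finite_functional_comp)+

lemma finite_functional_linear:
  assumes "finite_functional f"
  shows "f (\<lambda>k. c * \<phi> k + \<psi> k) = c * f \<phi> + f \<psi>"
  using assms by induction (auto simp: algebra_simps)

lemma app_linear: "app X (\<lambda>k. c * \<phi> k + \<psi> k) k = c * app X \<phi> k + app X \<psi> k"
  by (rule finite_functional_linear[OF finite_functional_app])

lemma app_add: "app X (\<lambda>k. \<phi> k + \<psi> k) k = app X \<phi> k + app X \<psi> k"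
  using app_linear[of X 1] by simp

instance
proof
  fix X Y Z :: "'a fop"
  show "X * (Y + Z) = X * Y + X * Z"
  proof (rule fop_eqI)
    fix \<psi> k
    have "app (Y + Z) \<psi> = (\<lambda>k. app Y \<psi> k + app Z \<psi> k)" by (simp add: fun_eq_iff app_basic)
    then show "app (X * (Y + Z)) \<psi> k = app (X * Y + X * Z) \<psi> k"
      by (simp add: app_basic app_add)
  qed
  have "app 1 (\<lambda>_. 1) k \<noteq> app (0 :: 'a fop) (\<lambda>_. 1) k" for k
    by (simp add: app_basic)
  then show "(0 :: 'a fop) \<noteq> 1" by metis
qed (rule fop_eqI; simp add: app_basic minus_fop_def)+

end

lemma app_diff: "app (X - Y) \<psi> k = app X \<psi> k - app Y \<psi> k"
  unfolding minus_fop_def app_basic by simp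

lemma app_sum: "app (sum X S) \<psi> k = (\<Sum>i\<in>S. app (X i) \<psi> k)"
  by (induction S rule: infinite_finite_induct) (simp_all add: app_basic)

lemma app_power: "app (X ^ m) \<psi> = ((app X) ^^ m) \<psi>"
  by (induction m) (simp_all add: app_basic)

lemma app_zero: "app X (\<lambda>k. 0) = (\<lambda>k. 0)"
proof
  show "app X (\<lambda>k. 0) k = 0" for k
    using app_add[of X "\<lambda>_. 0" "\<lambda>_. 0" k] by simp
qed

lemma app_scale: "app X (\<lambda>k. c * \<psi> k) k = c * app X \<psi> k"
  using app_linear[of X c \<psi> "\<lambda>_. 0"] by (simp add: app_zero)

lemma app_minus_arg: "app X (\<lambda>k. \<phi> k - \<psi> k) k = app X \<phi> k - app X \<psi> k"
  using app_linear[of X "-1" \<psi> \<phi>] by simp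

lemma app_sum_arg: "app X (\<lambda>k. \<Sum>i\<in>S. \<psi> i k) k = (\<Sum>i\<in>S. app X (\<psi> i) k)"
  by (induction S rule: infinite_finite_induct) (simp_all add: app_add app_zero)

lemma app_sums:
  assumes "\<And>k. (\<lambda>m. f m k) sums \<phi> k"
  shows "(\<lambda>m. app X (f m) k) sums app X \<phi> k"
proof -
  have "(\<lambda>m. g (f m)) sums g \<phi>" if "finite_functional g" for g
    using that by induction (auto intro: assms sums_add sums_mult)
  from this[OF finite_functional_app] show ?thesis .
qed

definition sc :: "complex \<Rightarrow> ('n :: finite) fop" where "sc c = Fop (\<lambda>\<psi> k. c * \<psi> k)"
definition an :: "'n \<Rightarrow> ('n :: finite) fop" where "an i = Fop (annih i)"
definition cr :: "'n \<Rightarrow> ('n :: finite) fop" where "cr i = Fop (creat i)"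

lemma app_sc: "app (sc c) \<psi> k = c * \<psi> k"
  unfolding sc_def by (subst Fop_inverse) (auto intro: finite_functional.intros)

lemma app_an: "app (an i) = annih i"
  unfolding an_def by (subst Fop_inverse) (auto simp: annih_def intro: finite_functional.intros)

lemma app_cr: "app (cr i) = creat i"
proof -
  have "finite_functional (\<lambda>\<psi>. creat i \<psi> k)" for k
    by (cases "k i = 0") (auto simp: creat_def intro: finite_functional.intros)
  then show ?thesis unfolding cr_def by (subst Fop_inverse) auto
qed

lemma sc_simps [simp]: "sc 0 = 0" "sc 1 = 1"
  by (auto intro!: fop_eqI simp: app_sc app_basic)

lemma sc_add: "sc (a + b) = sc a + sc b" and sc_mult: "sc (a * b) = sc a * sc b"
  and sc_minus: "sc (- a) = - sc a" and sc_diff: "sc (a - b) = sc a - sc b"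
  by (auto intro!: fop_eqI simp: app_sc app_basic app_diff algebra_simps)

lemma sc_commute: "X * sc c = sc c * X" for X :: "('n :: finite) fop"
proof (rule fop_eqI)
  fix \<psi> :: "'n state" and k
  have "app (sc c) \<psi> = (\<lambda>k. c * \<psi> k)" by (simp add: fun_eq_iff app_sc)
  then show "app (X * sc c) \<psi> k = app (sc c * X) \<psi> k" by (simp add: app_basic app_sc app_scale)
qed

lemma sc_left_commute: "X * (sc c * Y) = sc c * (X * Y)"
  by (metis mult.assoc sc_commute)

lemma an_cr: "an i * cr j = cr j * an i + (if i = j then 1 else 0)"
  using canonical_commutation[of i j]
  by (intro fop_eqI) (auto simp: app_basic app_an app_cr algebra_simps)

lemma an_an: "an i * an j = an j * an i"
  by (cases "i = j") (auto intro!: fop_eqI simp: app_basic app_an annih_def fun_upd_twist)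

lemma cr_cr: "cr i * cr j = cr j * cr i"
  by (cases "i = j") (auto intro!: fop_eqI simp: app_basic app_cr creat_def fun_upd_twist)

definition vac :: "('n :: finite) state" where "vac k = (if k = (\<lambda>_. 0) then 1 else 0)"

lemma an_vac: "app (an i) vac = (\<lambda>k. 0)"
  by (auto simp: app_an annih_def vac_def fun_eq_iff)

section \<open>Pointwise derivatives\<close>

definition pder :: "(real \<Rightarrow> ('n :: finite) state) \<Rightarrow> 'n state \<Rightarrow> real \<Rightarrow> bool" where
  "pder w w' t \<longleftrightarrow> (\<forall>k. ((\<lambda>t. w t k) has_vector_derivative w' k) (at t))"

lemma pder_app:
  assumes "pder w w' t" shows "pder (\<lambda>t. app X (w t)) (app X w') t"
proof -
  have "((\<lambda>t. f (w t)) has_vector_derivative f w') (at t)" if "finite_functional f" for f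
    using that assms
    by induction (auto simp: pder_def intro: has_vector_derivative_add bounded_linear.has_vector_derivative[OF bounded_linear_mult_right])
  then show ?thesis unfolding pder_def using finite_functional_app by blast
qed

text \<open>\<open>X'\<close> is the derivative at \<open>t\<close> of the operator valued function \<open>X\<close>, in the sense that the
  product rule holds for its action on states.\<close>

definition oder :: "(real \<Rightarrow> ('n :: finite) fop) \<Rightarrow> 'n fop \<Rightarrow> real \<Rightarrow> bool" where
  "oder X X' t \<longleftrightarrow> (\<forall>w w'. pder w w' t \<longrightarrow>
     pder (\<lambda>t. app (X t) (w t)) (\<lambda>k. app (X t) w' k + app X' (w t) k) t)"

lemma oder_const: "oder (\<lambda>t. X) 0 t"
  by (auto simp: oder_def app_basic intro: pder_app)

lemma oder_sc: assumes "(c has_vector_derivative c') (at t)" shows "oder (\<lambda>t. sc (c t)) (sc c') t"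
  using has_vector_derivative_mult[OF assms] by (auto simp: oder_def pder_def app_sc)

lemma oder_add:
  fixes X Y :: "real \<Rightarrow> ('n :: finite) fop"
  assumes "oder X X' t" "oder Y Y' t" shows "oder (\<lambda>t. X t + Y t) (X' + Y') t"
  using assms unfolding oder_def
proof (intro allI impI)
  fix w :: "real \<Rightarrow> 'n state" and w' assume "pder w w' t"
  then have X: "pder (\<lambda>t. app (X t) (w t)) (\<lambda>k. app (X t) w' k + app X' (w t) k) t"
    and Y: "pder (\<lambda>t. app (Y t) (w t)) (\<lambda>k. app (Y t) w' k + app Y' (w t) k) t"
    using assms by (auto simp: oder_def)
  have "((\<lambda>t. app (X t) (w t) k + app (Y t) (w t) k) has_vector_derivative
     (app (X t) w' k + app X' (w t) k) + (app (Y t) w' k + app Y' (w t) k)) (at t)" for k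
    by (intro has_vector_derivative_add X[unfolded pder_def, rule_format] Y[unfolded pder_def, rule_format])
  then show "pder (\<lambda>t. app (X t + Y t) (w t)) (\<lambda>k. app (X t + Y t) w' k + app (X' + Y') (w t) k) t"
    by (simp add: pder_def app_basic add_ac)
qed

lemma oder_mult:
  fixes X Y :: "real \<Rightarrow> ('n :: finite) fop"
  assumes "oder X X' t" "oder Y Y' t" shows "oder (\<lambda>t. X t * Y t) (X t * Y' + X' * Y t) t"
  unfolding oder_def
proof (intro allI impI)
  fix w :: "real \<Rightarrow> 'n state" and w' assume "pder w w' t"
  then have "pder (\<lambda>t. app (Y t) (w t)) (\<lambda>k. app (Y t) w' k + app Y' (w t) k) t"
    using assms(2) by (auto simp: oder_def)
  then have "pder (\<lambda>t. app (X t) (app (Y t) (w t))) (\<lambda>k. app (X t) (\<lambda>k. app (Y t) w' k + app Y' (w t) k) k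
     + app X' (app (Y t) (w t)) k) t"
    using assms(1) unfolding oder_def by blast
  then show "pder (\<lambda>t. app (X t * Y t) (w t)) (\<lambda>k. app (X t * Y t) w' k + app (X t * Y' + X' * Y t) (w t) k) t"
    by (simp add: app_basic app_add algebra_simps)
qed

lemma oder_sum: assumes "\<And>i. i \<in> S \<Longrightarrow> oder (X i) (X' i) t" shows "oder (\<lambda>t. \<Sum>i\<in>S. X i t) (\<Sum>i\<in>S. X' i) t"
  using assms by (induction S rule: infinite_finite_induct) (auto intro: oder_const oder_add)

lemma oder_sc_mult: assumes "(c has_vector_derivative c') (at t)" shows "oder (\<lambda>t. sc (c t) * X) (sc c' * X) t"
  using oder_mult[OF oder_sc[OF assms] oder_const, of X] by simp

section \<open>Estimates on the number shells\<close>

definition deg :: "('n :: finite \<Rightarrow> nat) \<Rightarrow> nat" where "deg k = (\<Sum>i\<in>UNIV. k i)"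

definition shell :: "nat \<Rightarrow> ('n :: finite \<Rightarrow> nat) set" where "shell N = {k. deg k = N}"

lemma le_deg: "k i \<le> deg k"
  unfolding deg_def by (rule member_le_sum) auto

lemma finite_deg_le: "finite {k :: 'n :: finite \<Rightarrow> nat. deg k \<le> N}"
proof (rule finite_subset)
  show "{k :: 'n \<Rightarrow> nat. deg k \<le> N} \<subseteq> Pi\<^sub>E UNIV (\<lambda>_. {..N})"
    using le_deg order_trans by (fastforce simp: PiE_iff)
qed (intro finite_PiE; simp)

lemma finite_shell [simp]: "finite (shell N)"
  by (rule finite_subset[OF _ finite_deg_le[of N]]) (auto simp: shell_def)

lemma deg_upd_Suc: "deg (k(i := Suc (k i))) = Suc (deg k)"
proof -
  have "deg (k(i := x)) = x + (\<Sum>j\<in>UNIV - {i}. k j)" for x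
    unfolding deg_def by (subst sum.remove[of UNIV i]) (auto intro!: sum.cong)
  from this[of "Suc (k i)"] this[of "k i"] show ?thesis by simp
qed

lemma deg_upd_pred: "k i > 0 \<Longrightarrow> Suc (deg (k(i := k i - 1))) = deg k"
  using deg_upd_Suc[of "k(i := k i - 1)" i] by simp

lemma deg_zero: "deg (\<lambda>_. 0) = 0" by (simp add: deg_def)

lemma deg_eq_0: "deg k = 0 \<longleftrightarrow> k = (\<lambda>_. 0)"
  by (auto simp: deg_def fun_eq_iff)

lemma sum_shell_upd:
  "(\<Sum>k\<in>shell N. f (k(i := Suc (k i)))) = (\<Sum>k\<in>{k \<in> shell (Suc N). k i > 0}. f k)"
  for f :: "('n :: finite \<Rightarrow> nat) \<Rightarrow> 'a :: comm_monoid_add"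
  by (rule sum.reindex_bij_witness[of _ "\<lambda>k. k(i := k i - 1)" "\<lambda>k. k(i := Suc (k i))"])
     (auto simp: shell_def deg_upd_Suc dest: deg_upd_pred)

definition sh :: "nat \<Rightarrow> ('n :: finite) state \<Rightarrow> real" where
  "sh N \<psi> = L2_set (\<lambda>k. cmod (\<psi> k)) (shell N)"

lemma sh_nonneg [simp]: "0 \<le> sh N \<psi>"
  by (simp add: sh_def L2_set_nonneg)

lemma sh_power2: "(sh N \<psi>)\<^sup>2 = (\<Sum>k\<in>shell N. (cmod (\<psi> k))\<^sup>2)"
  by (simp add: sh_def L2_set_def sum_nonneg)

lemma sh_add: "sh N (\<lambda>k. \<phi> k + \<psi> k) \<le> sh N \<phi> + sh N \<psi>"
  unfolding sh_def
  by (rule order_trans[OF L2_set_mono L2_set_triangle_ineq]) (auto intro: norm_triangle_ineq)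

lemma sh_scale: "sh N (\<lambda>k. c * \<psi> k) = cmod c * sh N \<psi>"
  by (simp add: sh_def norm_mult L2_set_right_distrib)

lemma sh_minus: "sh N (\<lambda>k. - \<psi> k) = sh N \<psi>"
  by (simp add: sh_def)

lemma sh_zero: "sh N (\<lambda>k. 0) = 0"
  by (simp add: sh_def L2_set_def)

lemma sh_sum: "sh N (\<lambda>k. \<Sum>i\<in>S. \<psi> i k) \<le> (\<Sum>i\<in>S. sh N (\<psi> i))"
proof (induction S rule: infinite_finite_induct)
  case (insert x F)
  then show ?case using sh_add[of N "\<psi> x" "\<lambda>k. \<Sum>i\<in>F. \<psi> i k"] by simp
qed (simp_all add: sh_zero)

lemma sum_sh_an: "(\<Sum>i\<in>UNIV. (sh N (app (an i) \<psi>))\<^sup>2) = real (Suc N) * (sh (Suc N) \<psi>)\<^sup>2"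
proof -
  have "(sh N (app (an i) \<psi>))\<^sup>2 = (\<Sum>k\<in>shell (Suc N). real (k i) * (cmod (\<psi> k))\<^sup>2)" for i
  proof -
    have "(sh N (app (an i) \<psi>))\<^sup>2 = (\<Sum>k\<in>shell N. (\<lambda>k. real (k i) * (cmod (\<psi> k))\<^sup>2) (k(i := Suc (k i))))"
      by (simp add: sh_power2 app_an annih_def norm_mult power_mult_distrib)
    also have "\<dots> = (\<Sum>k\<in>{k \<in> shell (Suc N). k i > 0}. real (k i) * (cmod (\<psi> k))\<^sup>2)"
      by (rule sum_shell_upd)
    also have "\<dots> = (\<Sum>k\<in>shell (Suc N). real (k i) * (cmod (\<psi> k))\<^sup>2)"
      by (rule sum.mono_neutral_left) auto
    finally show ?thesis .
  qed
  then have "(\<Sum>i\<in>UNIV. (sh N (app (an i) \<psi>))\<^sup>2) = (\<Sum>k\<in>shell (Suc N). \<Sum>i\<in>UNIV. real (k i) * (cmod (\<psi> k))\<^sup>2)"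
    by (simp add: sum.swap[of _ _ UNIV])
  also have "\<dots> = (\<Sum>k\<in>shell (Suc N). real (Suc N) * (cmod (\<psi> k))\<^sup>2)"
    by (intro sum.cong refl) (auto simp: shell_def deg_def simp flip: sum_distrib_right of_nat_sum)
  finally show ?thesis by (simp add: sh_power2 sum_distrib_left)
qed

lemma sh_cr_0: "sh 0 (app (cr i) \<psi>) = 0"
  by (auto simp: sh_def L2_set_def app_cr creat_def shell_def deg_eq_0)

lemma sh_cr_power2: "(sh (Suc N) (app (cr i) \<psi>))\<^sup>2 = (\<Sum>k\<in>shell N. real (Suc (k i)) * (cmod (\<psi> k))\<^sup>2)"
proof -
  have "(sh (Suc N) (app (cr i) \<psi>))\<^sup>2 = (\<Sum>k\<in>{k \<in> shell (Suc N). k i > 0}. (cmod (app (cr i) \<psi> k))\<^sup>2)"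
    unfolding sh_power2 by (rule sum.mono_neutral_right) (auto simp: app_cr creat_def)
  also have "\<dots> = (\<Sum>k\<in>shell N. (\<lambda>k. (cmod (app (cr i) \<psi> k))\<^sup>2) (k(i := Suc (k i))))"
    by (rule sum_shell_upd[symmetric])
  finally show ?thesis
    by (simp add: app_cr creat_def norm_mult power_mult_distrib fun_upd_triv)
qed

lemma sum_sh_cr: "(\<Sum>i\<in>UNIV. (sh (Suc N) (app (cr i) \<psi>))\<^sup>2) = real (N + CARD('n)) * (sh N \<psi>)\<^sup>2"
  for \<psi> :: "('n :: finite) state"
proof -
  have "(\<Sum>i\<in>UNIV. (sh (Suc N) (app (cr i) \<psi>))\<^sup>2) = (\<Sum>k\<in>shell N. \<Sum>i\<in>UNIV. real (Suc (k i)) * (cmod (\<psi> k))\<^sup>2)"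
    by (simp add: sh_cr_power2 sum.swap[of _ _ UNIV] del: of_nat_Suc)
  also have "\<dots> = (\<Sum>k\<in>shell N. real (N + CARD('n)) * (cmod (\<psi> k))\<^sup>2)"
  proof (intro sum.cong refl)
    fix k :: "'n \<Rightarrow> nat" assume "k \<in> shell N"
    then have "(\<Sum>i\<in>UNIV. real (Suc (k i))) = real (N + CARD('n))"
      by (simp add: shell_def deg_def sum.distrib flip: of_nat_sum)
    then show "(\<Sum>i\<in>UNIV. real (Suc (k i)) * (cmod (\<psi> k))\<^sup>2) = real (N + CARD('n)) * (cmod (\<psi> k))\<^sup>2"
      by (simp only: sum_distrib_right[symmetric])
  qed
  finally show ?thesis by (simp add: sh_power2 sum_distrib_left)
qed

lemma sh_an: "sh N (app (an i) \<psi>) \<le> sqrt (real (Suc N)) * sh (Suc N) \<psi>"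
proof -
  have "(sh N (app (an i) \<psi>))\<^sup>2 \<le> real (Suc N) * (sh (Suc N) \<psi>)\<^sup>2"
    unfolding sum_sh_an[symmetric] by (rule member_le_sum) auto
  then have "sh N (app (an i) \<psi>) \<le> sqrt (real (Suc N) * (sh (Suc N) \<psi>)\<^sup>2)" by (rule real_le_rsqrt)
  then show ?thesis by (simp add: real_sqrt_mult)
qed

lemma sh_cr: "sh (Suc N) (app (cr i) \<psi>) \<le> sqrt (real (Suc N)) * sh N \<psi>"
proof -
  have "(sh (Suc N) (app (cr i) \<psi>))\<^sup>2 \<le> (\<Sum>k\<in>shell N. real (Suc N) * (cmod (\<psi> k))\<^sup>2)"
    unfolding sh_cr_power2 using le_deg by (intro sum_mono mult_right_mono) (auto simp: shell_def)
  then have "(sh (Suc N) (app (cr i) \<psi>))\<^sup>2 \<le> real (Suc N) * (sh N \<psi>)\<^sup>2"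
    by (simp add: sh_power2 sum_distrib_left)
  then have "sh (Suc N) (app (cr i) \<psi>) \<le> sqrt (real (Suc N) * (sh N \<psi>)\<^sup>2)" by (rule real_le_rsqrt)
  then show ?thesis by (simp add: real_sqrt_mult)
qed

text \<open>The matrix \<open>R\<close> acts on the mode index only, so its operator norm controls the whole tuple
  \<open>R a\<^sup>\<dagger> \<psi>\<close>; this is what keeps the constant below \<open>1\<close>.\<close>

lemma annihilation_recursion:
  fixes R :: "complex^'n^'n" and g :: "complex^'n" and \<phi> \<psi> :: "'n state"
  assumes R: "\<And>x. norm (R *v x) \<le> r * norm x" and r: "0 \<le> r"
    and an: "\<And>i k. app (an i) \<phi> k = - (\<Sum>j\<in>UNIV. R $ i $ j * app (cr j) \<psi> k) - g $ i * \<psi> k"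
  shows "sqrt (real (Suc N)) * sh (Suc N) \<phi> \<le>
    r * (if N = 0 then 0 else sqrt (real (N - 1 + CARD('n))) * sh (N - 1) \<psi>) + norm g * sh N \<psi>"
proof -
  define u where "u i k = (\<Sum>j\<in>UNIV. R $ i $ j * app (cr j) \<psi> k)" for i k
  have "sqrt (real (Suc N)) * sh (Suc N) \<phi> = L2_set (\<lambda>i. sh N (app (an i) \<phi>)) UNIV"
    by (simp add: L2_set_def sum_sh_an real_sqrt_mult)
  also have "\<dots> \<le> L2_set (\<lambda>i. sh N (u i) + sh N (\<lambda>k. g $ i * \<psi> k)) UNIV"
  proof (rule L2_set_mono)
    fix i
    have "app (an i) \<phi> = (\<lambda>k. - (u i k + g $ i * \<psi> k))" by (simp add: an u_def fun_eq_iff)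
    then have "sh N (app (an i) \<phi>) = sh N (\<lambda>k. u i k + g $ i * \<psi> k)" by (simp only: sh_minus)
    then show "sh N (app (an i) \<phi>) \<le> sh N (u i) + sh N (\<lambda>k. g $ i * \<psi> k)" by (simp only: sh_add)
  qed simp
  also have "\<dots> \<le> L2_set (\<lambda>i. sh N (u i)) UNIV + L2_set (\<lambda>i. sh N (\<lambda>k. g $ i * \<psi> k)) UNIV"
    by (rule L2_set_triangle_ineq)
  also have "L2_set (\<lambda>i. sh N (\<lambda>k. g $ i * \<psi> k)) UNIV = norm g * sh N \<psi>"
    by (simp add: sh_scale norm_vec_def L2_set_left_distrib)
  also have "L2_set (\<lambda>i. sh N (u i)) UNIV \<le> r * (if N = 0 then 0 else sqrt (real (N - 1 + CARD('n))) * sh (N - 1) \<psi>)"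
  proof -
    define x where "x k = (\<chi> j. app (cr j) \<psi> k)" for k
    have u: "u i k = (R *v x k) $ i" for i k by (simp add: u_def x_def matrix_vector_mult_def)
    have n2: "(norm y)\<^sup>2 = (\<Sum>i\<in>UNIV. (cmod (y $ i))\<^sup>2)" for y :: "complex^'n"
      by (simp add: norm_vec_def L2_set_def sum_nonneg)
    have "(\<Sum>i\<in>UNIV. (sh N (u i))\<^sup>2) = (\<Sum>k\<in>shell N. (norm (R *v x k))\<^sup>2)"
      by (simp add: sh_power2 n2 u sum.swap[of _ _ UNIV])
    also have "\<dots> \<le> (\<Sum>k\<in>shell N. r\<^sup>2 * (norm (x k))\<^sup>2)"
    proof (intro sum_mono)
      fix k
      have "(norm (R *v x k))\<^sup>2 \<le> (r * norm (x k))\<^sup>2" by (intro power_mono R) simp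
      then show "(norm (R *v x k))\<^sup>2 \<le> r\<^sup>2 * (norm (x k))\<^sup>2" by (simp add: power_mult_distrib)
    qed
    also have "\<dots> = r\<^sup>2 * (\<Sum>j\<in>UNIV. (sh N (app (cr j) \<psi>))\<^sup>2)"
      by (simp add: sh_power2 n2 x_def sum.swap[of _ _ UNIV] sum_distrib_left)
    also have "(\<Sum>j\<in>UNIV. (sh N (app (cr j) \<psi>))\<^sup>2) = (if N = 0 then 0 else sqrt (real (N - 1 + CARD('n))) * sh (N - 1) \<psi>)\<^sup>2"
      using sum_sh_cr[of "N - 1" \<psi>] by (auto simp: sh_cr_0 power_mult_distrib)
    finally show ?thesis
      unfolding L2_set_def using r by (intro real_le_lsqrt) (auto simp: power_mult_distrib sum_nonneg)
  qed
  finally show ?thesis by simp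
qed

lemma ex_decay_constants:
  fixes r \<gamma> :: real and n :: nat
  assumes r: "0 \<le> r" "r < 1" and \<gamma>: "0 \<le> \<gamma>" and n: "n \<ge> 1"
  shows "\<exists>C \<mu>. 0 < C \<and> 0 < \<mu> \<and> \<mu> < 1 \<and> (\<forall>x :: nat \<Rightarrow> nat \<Rightarrow> real.
     (\<forall>m N. 0 \<le> x m N) \<longrightarrow> x 0 0 \<le> 1 \<longrightarrow> (\<forall>N. x 0 (Suc N) = 0) \<longrightarrow> (\<forall>m. x (Suc m) 0 = 0) \<longrightarrow>
     (\<forall>m N. sqrt (real (Suc N)) * x (Suc m) (Suc N) \<le>
        r * (if N = 0 then 0 else sqrt (real (N - 1 + n)) * x m (N - 1)) + \<gamma> * x m N) \<longrightarrow>
     (\<forall>m N. x m N \<le> C * \<mu> ^ N * \<mu> ^ m))"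
proof -
  define \<mu> where "\<mu> = 1 - (1 - r) / 4"
  have \<mu>: "0 < \<mu>" "\<mu> < 1" using r by (auto simp: \<mu>_def)
  have "r < \<mu> ^ 3"
  proof -
    have eq: "\<mu> = 1 + - ((1 - r) / 4)" by (simp add: \<mu>_def)
    have "1 + real 3 * (- ((1 - r) / 4)) \<le> \<mu> ^ 3"
      unfolding eq using r by (intro Bernoulli_inequality) auto
    moreover have "r < 1 + real 3 * (- ((1 - r) / 4))" using r by (simp add: field_simps)
    ultimately show ?thesis by linarith
  qed
  then have "r / \<mu> ^ 3 < 1" using \<mu> by simp
  moreover have "(\<lambda>N. r * (1 + real n * inverse (real (Suc N))) / \<mu> ^ 3 + \<gamma> * sqrt (inverse (real (Suc N))) / \<mu>\<^sup>2)
      \<longlonglongrightarrow> r * (1 + real n * 0) / \<mu> ^ 3 + \<gamma> * sqrt 0 / \<mu>\<^sup>2"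
    using \<mu> by (intro tendsto_intros LIMSEQ_inverse_real_of_nat) auto
  ultimately have "\<forall>\<^sub>F N in sequentially. r * (1 + real n * inverse (real (Suc N))) / \<mu> ^ 3
      + \<gamma> * sqrt (inverse (real (Suc N))) / \<mu>\<^sup>2 < 1"
    by (intro order_tendstoD(2)[of _ "r / \<mu> ^ 3"]) simp_all
  then obtain N0 where N0: "\<And>N. N \<ge> N0 \<Longrightarrow> r * (1 + real n * inverse (real (Suc N))) / \<mu> ^ 3
      + \<gamma> * sqrt (inverse (real (Suc N))) / \<mu>\<^sup>2 < 1"
    by (auto simp: eventually_sequentially)
  define K where "K = real n + \<gamma> + 1"
  have K: "K \<ge> 1" using \<gamma> by (simp add: K_def)
  define C where "C = K ^ N0 / \<mu> ^ (2 * N0)"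
  have C: "C > 0" using K \<mu> by (simp add: C_def)
  have main: "x m N \<le> C * \<mu> ^ N * \<mu> ^ m"
    if x0: "\<forall>m N. 0 \<le> x m N" and x1: "x 0 0 \<le> 1" and x2: "\<forall>N. x 0 (Suc N) = 0" and x3: "\<forall>m. x (Suc m) 0 = 0"
    and rec: "\<forall>m N. sqrt (real (Suc N)) * x (Suc m) (Suc N) \<le>
        r * (if N = 0 then 0 else sqrt (real (N - 1 + n)) * x m (N - 1)) + \<gamma> * x m N" for x :: "nat \<Rightarrow> nat \<Rightarrow> real" and m N
  proof -
    have zero: "x m N = 0" if "N < m" for m N
      using that
    proof (induction m arbitrary: N)
      case (Suc m)
      show ?case
      proof (cases N)
        case (Suc N')
        then have "N' < m" "N' - 1 < m" using Suc.prems by auto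
        then have "sqrt (real (Suc N')) * x (Suc m) (Suc N') \<le> 0"
          using rec[rule_format, of N' m] Suc.IH by (auto split: if_splits)
        then have "x (Suc m) (Suc N') \<le> 0" by (simp add: mult_le_0_iff)
        then show ?thesis using x0[rule_format, of "Suc m" "Suc N'"] Suc by simp
      qed (simp add: x3)
    qed simp
    have small: "x m N \<le> K ^ N" for m N
    proof (induction m arbitrary: N)
      case 0
      then show ?case using x1 x2 K by (cases N) auto
    next
      case (Suc m)
      show ?case
      proof (cases N)
        case (Suc N')
        have a: "r * (if N' = 0 then 0 else sqrt (real (N' - 1 + n)) * x m (N' - 1)) \<le> sqrt (real (Suc N')) * (real n * K ^ N')"
        proof (cases "N' = 0")
          case False
          have "N' - 1 + n \<le> Suc N' * (n * n)"
          proof -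
            have "1 \<le> n * n" "n \<le> n * n" using n by (simp_all add: Suc_le_eq)
            moreover have "N' \<le> N' * (n * n)" using \<open>1 \<le> n * n\<close> by (metis mult.right_neutral mult_le_mono2)
            moreover have "Suc N' * (n * n) = n * n + N' * (n * n)" by simp
            ultimately show ?thesis by linarith
          qed
          then have "sqrt (real (N' - 1 + n)) \<le> sqrt (real (Suc N' * (n * n)))" 
            by (simp only: real_sqrt_le_iff of_nat_le_iff)
          then have "sqrt (real (N' - 1 + n)) \<le> sqrt (real (Suc N')) * real n"
            by (simp only: of_nat_mult real_sqrt_mult real_sqrt_mult_self abs_of_nat)
          moreover have "x m (N' - 1) \<le> K ^ N'"
            using Suc.IH[of "N' - 1"] power_increasing[of "N' - 1" N' K] K by simp
          ultimately have "sqrt (real (N' - 1 + n)) * x m (N' - 1) \<le> (sqrt (real (Suc N')) * real n) * K ^ N'"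
            using x0 by (intro mult_mono) auto
          then have "r * (sqrt (real (N' - 1 + n)) * x m (N' - 1)) \<le> 1 * ((sqrt (real (Suc N')) * real n) * K ^ N')"
            by (rule mult_mono[OF less_imp_le[OF r(2)]]) (use x0 in auto)
          then show ?thesis using False by (simp add: mult.assoc)
        qed (use K in auto)
        have "\<gamma> * x m N' \<le> \<gamma> * K ^ N'" using Suc.IH \<gamma> by (intro mult_left_mono) auto
        also have "\<dots> \<le> sqrt (real (Suc N')) * (\<gamma> * K ^ N')"
          using \<gamma> K mult_right_mono[of 1 "sqrt (real (Suc N'))" "\<gamma> * K ^ N'"] by simp
        finally have "sqrt (real (Suc N')) * x (Suc m) (Suc N') \<le>
            sqrt (real (Suc N')) * (real n * K ^ N' + \<gamma> * K ^ N')"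
          using a rec[rule_format, of N' m] by (simp add: distrib_left)
        then have "x (Suc m) (Suc N') \<le> real n * K ^ N' + \<gamma> * K ^ N'"
          by (subst (asm) mult_le_cancel_left_pos) auto
        also have "\<dots> \<le> K ^ Suc N'" using K by (simp add: K_def distrib_right)
        finally show ?thesis using Suc by simp
      qed (use x3 K in auto)
    qed
    show ?thesis
    proof (induction m arbitrary: N)
      case 0
      have "\<mu> ^ (2 * N0) \<le> 1" "1 \<le> K ^ N0" using K \<mu> by (auto intro: power_le_one one_le_power)
      then have "\<mu> ^ (2 * N0) \<le> K ^ N0" by linarith
      then have "1 \<le> C" using \<mu> by (simp add: C_def)
      then show ?case using x1 x2 C \<mu> by (cases N) auto
    next
      case (Suc m)
      show ?case
      proof (cases "N \<le> N0")
        case True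
        show ?thesis
        proof (cases "N < Suc m")
          case True
          then show ?thesis using zero[of N "Suc m"] C \<mu> by simp
        next
          case False
          have "x (Suc m) N \<le> K ^ N0"
            using small[of "Suc m" N] power_increasing[OF True K] by simp
          also have "\<dots> = C * \<mu> ^ (2 * N0)" using \<mu> by (simp add: C_def)
          also have "\<dots> \<le> C * \<mu> ^ (N + Suc m)"
            using True False C \<mu> by (intro mult_left_mono power_decreasing) auto
          finally show ?thesis by (simp only: power_add mult.assoc)
        qed
      next
        case False
        then obtain N' where N': "N = Suc N'" "N' \<ge> N0" by (cases N) auto
        define s where "s = sqrt (real (Suc N'))"
        have s: "s > 0" by (simp add: s_def)
        have si: "sqrt (inverse (real (Suc N'))) = 1 / s" unfolding s_def real_sqrt_inverse by (rule inverse_eq_divide)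
        have a: "r * (if N' = 0 then 0 else sqrt (real (N' - 1 + n)) * x m (N' - 1))
            \<le> r * (s * (1 + real n * inverse (real (Suc N')))) * (C * \<mu> ^ Suc N' * \<mu> ^ Suc m / \<mu> ^ 3)"
        proof (cases "N' = 0")
          case False
          have "real (N' - 1 + n) \<le> real (Suc N') * (1 + real n * inverse (real (Suc N')))"
          proof -
            have "real (Suc N') * (1 + real n * inverse (real (Suc N'))) = real (Suc N') + real n"
              by (simp add: distrib_left)
            moreover have "N' - 1 + n \<le> Suc N' + n" by simp
            ultimately show ?thesis by linarith
          qed
          also have "\<dots> \<le> real (Suc N') * (1 + real n * inverse (real (Suc N')))\<^sup>2"
          proof -
            have "(1 + real n * inverse (real (Suc N'))) * 1 \<le> (1 + real n * inverse (real (Suc N'))) * (1 + real n * inverse (real (Suc N')))"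
              by (intro mult_left_mono) auto
            then show ?thesis by (intro mult_left_mono) (auto simp: power2_eq_square)
          qed
          finally have "sqrt (real (N' - 1 + n)) \<le> sqrt (real (Suc N') * (1 + real n * inverse (real (Suc N')))\<^sup>2)"
            by (simp only: real_sqrt_le_iff)
          also have "\<dots> = s * (1 + real n * inverse (real (Suc N')))"
            by (simp add: real_sqrt_mult s_def del: of_nat_Suc)
          finally have 1: "sqrt (real (N' - 1 + n)) \<le> s * (1 + real n * inverse (real (Suc N')))" .
          have 2: "x m (N' - 1) \<le> C * \<mu> ^ Suc N' * \<mu> ^ Suc m / \<mu> ^ 3"
          proof -
            obtain N'' where "N' = Suc N''" using False by (cases N') auto
            moreover have "C * \<mu> ^ Suc (Suc N'') * \<mu> ^ Suc m / \<mu> ^ 3 = C * \<mu> ^ N'' * \<mu> ^ m"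
              using \<mu> by (simp add: power3_eq_cube)
            ultimately show ?thesis using Suc.IH[of N''] by simp
          qed
          have "0 \<le> s * (1 + real n * inverse (real (Suc N')))"
            using s by (intro mult_nonneg_nonneg add_nonneg_nonneg) auto
          then have "sqrt (real (N' - 1 + n)) * x m (N' - 1)
              \<le> s * (1 + real n * inverse (real (Suc N'))) * (C * \<mu> ^ Suc N' * \<mu> ^ Suc m / \<mu> ^ 3)"
            by (rule mult_mono[OF 1 2 _ x0[rule_format]])
          from mult_left_mono[OF this r(1)] show ?thesis
            by (simp only: if_not_P[OF False] mult.assoc)
        next
          case True
          have "0 \<le> r * (s * (1 + real n * inverse (real (Suc N')))) * (C * \<mu> ^ Suc N' * \<mu> ^ Suc m / \<mu> ^ 3)"
            using r s C \<mu> by (intro mult_nonneg_nonneg add_nonneg_nonneg divide_nonneg_nonneg) auto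
          then show ?thesis by (simp only: if_P[OF True] mult_zero_right)
        qed
        have b: "\<gamma> * x m N' \<le> \<gamma> * (C * \<mu> ^ Suc N' * \<mu> ^ Suc m / \<mu>\<^sup>2)"
        proof -
          have "C * \<mu> ^ Suc N' * \<mu> ^ Suc m / \<mu>\<^sup>2 = C * \<mu> ^ N' * \<mu> ^ m"
            using \<mu> by (simp add: power2_eq_square)
          then show ?thesis using Suc.IH[of N'] \<gamma> by (simp add: mult_left_mono)
        qed
        have "s * x (Suc m) (Suc N') \<le> r * (s * (1 + real n * inverse (real (Suc N')))) * (C * \<mu> ^ Suc N' * \<mu> ^ Suc m / \<mu> ^ 3)
           + \<gamma> * (C * \<mu> ^ Suc N' * \<mu> ^ Suc m / \<mu>\<^sup>2)"
          using rec[rule_format, of N' m] a b by (simp only: s_def)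
        also have "\<dots> = s * (C * \<mu> ^ Suc N' * \<mu> ^ Suc m) *
           (r * (1 + real n * inverse (real (Suc N'))) / \<mu> ^ 3 + \<gamma> * sqrt (inverse (real (Suc N'))) / \<mu>\<^sup>2)"
        proof -
          have e1: "\<gamma> * (P / b) = s * P * (\<gamma> * (1 / s) / b)" for P b using s by simp
          have e2: "r * (s * e) * (P / b) = s * P * (r * e / b)" for e P b by simp
          show ?thesis unfolding si
            by (rule trans[OF arg_cong2[of _ _ _ _ "(+)", OF e2 e1] distrib_left[symmetric]])
        qed
        also have "\<dots> \<le> s * (C * \<mu> ^ Suc N' * \<mu> ^ Suc m) * 1"
        proof (rule mult_left_mono)
          show "0 \<le> s * (C * \<mu> ^ Suc N' * \<mu> ^ Suc m)" using s C \<mu> by simp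
        qed (rule less_imp_le[OF N0[OF N'(2)]])
        finally have "s * x (Suc m) (Suc N') \<le> s * (C * \<mu> ^ Suc N' * \<mu> ^ Suc m)" by (simp only: mult_1_right)
        then show ?thesis using s unfolding N'(1) by (rule mult_left_le_imp_le)
      qed
    qed
  qed
  show ?thesis
  proof (rule exI[of _ C], rule exI[of _ \<mu>], intro conjI allI impI)
    show "0 < C" "0 < \<mu>" "\<mu> < 1" using C \<mu> by auto
  next
    fix x :: "nat \<Rightarrow> nat \<Rightarrow> real" and m N
    assume "\<forall>m N. 0 \<le> x m N" "x 0 0 \<le> 1" "\<forall>N. x 0 (Suc N) = 0" "\<forall>m. x (Suc m) 0 = 0"
      "\<forall>m N. sqrt (real (Suc N)) * x (Suc m) (Suc N) \<le>
        r * (if N = 0 then 0 else sqrt (real (N - 1 + n)) * x m (N - 1)) + \<gamma> * x m N"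
    then show "x m N \<le> C * \<mu> ^ N * \<mu> ^ m" by (rule main)
  qed
qed

section \<open>Exponential decay in the particle number\<close>

lemma disjoint_shells: "{k. deg k < N} = (\<Union>m<N. shell m)"
  by (auto simp: shell_def)

lemma sum_deg_less: "(\<Sum>k | deg k < N. f k) = (\<Sum>m<N. \<Sum>k\<in>shell m. f k)"
  for f :: "('n :: finite \<Rightarrow> nat) \<Rightarrow> 'a :: comm_monoid_add"
  unfolding disjoint_shells by (rule sum.UNION_disjoint) (auto simp: shell_def finite_shell[unfolded shell_def])

lemma finite_deg_less: "finite {k :: 'n :: finite \<Rightarrow> nat. deg k < N}"
  by (rule finite_subset[OF _ finite_deg_le[of N]]) auto

lemma fock_norm_nonneg [simp]: "0 \<le> fock_norm \<psi>"
  by (simp add: fock_norm_def infsum_nonneg)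

lemma fock_norm_power2: "(fock_norm \<psi>)\<^sup>2 = (\<Sum>\<^sub>\<infinity>k. (cmod (\<psi> k))\<^sup>2)"
  by (simp add: fock_norm_def infsum_nonneg)

lemma fock_shells:
  assumes "\<psi> \<in> fock" shows "(\<Sum>m<N. (sh m \<psi>)\<^sup>2) \<le> (fock_norm \<psi>)\<^sup>2"
  unfolding fock_norm_power2 sh_power2 sum_deg_less[symmetric]
  using assms by (intro finite_sum_le_infsum finite_deg_less) (auto simp: fock_def)

lemma fock_if_shells:
  assumes "\<And>N. (\<Sum>m<N. (sh m \<psi>)\<^sup>2) \<le> M"
  shows "\<psi> \<in> fock" "(fock_norm \<psi>)\<^sup>2 \<le> M"
proof -
  have *: "(\<Sum>k\<in>F. (cmod (\<psi> k))\<^sup>2) \<le> M" if "finite F" for F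
  proof -
    have "finite (deg ` F)" using that by simp
    obtain N where "\<forall>k\<in>F. deg k < N"
      using \<open>finite (deg ` F)\<close> unfolding finite_nat_set_iff_bounded by auto
    then have "(\<Sum>k\<in>F. (cmod (\<psi> k))\<^sup>2) \<le> (\<Sum>k | deg k < N. (cmod (\<psi> k))\<^sup>2)"
      by (intro sum_mono2 finite_deg_less) auto
    also have "\<dots> \<le> M" using assms[of N] by (simp add: sum_deg_less sh_power2)
    finally show ?thesis .
  qed
  have s: "(\<lambda>k. (cmod (\<psi> k))\<^sup>2) summable_on UNIV"
    by (rule nonneg_bdd_above_summable_on) (use * in \<open>auto intro!: bdd_aboveI[of _ M]\<close>)
  then show "\<psi> \<in> fock" by (simp add: fock_def)
  show "(fock_norm \<psi>)\<^sup>2 \<le> M"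
    unfolding fock_norm_power2 by (rule infsum_le_finite_sums[OF s]) (use * in auto)
qed

definition decays :: "real \<Rightarrow> real \<Rightarrow> ('n :: finite) state \<Rightarrow> bool" where
  "decays C \<mu> \<psi> \<longleftrightarrow> (\<forall>N. sh N \<psi> \<le> C * \<mu> ^ N)"

lemma decays_fock:
  assumes "decays C \<mu> \<psi>" "0 < \<mu>" "\<mu> < 1"
  shows "\<psi> \<in> fock" "(fock_norm \<psi>)\<^sup>2 \<le> C\<^sup>2 / (1 - \<mu>\<^sup>2)"
proof -
  have m: "0 \<le> \<mu>\<^sup>2" "\<mu>\<^sup>2 < 1" using assms by (auto simp: power_less_one_iff abs_square_less_1)
  have "(\<Sum>m<N. (sh m \<psi>)\<^sup>2) \<le> C\<^sup>2 / (1 - \<mu>\<^sup>2)" for N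
  proof -
    have "(\<Sum>m<N. (sh m \<psi>)\<^sup>2) \<le> (\<Sum>m<N. C\<^sup>2 * (\<mu>\<^sup>2) ^ m)"
    proof (intro sum_mono)
      fix m
      have "(sh m \<psi>)\<^sup>2 \<le> (C * \<mu> ^ m)\<^sup>2"
        using assms(1) by (intro power_mono) (auto simp: decays_def)
      then show "(sh m \<psi>)\<^sup>2 \<le> C\<^sup>2 * (\<mu>\<^sup>2) ^ m"
        by (simp add: power_mult_distrib power_mult[symmetric] mult.commute)
    qed
    also have "\<dots> = C\<^sup>2 * (\<Sum>m<N. (\<mu>\<^sup>2) ^ m)" by (simp add: sum_distrib_left)
    also have "\<dots> \<le> C\<^sup>2 * (\<Sum>m. (\<mu>\<^sup>2) ^ m)"
      using m by (intro mult_left_mono sum_le_suminf summable_geometric) auto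
    also have "\<dots> = C\<^sup>2 / (1 - \<mu>\<^sup>2)" using m by (simp add: suminf_geometric)
    finally show ?thesis .
  qed
  then show "\<psi> \<in> fock" "(fock_norm \<psi>)\<^sup>2 \<le> C\<^sup>2 / (1 - \<mu>\<^sup>2)" using fock_if_shells by blast+
qed

lemma ex_weight_bound:
  assumes "0 < \<mu>" "\<mu> < (1 :: real)"
  shows "\<exists>D \<nu>. 0 < D \<and> \<mu> \<le> \<nu> \<and> \<nu> < 1 \<and> (\<forall>N. sqrt (real (Suc N)) * \<mu> ^ N \<le> D * \<nu> ^ N)"
proof -
  define \<nu> where "\<nu> = (\<mu> + 1) / 2"
  have \<nu>: "\<mu> < \<nu>" "\<nu> < 1" using assms by (auto simp: \<nu>_def)
  define q where "q = \<mu> / \<nu>"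
  have q: "0 < q" "q < 1" using assms \<nu> by (auto simp: q_def)
  have "(\<lambda>N. real N * q ^ N) \<longlonglongrightarrow> 0" using q by (intro powser_times_n_limit_0) auto
  then have "Bseq (\<lambda>N. real N * q ^ N)" by (intro convergent_imp_Bseq convergentI)
  then obtain D where D: "D > 0" "\<And>N. \<bar>real N * q ^ N\<bar> \<le> D" by (auto simp: Bseq_def)
  have "sqrt (real (Suc N)) * \<mu> ^ N \<le> (D + 1) * \<nu> ^ N" for N
  proof -
    have "sqrt (real (Suc N)) \<le> real (Suc N)" 
    proof -
      have "sqrt (real (Suc N)) * 1 \<le> sqrt (real (Suc N)) * sqrt (real (Suc N))"
        by (intro mult_left_mono) auto
      then show ?thesis by simp
    qed
    then have "sqrt (real (Suc N)) * q ^ N \<le> real N * q ^ N + q ^ N"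
      using mult_right_mono[of "sqrt (real (Suc N))" "real (Suc N)" "q ^ N"] q by (simp add: distrib_right)
    also have "\<dots> \<le> D + 1" using D(2)[of N] q power_le_one[of q N] by linarith
    finally have "sqrt (real (Suc N)) * q ^ N * \<nu> ^ N \<le> (D + 1) * \<nu> ^ N"
      using \<nu> assms by (intro mult_right_mono) auto
    then show ?thesis using \<nu> assms by (simp add: q_def power_divide)
  qed
  then show ?thesis using D \<nu> by (intro exI[of _ "D + 1"] exI[of _ \<nu>]) auto
qed

lemma decays_mono: "decays C \<mu> \<psi> \<Longrightarrow> C \<le> C' \<Longrightarrow> 0 \<le> C \<Longrightarrow> 0 \<le> \<mu> \<Longrightarrow> \<mu> \<le> \<mu>' \<Longrightarrow> decays C' \<mu>' \<psi>"
  unfolding decays_def by (meson mult_mono order_trans power_mono zero_le_power)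

lemma decays_an_cr:
  assumes \<mu>: "0 < \<mu>" "\<mu> < 1"
  shows "\<exists>D \<nu>. 0 < D \<and> 0 < \<nu> \<and> \<nu> < 1 \<and> (\<forall>C (\<psi> :: ('n :: finite) state) i. 0 \<le> C \<longrightarrow> decays C \<mu> \<psi> \<longrightarrow>
     decays (D * C) \<nu> \<psi> \<and> decays (D * C) \<nu> (app (an i) \<psi>) \<and> decays (D * C) \<nu> (app (cr i) \<psi>))"
proof -
  obtain D \<nu> where D: "0 < D" "\<mu> \<le> \<nu>" "\<nu> < 1" and b: "\<And>N. sqrt (real (Suc N)) * \<mu> ^ N \<le> D * \<nu> ^ N"
    using ex_weight_bound[OF \<mu>] by blast
  have D1: "1 \<le> D" using b[of 0] by simp
  have \<nu>: "0 < \<nu>" using D \<mu> by simp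
  define E where "E = D / \<nu>"
  have E: "D \<le> E" "0 < E" using D \<nu> by (auto simp: E_def field_simps)
  show ?thesis
  proof (rule exI[of _ E], rule exI[of _ \<nu>], intro conjI allI impI)
    fix C :: real and \<psi> ::  "'n state" and i assume C: "0 \<le> C" and d: "decays C \<mu> \<psi>"
    have "C \<le> E * C" using C D1 E mult_right_mono[of 1 E C] by simp
    then show "decays (E * C) \<nu> \<psi>" using d C D \<mu> by (intro decays_mono[OF d]) auto
    show "decays (E * C) \<nu> (app (an i) \<psi>)"
      unfolding decays_def
    proof
      fix N
      have "sh N (app (an i) \<psi>) \<le> sqrt (real (Suc N)) * sh (Suc N) \<psi>" by (rule sh_an)
      also have "\<dots> \<le> sqrt (real (Suc N)) * (C * \<mu> ^ Suc N)"
        using d[unfolded decays_def, rule_format, of "Suc N"] by (rule mult_left_mono) simp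
      also have "\<dots> = C * \<mu> * (sqrt (real (Suc N)) * \<mu> ^ N)" by simp
      also have "\<dots> \<le> C * 1 * (E * \<nu> ^ N)"
      proof (rule mult_mono)
        show "C * \<mu> \<le> C * 1" using C \<mu> by (intro mult_left_mono) auto
        have "D * \<nu> ^ N \<le> E * \<nu> ^ N" using E \<nu> by (intro mult_right_mono) auto
        then show "sqrt (real (Suc N)) * \<mu> ^ N \<le> E * \<nu> ^ N" using b[of N] by (rule order_trans[rotated])
      qed (use C \<mu> in auto)
      finally show "sh N (app (an i) \<psi>) \<le> E * C * \<nu> ^ N" by (simp add: mult_ac)
    qed
    show "decays (E * C) \<nu> (app (cr i) \<psi>)"
      unfolding decays_def
    proof
      fix N
      show "sh N (app (cr i) \<psi>) \<le> E * C * \<nu> ^ N"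
      proof (cases N)
        case (Suc N')
        have "sh N (app (cr i) \<psi>) \<le> sqrt (real (Suc N')) * sh N' \<psi>" unfolding Suc by (rule sh_cr)
        also have "\<dots> \<le> sqrt (real (Suc N')) * (C * \<mu> ^ N')"
          using d[unfolded decays_def, rule_format, of N'] by (rule mult_left_mono) simp
        also have "\<dots> = C * (sqrt (real (Suc N')) * \<mu> ^ N')" by simp
        also have "\<dots> \<le> C * (D * \<nu> ^ N')" using C b by (intro mult_left_mono)
        also have "\<dots> = E * C * \<nu> ^ N" using \<nu> by (simp add: E_def Suc)
        finally show ?thesis .
      qed (use E C in \<open>simp add: sh_cr_0\<close>)
    qed
    qed (use E \<nu> D in auto)
qed

lemma decays_add: "decays C \<mu> \<phi> \<Longrightarrow> decays D \<mu> \<psi> \<Longrightarrow> decays (C + D) \<mu> (\<lambda>k. \<phi> k + \<psi> k)"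
  unfolding decays_def by (metis add_mono distrib_right order_trans sh_add)

lemma decays_scale: "decays C \<mu> \<psi> \<Longrightarrow> cmod c \<le> L \<Longrightarrow> 0 \<le> C \<Longrightarrow> 0 \<le> \<mu> \<Longrightarrow> decays (L * C) \<mu> (\<lambda>k. c * \<psi> k)"
  unfolding decays_def sh_scale mult.assoc by (intro allI mult_mono) (auto intro: order_trans[OF norm_ge_zero])

definition loc_decays :: "(real \<Rightarrow> ('n :: finite) state) \<Rightarrow> bool" where
  "loc_decays w \<longleftrightarrow> (\<forall>T. \<exists>C \<mu>. 0 \<le> C \<and> 0 < \<mu> \<and> \<mu> < 1 \<and> (\<forall>t. \<bar>t\<bar> \<le> T \<longrightarrow> decays C \<mu> (w t)))"

definition loc_bounded :: "(real \<Rightarrow> complex) \<Rightarrow> bool" where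
  "loc_bounded c \<longleftrightarrow> (\<forall>T. \<exists>L. \<forall>t. \<bar>t\<bar> \<le> T \<longrightarrow> cmod (c t) \<le> L)"

lemma loc_bounded_continuous:
  assumes "continuous_on UNIV c" shows "loc_bounded c"
proof -
  have "bounded (c ` {- T..T})" for T :: real
    using assms by (intro compact_imp_bounded compact_continuous_image continuous_on_subset[OF assms]) auto
  then have "\<exists>L. \<forall>t\<in>{- T..T}. cmod (c t) \<le> L" for T :: real
    by (simp add: bounded_iff)
  then show ?thesis by (simp add: loc_bounded_def abs_le_iff Ball_def minus_le_iff conj_commute)
qed

lemma loc_decays_add:
  assumes "loc_decays v" "loc_decays w" shows "loc_decays (\<lambda>t k. v t k + w t k)"
  unfolding loc_decays_def
proof
  fix T
  from assms(1)[unfolded loc_decays_def, rule_format, of T] obtain C \<mu> where 1: "0 \<le> C" "0 < \<mu>" "\<mu> < 1" "\<forall>t. \<bar>t\<bar> \<le> T \<longrightarrow> decays C \<mu> (v t)"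
    by blast
  from assms(2)[unfolded loc_decays_def, rule_format, of T] obtain D \<nu> where 2: "0 \<le> D" "0 < \<nu>" "\<nu> < 1" "\<forall>t. \<bar>t\<bar> \<le> T \<longrightarrow> decays D \<nu> (w t)"
    by blast
  have "decays C (max \<mu> \<nu>) (v t)" "decays D (max \<mu> \<nu>) (w t)" if "\<bar>t\<bar> \<le> T" for t
    by (rule decays_mono[OF 1(4)[rule_format, OF that]] decays_mono[OF 2(4)[rule_format, OF that]];
        use 1 2 in simp)+
  then have "\<forall>t. \<bar>t\<bar> \<le> T \<longrightarrow> decays (C + D) (max \<mu> \<nu>) (\<lambda>k. v t k + w t k)"
    by (auto intro: decays_add)
  then show "\<exists>C \<mu>. 0 \<le> C \<and> 0 < \<mu> \<and> \<mu> < 1 \<and> (\<forall>t. \<bar>t\<bar> \<le> T \<longrightarrow> decays C \<mu> (\<lambda>k. v t k + w t k))"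
    using 1 2 by (intro exI[of _ "C + D"] exI[of _ "max \<mu> \<nu>"]) auto
qed

lemma loc_decays_scale:
  assumes "loc_decays w" "loc_bounded c" shows "loc_decays (\<lambda>t k. c t * w t k)"
  unfolding loc_decays_def
proof
  fix T
  from assms(1)[unfolded loc_decays_def, rule_format, of T] obtain C \<mu> where 1: "0 \<le> C" "0 < \<mu>" "\<mu> < 1" "\<forall>t. \<bar>t\<bar> \<le> T \<longrightarrow> decays C \<mu> (w t)"
    by blast
  obtain L where "\<forall>t. \<bar>t\<bar> \<le> T \<longrightarrow> cmod (c t) \<le> L" using assms(2) unfolding loc_bounded_def by blast
  then have L: "\<forall>t. \<bar>t\<bar> \<le> T \<longrightarrow> cmod (c t) \<le> \<bar>L\<bar>" by fastforce
  have "\<forall>t. \<bar>t\<bar> \<le> T \<longrightarrow> decays (\<bar>L\<bar> * C) \<mu> (\<lambda>k. c t * w t k)"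
    using 1 L by (intro allI impI decays_scale) auto
  then show "\<exists>C \<mu>. 0 \<le> C \<and> 0 < \<mu> \<and> \<mu> < 1 \<and> (\<forall>t. \<bar>t\<bar> \<le> T \<longrightarrow> decays C \<mu> (\<lambda>k. c t * w t k))"
    using 1 by (intro exI[of _ "\<bar>L\<bar> * C"] exI[of _ \<mu>]) auto
qed

lemma loc_decays_sum:
  assumes "finite S" "\<And>i. i \<in> S \<Longrightarrow> loc_decays (w i)" shows "loc_decays (\<lambda>t k. \<Sum>i\<in>S. w i t k)"
  using assms
proof (induction S rule: finite_induct)
  case empty
  have "decays 0 (1/2) (\<lambda>k. 0 :: complex)" by (simp add: decays_def sh_zero)
  then show ?case unfolding loc_decays_def by (intro allI exI[of _ 0] exI[of _ "1/2"]) auto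
next
  case (insert x F)
  then show ?case by (simp add: loc_decays_add)
qed

lemma loc_decays_an_cr:
  assumes "loc_decays w"
  shows "loc_decays (\<lambda>t. app (an i) (w t))" "loc_decays (\<lambda>t. app (cr i) (w t))"
proof -
  have "\<exists>C \<mu>. 0 \<le> C \<and> 0 < \<mu> \<and> \<mu> < 1 \<and>
    (\<forall>t. \<bar>t\<bar> \<le> T \<longrightarrow> decays C \<mu> (app (an i) (w t)) \<and> decays C \<mu> (app (cr i) (w t)))" for T
  proof -
    from assms(1)[unfolded loc_decays_def, rule_format, of T] obtain C \<mu> where 1: "0 \<le> C" "0 < \<mu>" "\<mu> < 1" "\<forall>t. \<bar>t\<bar> \<le> T \<longrightarrow> decays C \<mu> (w t)"
      by blast
    obtain D \<nu> where D: "0 < D" "0 < \<nu>" "\<nu> < 1" and d: "\<And>C \<psi> i. 0 \<le> C \<Longrightarrow> decays C \<mu> (\<psi> :: 'a state) \<Longrightarrow>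
       decays (D * C) \<nu> \<psi> \<and> decays (D * C) \<nu> (app (an i) \<psi>) \<and> decays (D * C) \<nu> (app (cr i) \<psi>)"
      using decays_an_cr[OF 1(2,3)] by blast
    show ?thesis using 1 D d by (intro exI[of _ "D * C"] exI[of _ \<nu>]) auto
  qed
  then show "loc_decays (\<lambda>t. app (an i) (w t))" "loc_decays (\<lambda>t. app (cr i) (w t))"
    unfolding loc_decays_def by blast+
qed

lemma loc_decays_bounded:
  assumes "loc_decays w"
  shows "\<exists>M. \<forall>t. \<bar>t\<bar> \<le> T \<longrightarrow> (\<forall>N. (\<Sum>m<N. (sh m (w t))\<^sup>2) \<le> M)"
proof -
  from assms(1)[unfolded loc_decays_def, rule_format, of T] obtain C \<mu> where 1: "0 \<le> C" "0 < \<mu>" "\<mu> < 1" "\<forall>t. \<bar>t\<bar> \<le> T \<longrightarrow> decays C \<mu> (w t)"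
    by blast
  show ?thesis
    by (rule exI[of _ "C\<^sup>2 / (1 - \<mu>\<^sup>2)"]) (use decays_fock[OF _ 1(2,3)] 1(4) fock_shells order_trans in blast)
qed

section \<open>The inner product and its truncations\<close>

definition sip :: "nat \<Rightarrow> ('n :: finite) state \<Rightarrow> 'n state \<Rightarrow> complex" where
  "sip N \<phi> \<psi> = (\<Sum>k\<in>shell N. cnj (\<phi> k) * \<psi> k)"

definition ip :: "nat \<Rightarrow> ('n :: finite) state \<Rightarrow> 'n state \<Rightarrow> complex" where
  "ip N \<phi> \<psi> = (\<Sum>m<N. sip m \<phi> \<psi>)"

lemma cnj_ip: "cnj (ip N \<phi> \<psi>) = ip N \<psi> \<phi>"
  by (simp add: ip_def sip_def mult.commute)

lemma ip_add_right: "ip N \<phi> (\<lambda>k. \<xi> k + \<psi> k) = ip N \<phi> \<xi> + ip N \<phi> \<psi>"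
  by (simp add: ip_def sip_def distrib_left sum.distrib)

lemma ip_scale_right: "ip N \<phi> (\<lambda>k. c * \<psi> k) = c * ip N \<phi> \<psi>"
  by (simp add: ip_def sip_def sum_distrib_left mult_ac)

lemma ip_sum_right: "ip N \<phi> (\<lambda>k. \<Sum>i\<in>S. \<psi> i k) = (\<Sum>i\<in>S. ip N \<phi> (\<psi> i))"
  by (simp add: ip_def sip_def sum_distrib_left sum.swap[of _ S])

lemma sip_cr: "sip (Suc N) \<phi> (app (cr i) \<psi>) = sip N (app (an i) \<phi>) \<psi>"
proof -
  have "sip (Suc N) \<phi> (app (cr i) \<psi>) = (\<Sum>k\<in>{k \<in> shell (Suc N). k i > 0}. cnj (\<phi> k) * app (cr i) \<psi> k)"
    unfolding sip_def by (rule sum.mono_neutral_right) (auto simp: app_cr creat_def)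
  also have "\<dots> = (\<Sum>k\<in>shell N. (\<lambda>k. cnj (\<phi> k) * app (cr i) \<psi> k) (k(i := Suc (k i))))"
    by (rule sum_shell_upd[symmetric])
  finally show ?thesis
    by (simp add: sip_def app_cr app_an creat_def annih_def fun_upd_triv mult_ac)
qed

lemma sip_cr_0: "sip 0 \<phi> (app (cr i) \<psi>) = 0"
  by (auto simp: sip_def app_cr creat_def shell_def deg_eq_0)

lemma ip_cr: "ip (Suc N) \<phi> (app (cr i) \<psi>) = ip N (app (an i) \<phi>) \<psi>"
  unfolding ip_def by (subst sum.lessThan_Suc_shift) (simp add: sip_cr_0 sip_cr)

lemma cmod_sip: "cmod (sip N \<phi> \<psi>) \<le> sh N \<phi> * sh N \<psi>"
proof -
  have "cmod (sip N \<phi> \<psi>) \<le> (\<Sum>k\<in>shell N. \<bar>cmod (\<phi> k)\<bar> * \<bar>cmod (\<psi> k)\<bar>)"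
    unfolding sip_def by (rule order_trans[OF norm_sum]) (simp add: norm_mult)
  also have "\<dots> \<le> sh N \<phi> * sh N \<psi>" unfolding sh_def by (rule L2_set_mult_ineq)
  finally show ?thesis .
qed

section \<open>Uniqueness for the Schroedinger equation\<close>

text \<open>\<open>i\<close> times the Hamiltonian.\<close>

definition gen :: "complex^'n^'n \<Rightarrow> complex^'n^'n \<Rightarrow> complex^'n \<Rightarrow> ('n :: finite) fop" where
  "gen A B h = (\<Sum>i\<in>UNIV. \<Sum>j\<in>UNIV. sc (- A $ i $ j / 2) * (cr i * cr j))
    + (\<Sum>i\<in>UNIV. \<Sum>j\<in>UNIV. sc (cnj (A $ i $ j) / 2) * (an i * an j))
    + (\<Sum>i\<in>UNIV. \<Sum>j\<in>UNIV. sc (\<i> * B $ i $ j) * (cr i * an j))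
    + (\<Sum>i\<in>UNIV. sc (- h $ i) * cr i)
    + (\<Sum>i\<in>UNIV. sc (cnj (h $ i)) * an i)"

lemma app_gen: "app (gen A B h) \<psi> k =
      (\<Sum>i\<in>UNIV. \<Sum>j\<in>UNIV. (- A $ i $ j / 2) * app (cr i) (app (cr j) \<psi>) k)
    + (\<Sum>i\<in>UNIV. \<Sum>j\<in>UNIV. (cnj (A $ i $ j) / 2) * app (an i) (app (an j) \<psi>) k)
    + (\<Sum>i\<in>UNIV. \<Sum>j\<in>UNIV. (\<i> * B $ i $ j) * app (cr i) (app (an j) \<psi>) k)
    + (\<Sum>i\<in>UNIV. (- h $ i) * app (cr i) \<psi> k)
    + (\<Sum>i\<in>UNIV. cnj (h $ i) * app (an i) \<psi> k)"
  by (simp only: gen_def app_basic app_sum app_sc)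

lemma app_gen_hamiltonian: "app (gen A B h) \<psi> k = \<i> * hamiltonian A B h \<psi> k"
proof -
  have i: "\<i> * (\<i> / 2 * z) = - z / 2" "\<i> * (\<i> * z) = - z" for z :: complex
    by (simp_all flip: mult.assoc)
  show ?thesis
    unfolding hamiltonian_def app_gen bilin_op_def lin_op_def app_an app_cr distrib_left right_diff_distrib i
    by (simp add: sum_distrib_left sum_negf sum_divide_distrib diff_divide_distrib mult.assoc)
qed

lemma gen_uminus: "gen (- A) (- B) (- h) = - gen A B h"
  by (rule fop_eqI) (simp add: app_gen app_basic sum_negf)

lemma cnj_mult_cmod: "\<bar>Re (z * x)\<bar> \<le> cmod z * cmod x"
  by (metis abs_Re_le_cmod norm_mult)

lemma two_mult_le: "a * b \<le> (a\<^sup>2 + b\<^sup>2) / 2" for a b :: real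
  using sum_squares_bound[of a b] by simp

lemma Re_ip_gen:
  assumes A: "transpose A = A" and B: "cnj_mat (transpose B) = B"
  shows "Re (ip (Suc (Suc N)) w (app (gen A B h) w)) =
    (\<Sum>i\<in>UNIV. \<Sum>j\<in>UNIV. Re (cnj (A $ i $ j) / 2 *
        (sip N w (app (an i) (app (an j) w)) + sip (Suc N) w (app (an i) (app (an j) w)))))
    + (\<Sum>i\<in>UNIV. Re (cnj (h $ i) * sip (Suc N) w (app (an i) w)))"
proof -
  define I where "I = ip (Suc (Suc N)) w"
  have As: "A $ i $ j = A $ j $ i" for i j using A by (auto simp: vec_eq_iff transpose_def)
  have Bs: "cnj (B $ i $ j) = B $ j $ i" for i j using B by (auto simp: vec_eq_iff transpose_def)
  have I: "I (app (gen A B h) w) =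
      (\<Sum>i\<in>UNIV. \<Sum>j\<in>UNIV. (- A $ i $ j / 2) * I (app (cr i) (app (cr j) w)))
    + (\<Sum>i\<in>UNIV. \<Sum>j\<in>UNIV. (cnj (A $ i $ j) / 2) * I (app (an i) (app (an j) w)))
    + (\<Sum>i\<in>UNIV. \<Sum>j\<in>UNIV. (\<i> * B $ i $ j) * I (app (cr i) (app (an j) w)))
    + (\<Sum>i\<in>UNIV. (- h $ i) * I (app (cr i) w))
    + (\<Sum>i\<in>UNIV. cnj (h $ i) * I (app (an i) w))"
    unfolding I_def app_gen ip_add_right ip_sum_right ip_scale_right ..
  have e1: "Re (\<Sum>i\<in>UNIV. \<Sum>j\<in>UNIV. (- A $ i $ j / 2) * I (app (cr i) (app (cr j) w)))
      = (\<Sum>i\<in>UNIV. \<Sum>j\<in>UNIV. - Re (cnj (A $ i $ j) / 2 * ip N w (app (an i) (app (an j) w))))"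
  proof -
    have "Re ((- A $ i $ j / 2) * I (app (cr i) (app (cr j) w)))
        = - Re (cnj (A $ j $ i) / 2 * ip N w (app (an j) (app (an i) w)))" for i j
    proof -
      have "I (app (cr i) (app (cr j) w)) = cnj (ip N w (app (an j) (app (an i) w)))"
        by (simp only: I_def ip_cr cnj_ip)
      then have "(- A $ i $ j / 2) * I (app (cr i) (app (cr j) w))
         = - cnj (cnj (A $ j $ i) / 2 * ip N w (app (an j) (app (an i) w)))"
        by (simp add: As[of i j])
      then show ?thesis by (simp only: uminus_complex.simps cnj.simps)
    qed
    then show ?thesis unfolding Re_sum by (simp only:) (rule sum.swap)
  qed
  have e2: "Re (\<Sum>i\<in>UNIV. \<Sum>j\<in>UNIV. (cnj (A $ i $ j) / 2) * I (app (an i) (app (an j) w)))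
      = (\<Sum>i\<in>UNIV. \<Sum>j\<in>UNIV. Re (cnj (A $ i $ j) / 2 * ip N w (app (an i) (app (an j) w)))
      + Re (cnj (A $ i $ j) / 2 *
        (sip N w (app (an i) (app (an j) w)) + sip (Suc N) w (app (an i) (app (an j) w)))))"
    unfolding Re_sum I_def ip_def sum.lessThan_Suc
    by (simp only: distrib_left plus_complex.sel add.assoc)
  have e3: "Re (\<Sum>i\<in>UNIV. \<Sum>j\<in>UNIV. (\<i> * B $ i $ j) * I (app (cr i) (app (an j) w))) = 0"
  proof -
    define Q where "Q = (\<Sum>i\<in>UNIV. \<Sum>j\<in>UNIV. B $ i $ j * ip (Suc N) (app (an i) w) (app (an j) w))"
    have "cnj Q = (\<Sum>i\<in>UNIV. \<Sum>j\<in>UNIV. B $ j $ i * ip (Suc N) (app (an j) w) (app (an i) w))"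
      by (simp add: Q_def Bs cnj_ip)
    also have "\<dots> = Q" unfolding Q_def by (rule sum.swap)
    finally have "Im (cnj Q) = Im Q" by (rule arg_cong)
    then have "Im Q = 0" by simp
    moreover have "(\<Sum>i\<in>UNIV. \<Sum>j\<in>UNIV. (\<i> * B $ i $ j) * I (app (cr i) (app (an j) w))) = \<i> * Q"
      by (simp add: I_def Q_def ip_cr sum_distrib_left mult.assoc)
    ultimately show ?thesis by simp
  qed
  have e4: "Re (\<Sum>i\<in>UNIV. (- h $ i) * I (app (cr i) w))
      = (\<Sum>i\<in>UNIV. - Re (cnj (h $ i) * ip (Suc N) w (app (an i) w)))"
  proof -
    have "(- h $ i) * I (app (cr i) w) = - cnj (cnj (h $ i) * ip (Suc N) w (app (an i) w))" for i
      by (simp add: I_def ip_cr cnj_ip)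
    then show ?thesis unfolding Re_sum by (simp only: uminus_complex.simps cnj.simps)
  qed
  have e5: "Re (\<Sum>i\<in>UNIV. cnj (h $ i) * I (app (an i) w))
      = (\<Sum>i\<in>UNIV. Re (cnj (h $ i) * ip (Suc N) w (app (an i) w)) + Re (cnj (h $ i) * sip (Suc N) w (app (an i) w)))"
    unfolding Re_sum I_def ip_def sum.lessThan_Suc[of _ "Suc N"]
    by (simp only: distrib_left plus_complex.sel)
  show ?thesis
    by (simp only: I_def[symmetric] I plus_complex.simps e1 e2 e3 e4 e5 sum.distrib sum_negf)
qed

lemma flux_bound:
  fixes A B :: "complex^'n^'n" and h :: "complex^'n"
  assumes A: "transpose A = A" and B: "cnj_mat (transpose B) = B"
  obtains c where "0 \<le> c" "\<And>N w. 2 * Re (ip (Suc (Suc N)) w (app (gen A B h) w)) \<le>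
    c * real (N + 3) * ((sh N w)\<^sup>2 + (sh (N + 1) w)\<^sup>2 + (sh (N + 2) w)\<^sup>2 + (sh (N + 3) w)\<^sup>2)"
proof
  define a where "a = (\<Sum>i\<in>UNIV. \<Sum>j\<in>UNIV. cmod (A $ i $ j))"
  define b where "b = (\<Sum>i\<in>UNIV. cmod (h $ i))"
  show "0 \<le> a + 2 * b" by (simp add: a_def b_def sum_nonneg)
  fix N and w :: "'n state"
  define S where "S = (sh N w)\<^sup>2 + (sh (N + 1) w)\<^sup>2 + (sh (N + 2) w)\<^sup>2 + (sh (N + 3) w)\<^sup>2"
  have S0: "0 \<le> S" by (simp add: S_def)
  have an1: "sh M (app (an i) u) \<le> real (N + 3) * sh (Suc M) u" if "M \<le> N + 2" for M i and u :: "'n state"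
  proof -
    have "sqrt (real (Suc M)) \<le> real (N + 3)"
    proof -
      have "sqrt (real (Suc M)) * 1 \<le> sqrt (real (Suc M)) * sqrt (real (Suc M))"
        by (intro mult_left_mono) auto
      then show ?thesis using that by simp
    qed
    then show ?thesis using sh_an[of M i u] mult_right_mono[of "sqrt (real (Suc M))" "real (N + 3)" "sh (Suc M) u"] by simp
  qed
  have an2: "sh M (app (an i) (app (an j) w)) \<le> real (N + 3) * sh (M + 2) w" if "M \<le> N + 1" for M i j
  proof -
    have "sh M (app (an i) (app (an j) w)) \<le> sqrt (real (Suc M)) * (sqrt (real (Suc (Suc M))) * sh (Suc (Suc M)) w)"
      by (rule order_trans[OF sh_an mult_left_mono[OF sh_an]]) simp
    also have "\<dots> \<le> (sqrt (real (N + 3)) * sqrt (real (N + 3))) * sh (Suc (Suc M)) w"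
      unfolding mult.assoc using that by (intro mult_mono) auto
    finally show ?thesis by simp
  qed
  have p: "sh M w * sh M' w \<le> ((sh M w)\<^sup>2 + (sh M' w)\<^sup>2) / 2" for M M' by (rule two_mult_le)
  have s2: "cmod (sip M w (app (an i) (app (an j) w))) \<le> real (N + 3) * (((sh M w)\<^sup>2 + (sh (M + 2) w)\<^sup>2) / 2)"
    if "M \<le> N + 1" for M i j
  proof -
    have "cmod (sip M w (app (an i) (app (an j) w))) \<le> sh M w * (real (N + 3) * sh (M + 2) w)"
      by (rule order_trans[OF cmod_sip mult_left_mono[OF an2[OF that]]]) simp
    also have "\<dots> = real (N + 3) * (sh M w * sh (M + 2) w)" by simp
    also have "\<dots> \<le> real (N + 3) * (((sh M w)\<^sup>2 + (sh (M + 2) w)\<^sup>2) / 2)"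
      by (rule mult_left_mono[OF p]) simp
    finally show ?thesis .
  qed
  have s1: "cmod (sip (Suc N) w (app (an i) w)) \<le> real (N + 3) * (((sh (N + 1) w)\<^sup>2 + (sh (N + 2) w)\<^sup>2) / 2)" for i
  proof -
    have "cmod (sip (Suc N) w (app (an i) w)) \<le> sh (Suc N) w * (real (N + 3) * sh (Suc (Suc N)) w)"
      by (rule order_trans[OF cmod_sip mult_left_mono[OF an1]]) simp_all
    also have "\<dots> = real (N + 3) * (sh (N + 1) w * sh (N + 2) w)" by (simp add: numeral_2_eq_2)
    also have "\<dots> \<le> real (N + 3) * (((sh (N + 1) w)\<^sup>2 + (sh (N + 2) w)\<^sup>2) / 2)"
      by (rule mult_left_mono[OF p]) simp
    finally show ?thesis .
  qed
  have "(\<Sum>i\<in>UNIV. \<Sum>j\<in>UNIV. Re (cnj (A $ i $ j) / 2 *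
        (sip N w (app (an i) (app (an j) w)) + sip (Suc N) w (app (an i) (app (an j) w)))))
      \<le> (\<Sum>i\<in>UNIV. \<Sum>j\<in>UNIV. cmod (A $ i $ j) / 2 * (real (N + 3) * S))"
  proof (intro sum_mono)
    fix i j
    have "cmod (sip N w (app (an i) (app (an j) w)) + sip (Suc N) w (app (an i) (app (an j) w)))
        \<le> real (N + 3) * (((sh N w)\<^sup>2 + (sh (N + 2) w)\<^sup>2) / 2) + real (N + 3) * (((sh (N + 1) w)\<^sup>2 + (sh (N + 3) w)\<^sup>2) / 2)"
      using s2[of N i j] s2[of "N + 1" i j]
      by (intro order_trans[OF norm_triangle_ineq] add_mono) (simp_all add: numeral_3_eq_3)
    also have "\<dots> = real (N + 3) * (S / 2)" by (simp add: S_def field_simps)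
    also have "\<dots> \<le> real (N + 3) * S" using S0 by (intro mult_left_mono) auto
    finally have *: "cmod (sip N w (app (an i) (app (an j) w)) + sip (Suc N) w (app (an i) (app (an j) w))) \<le> real (N + 3) * S" .
    have "Re (cnj (A $ i $ j) / 2 * (sip N w (app (an i) (app (an j) w)) + sip (Suc N) w (app (an i) (app (an j) w))))
        \<le> cmod (cnj (A $ i $ j) / 2) * cmod (sip N w (app (an i) (app (an j) w)) + sip (Suc N) w (app (an i) (app (an j) w)))"
      by (metis abs_le_D1 cnj_mult_cmod)
    also have "\<dots> \<le> cmod (cnj (A $ i $ j) / 2) * (real (N + 3) * S)" by (rule mult_left_mono[OF *]) simp
    finally show "Re (cnj (A $ i $ j) / 2 * (sip N w (app (an i) (app (an j) w)) + sip (Suc N) w (app (an i) (app (an j) w))))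
       \<le> cmod (A $ i $ j) / 2 * (real (N + 3) * S)" by (simp add: norm_divide)
  qed
  also have "\<dots> = a / 2 * (real (N + 3) * S)"
    by (simp add: a_def sum_distrib_right sum_divide_distrib)
  finally have 1: "(\<Sum>i\<in>UNIV. \<Sum>j\<in>UNIV. Re (cnj (A $ i $ j) / 2 *
        (sip N w (app (an i) (app (an j) w)) + sip (Suc N) w (app (an i) (app (an j) w))))) \<le> a / 2 * (real (N + 3) * S)" .
  have "(\<Sum>i\<in>UNIV. Re (cnj (h $ i) * sip (Suc N) w (app (an i) w))) \<le> (\<Sum>i\<in>UNIV. cmod (h $ i) * (real (N + 3) * S))"
  proof (intro sum_mono)
    fix i
    have "real (N + 3) * (((sh (N + 1) w)\<^sup>2 + (sh (N + 2) w)\<^sup>2) / 2) \<le> real (N + 3) * S"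
    proof (rule mult_left_mono)
      have "(b + c) / 2 \<le> a + b + c + d" if "0 \<le> a" "0 \<le> b" "0 \<le> c" "0 \<le> d" for a b c d :: real
        using that by (simp add: field_simps)
      then show "((sh (N + 1) w)\<^sup>2 + (sh (N + 2) w)\<^sup>2) / 2 \<le> S" unfolding S_def by simp
    qed simp
    then have *: "cmod (sip (Suc N) w (app (an i) w)) \<le> real (N + 3) * S" using s1[of i] by linarith
    have "Re (cnj (h $ i) * sip (Suc N) w (app (an i) w)) \<le> cmod (cnj (h $ i)) * cmod (sip (Suc N) w (app (an i) w))"
      by (metis abs_le_D1 cnj_mult_cmod)
    also have "\<dots> \<le> cmod (cnj (h $ i)) * (real (N + 3) * S)" by (rule mult_left_mono[OF *]) simp
    finally show "Re (cnj (h $ i) * sip (Suc N) w (app (an i) w)) \<le> cmod (h $ i) * (real (N + 3) * S)" by simp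
  qed
  also have "\<dots> = b * (real (N + 3) * S)" by (simp add: b_def sum_distrib_right)
  finally have 2: "(\<Sum>i\<in>UNIV. Re (cnj (h $ i) * sip (Suc N) w (app (an i) w))) \<le> b * (real (N + 3) * S)" .
  have "2 * Re (ip (Suc (Suc N)) w (app (gen A B h) w)) \<le> 2 * (a / 2 * (real (N + 3) * S) + b * (real (N + 3) * S))"
    unfolding Re_ip_gen[OF A B] using add_mono[OF 1 2] by simp
  also have "\<dots> = (a + 2 * b) * real (N + 3) * S" by (simp add: algebra_simps)
  finally show "2 * Re (ip (Suc (Suc N)) w (app (gen A B h) w)) \<le> (a + 2 * b) * real (N + 3) *
    ((sh N w)\<^sup>2 + (sh (N + 1) w)\<^sup>2 + (sh (N + 2) w)\<^sup>2 + (sh (N + 3) w)\<^sup>2)" unfolding S_def .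
qed

lemma truncated_norm_derivative:
  assumes "pder w w' t"
  shows "((\<lambda>t. \<Sum>m<N. (sh m (w t))\<^sup>2) has_real_derivative 2 * Re (ip N (w t) w')) (at t)"
proof -
  have d: "((\<lambda>t. (cmod (w t k))\<^sup>2) has_real_derivative 2 * Re (cnj (w t k) * w' k)) (at t)" for k
  proof -
    have "((\<lambda>t. w t k) has_vector_derivative w' k) (at t)" using assms by (simp add: pder_def)
    then have 1: "((\<lambda>t. Re (w t k)) has_real_derivative Re (w' k)) (at t)" and 2: "((\<lambda>t. Im (w t k)) has_real_derivative Im (w' k)) (at t)"
      by (auto simp: has_vector_derivative_complex_iff)
    show ?thesis unfolding cmod_power2
      using DERIV_add[OF DERIV_power[OF 1, of 2] DERIV_power[OF 2, of 2]] by (simp add: algebra_simps)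
  qed
  have "((\<lambda>t. \<Sum>m<N. \<Sum>k\<in>shell m. (cmod (w t k))\<^sup>2) has_real_derivative
      (\<Sum>m<N. \<Sum>k\<in>shell m. 2 * Re (cnj (w t k) * w' k))) (at t)"
    by (intro DERIV_sum d)
  then show ?thesis by (simp add: sh_power2 ip_def sip_def sum_distrib_left)
qed

lemma schroedinger_unique_nonneg:
  fixes A B :: "complex^'n^'n" and h :: "complex^'n" and w :: "real \<Rightarrow> 'n state"
  assumes A: "transpose A = A" and B: "cnj_mat (transpose B) = B"
    and ode: "\<And>t. pder w (app (gen A B h) (w t)) t"
    and bdd: "\<And>t N. 0 \<le> t \<Longrightarrow> t \<le> T \<Longrightarrow> (\<Sum>m<N. (sh m (w t))\<^sup>2) \<le> M"
    and w0: "w 0 = (\<lambda>k. 0)" and T: "0 \<le> T"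
  shows "w T = (\<lambda>k. 0)"
proof -
  obtain c where c: "0 \<le> c" and flux: "\<And>N (w :: 'n state). 2 * Re (ip (Suc (Suc N)) w (app (gen A B h) w)) \<le>
    c * real (N + 3) * ((sh N w)\<^sup>2 + (sh (N + 1) w)\<^sup>2 + (sh (N + 2) w)\<^sup>2 + (sh (N + 3) w)\<^sup>2)"
    using flux_bound[OF A B, of h] by blast
  define F where "F N t = (\<Sum>m<N. (sh m (w t))\<^sup>2)" for N t
  have F_mono: "F N t \<le> F N' t" if "N \<le> N'" for N N' t
    unfolding F_def using that by (intro sum_mono2) auto
  have F0: "0 \<le> F N t" for N t by (simp add: F_def sum_nonneg)
  have dF: "(F N has_real_derivative 2 * Re (ip N (w t) (app (gen A B h) (w t)))) (at t)" for N t
    unfolding F_def[abs_def] by (rule truncated_norm_derivative[OF ode])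
  have Q: "(\<Sum>N<L. F (N + 2) T / real (N + 3)) \<le> 4 * c * M * T" for L
  proof -
    define q where "q t = (\<Sum>N<L. F (N + 2) t / real (N + 3)) - 4 * c * M * t" for t
    define q' where "q' t = (\<Sum>N<L. 2 * Re (ip (N + 2) (w t) (app (gen A B h) (w t))) / real (N + 3)) - 4 * c * M" for t
    have dq: "(q has_real_derivative q' t) (at t)" for t
      unfolding q_def[abs_def] q'_def
      using DERIV_diff[OF DERIV_sum[of "{..<L}", OF DERIV_cdivide[OF dF]] DERIV_cmult_Id[of "4 * c * M"]]
      by simp
    have "q' t \<le> 0" if t: "0 \<le> t" "t \<le> T" for t
    proof -
      have shift: "(\<Sum>N<L. (sh (N + j) (w t))\<^sup>2) \<le> M" for j
      proof -
        have "(\<Sum>N<L. (sh (N + j) (w t))\<^sup>2) = (\<Sum>m\<in>(\<lambda>N. N + j) ` {..<L}. (sh m (w t))\<^sup>2)"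
          by (subst sum.reindex) (auto simp: inj_on_def)
        also have "\<dots> \<le> (\<Sum>m<L + j. (sh m (w t))\<^sup>2)" by (intro sum_mono2) auto
        finally show ?thesis using bdd[OF t, of "L + j"] by linarith
      qed
      have "(\<Sum>N<L. 2 * Re (ip (N + 2) (w t) (app (gen A B h) (w t))) / real (N + 3))
         \<le> (\<Sum>N<L. c * ((sh N (w t))\<^sup>2 + (sh (N + 1) (w t))\<^sup>2 + (sh (N + 2) (w t))\<^sup>2 + (sh (N + 3) (w t))\<^sup>2))"
      proof (intro sum_mono)
        fix N
        have "2 * Re (ip (N + 2) (w t) (app (gen A B h) (w t))) / real (N + 3) \<le>
          (c * real (N + 3) * ((sh N (w t))\<^sup>2 + (sh (N + 1) (w t))\<^sup>2 + (sh (N + 2) (w t))\<^sup>2 + (sh (N + 3) (w t))\<^sup>2)) / real (N + 3)"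
          using flux[of N "w t"] by (intro divide_right_mono) simp_all
        then show "2 * Re (ip (N + 2) (w t) (app (gen A B h) (w t))) / real (N + 3) \<le>
          c * ((sh N (w t))\<^sup>2 + (sh (N + 1) (w t))\<^sup>2 + (sh (N + 2) (w t))\<^sup>2 + (sh (N + 3) (w t))\<^sup>2)"
          by simp
      qed
      also have "\<dots> = c * ((\<Sum>N<L. (sh N (w t))\<^sup>2) + (\<Sum>N<L. (sh (N + 1) (w t))\<^sup>2)
          + (\<Sum>N<L. (sh (N + 2) (w t))\<^sup>2) + (\<Sum>N<L. (sh (N + 3) (w t))\<^sup>2))"
        by (simp only: sum_distrib_left[symmetric] sum.distrib)
      also have "\<dots> \<le> c * (M + M + M + M)"
        using c shift[of 0] shift[of 1] shift[of 2] shift[of 3] by (intro mult_left_mono add_mono) simp_all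
      finally show ?thesis by (simp add: q'_def)
    qed
    then have "q T \<le> q 0"
      using T dq by (intro DERIV_nonpos_imp_nonincreasing[of 0 T q]) blast+
    moreover have "q 0 = 0" by (simp add: q_def F_def w0 sh_zero)
    ultimately show ?thesis by (simp add: q_def)
  qed
  have "F j T = 0" for j
  proof (rule ccontr)
    assume "F j T \<noteq> 0"
    then have pos: "0 < F j T" using F0[of j T] by linarith
    have "summable (\<lambda>N. F (N + 2) T / real (N + 3))"
      by (rule summableI_nonneg_bounded[of _ "4 * c * M * T"]) (use Q F0 in auto)
    then have "summable (\<lambda>N. F (N + j + 2) T / real (N + j + 3))"
      by (subst (asm) summable_iff_shift[symmetric, of _ j]) (simp add: ac_simps)
    then have "summable (\<lambda>N. F j T * (1 / real (N + j + 3)))"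
    proof (rule summable_comparison_test'[of _ 0])
      fix N
      show "norm (F j T * (1 / real (N + j + 3))) \<le> F (N + j + 2) T / real (N + j + 3)"
        using F_mono[of j "N + j + 2" T] F0[of j T] by (simp add: divide_right_mono)
    qed
    then have "summable (\<lambda>N. 1 / real (N + j + 3))"
      using pos by (simp only: summable_cmult_iff) simp
    then have "summable (\<lambda>N. 1 / real (N + (j + 3)))" by (simp only: add.assoc)
    then have "summable (\<lambda>N. 1 / real N)"
      by (subst (asm) summable_iff_shift[of "\<lambda>N. 1 / real N"])
    then show False using not_summable_harmonic[where 'a = real] by (simp add: inverse_eq_divide)
  qed
  note z = this
  show ?thesis
  proof
    fix k :: "'n \<Rightarrow> nat"
    have "F (Suc (deg k)) T = (\<Sum>l | deg l < Suc (deg k). (cmod (w T l))\<^sup>2)"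
      by (simp only: F_def sh_power2 sum_deg_less)
    then have "(\<Sum>l | deg l < Suc (deg k). (cmod (w T l))\<^sup>2) = 0" using z by simp
    then have "(cmod (w T k))\<^sup>2 = 0"
      by (subst (asm) sum_nonneg_eq_0_iff) (auto simp: finite_deg_less)
    then show "w T k = 0" by simp
  qed
qed

lemma pder_reflect:
  fixes w :: "real \<Rightarrow> ('n :: finite) state"
  assumes "pder w w' (- t)" shows "pder (\<lambda>t. w (- t)) (\<lambda>k. - w' k) t"
  unfolding pder_def
proof
  fix k
  have "((\<lambda>t. w t k) \<circ> uminus has_vector_derivative (-1) *\<^sub>R w' k) (at t)"
    by (rule vector_diff_chain_at) (use assms in \<open>auto simp: pder_def intro!: derivative_eq_intros\<close>)
  then show "((\<lambda>t. w (- t) k) has_vector_derivative - w' k) (at t)" by (simp add: o_def)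
qed

lemma schroedinger_unique:
  fixes A B :: "complex^'n^'n" and h :: "complex^'n" and w :: "real \<Rightarrow> 'n state"
  assumes A: "transpose A = A" and B: "cnj_mat (transpose B) = B"
    and ode: "\<And>t. pder w (app (gen A B h) (w t)) t"
    and bdd: "\<And>T. \<exists>M. \<forall>t. \<bar>t\<bar> \<le> T \<longrightarrow> (\<forall>N. (\<Sum>m<N. (sh m (w t))\<^sup>2) \<le> M)"
    and w0: "w 0 = (\<lambda>k. 0)"
  shows "w t = (\<lambda>k. 0)"
proof (cases "0 \<le> t")
  case True
  obtain M where "\<forall>s. \<bar>s\<bar> \<le> t \<longrightarrow> (\<forall>N. (\<Sum>m<N. (sh m (w s))\<^sup>2) \<le> M)" using bdd by blast
  then show ?thesis
    using True by (intro schroedinger_unique_nonneg[OF A B ode _ w0, of t M]) auto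
next
  case False
  obtain M where M: "\<forall>s. \<bar>s\<bar> \<le> - t \<longrightarrow> (\<forall>N. (\<Sum>m<N. (sh m (w s))\<^sup>2) \<le> M)" using bdd by blast
  have neg: "app (gen (- A) (- B) (- h)) \<psi> = (\<lambda>k. - app (gen A B h) \<psi> k)" for \<psi>
    by (simp only: gen_uminus fun_eq_iff app_basic) simp
  have "(\<lambda>t. w (- t)) (- t) = (\<lambda>k. 0)"
  proof (rule schroedinger_unique_nonneg[of "- A" "- B" "\<lambda>t. w (- t)" "- h" "- t" M])
    show "transpose (- A) = - A" "cnj_mat (transpose (- B)) = - B"
      by (simp_all only: transpose_simps A B cnj_mat_simps)
    show "pder (\<lambda>t. w (- t)) (app (gen (- A) (- B) (- h)) (w (- s))) s" for s
      unfolding neg by (rule pder_reflect[OF ode])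
    show "(\<Sum>m<N. (sh m (w (- s)))\<^sup>2) \<le> M" if "0 \<le> s" "s \<le> - t" for s N
      using M[rule_format, of "- s" N] that by simp
    show "w (- 0) = (\<lambda>k. 0)" using w0 by simp
    show "0 \<le> - t" using False by simp
  qed
  then show ?thesis by simp
qed

section \<open>Unitary groups solve the Schroedinger equation pointwise\<close>

definition ipf :: "('n :: finite) state \<Rightarrow> 'n state \<Rightarrow> complex" where
  "ipf \<phi> \<psi> = (\<Sum>\<^sub>\<infinity>k. cnj (\<phi> k) * \<psi> k)"

lemma fock_has_sum:
  assumes "\<phi> \<in> fock" shows "((\<lambda>k. (cmod (\<phi> k))\<^sup>2) has_sum (fock_norm \<phi>)\<^sup>2) UNIV"
  using assms unfolding fock_norm_power2 fock_def by (intro has_sum_infsum) simp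

lemma ipf_has_sum:
  assumes "\<phi> \<in> fock" "\<psi> \<in> fock"
  shows "((\<lambda>k. cnj (\<phi> k) * \<psi> k) has_sum ipf \<phi> \<psi>) UNIV"
proof -
  have s: "(\<lambda>k. (cmod (\<phi> k))\<^sup>2 + (cmod (\<psi> k))\<^sup>2) summable_on UNIV"
    using assms by (intro summable_on_add) (auto simp: fock_def)
  have "cmod (\<phi> k) * cmod (\<psi> k) \<le> (cmod (\<phi> k))\<^sup>2 + (cmod (\<psi> k))\<^sup>2" for k
  proof -
    have "(a + b) / 2 \<le> a + b" if "0 \<le> a" "0 \<le> b" for a b :: real using that by simp
    from order_trans[OF two_mult_le this] show ?thesis by simp
  qed
  then have "(\<lambda>k. norm (cnj (\<phi> k) * \<psi> k)) summable_on UNIV"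
    by (intro summable_on_comparison_test[OF s]) (auto simp: norm_mult)
  then show ?thesis unfolding ipf_def by (rule has_sum_infsum[OF abs_summable_summable])
qed

lemma cmod_linear_power2:
  "(cmod (c * x + y))\<^sup>2 = (cmod c)\<^sup>2 * (cmod x)\<^sup>2 + (cmod y)\<^sup>2 + 2 * Re (cnj c * (cnj x * y))"
proof -
  have "(cmod (c * x + y))\<^sup>2 = (cmod (c * x))\<^sup>2 + (cmod y)\<^sup>2 + 2 * Re (cnj (c * x) * y)"
    unfolding cmod_power2 by (simp add: power2_eq_square algebra_simps)
  then show ?thesis by (simp add: norm_mult power_mult_distrib mult.assoc)
qed

lemma fock_linear:
  assumes "\<phi> \<in> fock" "\<psi> \<in> fock"
  shows "(\<lambda>k. c * \<phi> k + \<psi> k) \<in> fock"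
    and "(fock_norm (\<lambda>k. c * \<phi> k + \<psi> k))\<^sup>2 =
      (cmod c)\<^sup>2 * (fock_norm \<phi>)\<^sup>2 + (fock_norm \<psi>)\<^sup>2 + 2 * Re (cnj c * ipf \<phi> \<psi>)"
proof -
  have "((\<lambda>k. Re (cnj c * (cnj (\<phi> k) * \<psi> k))) has_sum Re (cnj c * ipf \<phi> \<psi>)) UNIV"
    by (intro has_sum_bounded_linear[OF bounded_linear_Re, unfolded o_def] has_sum_cmult_right ipf_has_sum assms)
  then have *: "((\<lambda>k. (cmod (c * \<phi> k + \<psi> k))\<^sup>2) has_sum
     (cmod c)\<^sup>2 * (fock_norm \<phi>)\<^sup>2 + (fock_norm \<psi>)\<^sup>2 + 2 * Re (cnj c * ipf \<phi> \<psi>)) UNIV"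
    unfolding cmod_linear_power2 by (intro has_sum_add has_sum_cmult_right fock_has_sum assms)
  then show "(\<lambda>k. c * \<phi> k + \<psi> k) \<in> fock"
    unfolding fock_def mem_Collect_eq by (rule has_sum_imp_summable)
  show "(fock_norm (\<lambda>k. c * \<phi> k + \<psi> k))\<^sup>2 =
      (cmod c)\<^sup>2 * (fock_norm \<phi>)\<^sup>2 + (fock_norm \<psi>)\<^sup>2 + 2 * Re (cnj c * ipf \<phi> \<psi>)"
    unfolding fock_norm_power2[of "\<lambda>k. c * \<phi> k + \<psi> k"] by (rule infsumI[OF *])
qed

lemma fock_zero: "(\<lambda>k. 0) \<in> fock" "fock_norm (\<lambda>k. 0) = 0"
  by (simp_all add: fock_def fock_norm_def)

lemma fock_scale:
  assumes "\<phi> \<in> fock" shows "(\<lambda>k. c * \<phi> k) \<in> fock"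
  using fock_linear(1)[OF assms fock_zero(1), of c] by simp

lemma fock_diff:
  assumes "\<phi> \<in> fock" "\<psi> \<in> fock" shows "(\<lambda>k. \<phi> k - \<psi> k) \<in> fock"
  using fock_linear(1)[OF assms(2,1), of "-1"] by simp

lemma cmod_ipf:
  assumes "\<phi> \<in> fock" "\<psi> \<in> fock" shows "cmod (ipf \<phi> \<psi>) \<le> fock_norm \<phi> * fock_norm \<psi>"
proof -
  define z a b where "z = ipf \<phi> \<psi>" and "a = fock_norm \<phi>" and "b = fock_norm \<psi>"
  have ab: "0 \<le> a" "0 \<le> b" by (simp_all add: a_def b_def)
  have q: "0 \<le> (cmod z)\<^sup>2 * s\<^sup>2 * a\<^sup>2 + b\<^sup>2 - 2 * s * (cmod z)\<^sup>2" for s :: real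
  proof -
    have e: "cnj (- of_real s * z) * z = of_real (- s * (cmod z)\<^sup>2)"
    proof -
      have "cnj z * z = of_real ((cmod z)\<^sup>2)" by (simp only: complex_norm_square mult.commute)
      then have "- of_real s * (cnj z * z) = of_real (- s * (cmod z)\<^sup>2)" by simp
      then show ?thesis by (simp add: mult.assoc)
    qed
    have "0 \<le> (fock_norm (\<lambda>k. (- of_real s * z) * \<phi> k + \<psi> k))\<^sup>2" by simp
    also have "\<dots> = (cmod (- of_real s * z))\<^sup>2 * a\<^sup>2 + b\<^sup>2 + 2 * Re (cnj (- of_real s * z) * z)"
      unfolding fock_linear(2)[OF assms] z_def a_def b_def ..
    also have "\<dots> = (cmod z)\<^sup>2 * s\<^sup>2 * a\<^sup>2 + b\<^sup>2 - 2 * s * (cmod z)\<^sup>2"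
      unfolding e by (simp add: norm_mult power_mult_distrib)
    finally show ?thesis .
  qed
  have "(cmod z)\<^sup>2 \<le> (a * b)\<^sup>2"
  proof (cases "a = 0")
    case True
    have "z = 0"
    proof (rule ccontr)
      assume "z \<noteq> 0"
      then have "2 * ((b\<^sup>2 + 1) / (2 * (cmod z)\<^sup>2)) * (cmod z)\<^sup>2 = b\<^sup>2 + 1" by simp
      then show False using q[of "(b\<^sup>2 + 1) / (2 * (cmod z)\<^sup>2)"] True by simp
    qed
    then show ?thesis by simp
  next
    case False
    have "(cmod z)\<^sup>2 * (1 / a\<^sup>2)\<^sup>2 * a\<^sup>2 = (cmod z)\<^sup>2 / a\<^sup>2" using False by (simp add: power2_eq_square)
    then have "(cmod z)\<^sup>2 / a\<^sup>2 \<le> b\<^sup>2" using q[of "1 / a\<^sup>2"] by simp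
    then show ?thesis using False by (simp add: field_simps power_mult_distrib)
  qed
  then have "cmod z \<le> a * b" using ab by (intro power2_le_imp_le[of "cmod z" "a * b"]) auto
  then show ?thesis by (simp only: z_def a_def b_def)
qed

lemma ipf_diff_left:
  assumes "\<phi> \<in> fock" "\<phi>' \<in> fock" "\<psi> \<in> fock"
  shows "ipf (\<lambda>k. \<phi> k - \<phi>' k) \<psi> = ipf \<phi> \<psi> - ipf \<phi>' \<psi>"
proof -
  have "((\<lambda>k. cnj (\<phi> k) * \<psi> k + (-1) * (cnj (\<phi>' k) * \<psi> k)) has_sum ipf \<phi> \<psi> + (-1) * ipf \<phi>' \<psi>) UNIV"
    by (intro has_sum_add has_sum_cmult_right ipf_has_sum assms)
  then show ?thesis unfolding ipf_def[of "\<lambda>k. \<phi> k - \<phi>' k"] by (intro infsumI) (simp add: algebra_simps)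
qed

lemma ipf_scale_left:
  assumes "\<phi> \<in> fock" "\<psi> \<in> fock" shows "ipf (\<lambda>k. c * \<phi> k) \<psi> = cnj c * ipf \<phi> \<psi>"
proof -
  have "((\<lambda>k. cnj c * (cnj (\<phi> k) * \<psi> k)) has_sum cnj c * ipf \<phi> \<psi>) UNIV"
    by (intro has_sum_cmult_right ipf_has_sum assms)
  then show ?thesis unfolding ipf_def[of "\<lambda>k. c * \<phi> k"] by (intro infsumI) (simp add: mult_ac)
qed

lemma unitary_op_ipf:
  assumes V: "unitary_op V" and \<phi>: "\<phi> \<in> fock" and \<psi>: "\<psi> \<in> fock"
  shows "ipf (V \<phi>) (V \<psi>) = ipf \<phi> \<psi>"
proof -
  have Vf: "V \<phi> \<in> fock" "V \<psi> \<in> fock" using V \<phi> \<psi> by (auto simp: unitary_op_def)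
  have "Re (cnj c * ipf (V \<phi>) (V \<psi>)) = Re (cnj c * ipf \<phi> \<psi>)" for c
  proof -
    have "V (\<lambda>k. c * \<phi> k + \<psi> k) = (\<lambda>k. c * V \<phi> k + V \<psi> k)" using V \<phi> \<psi> by (simp add: unitary_op_def)
    moreover have "fock_norm (V \<xi>) = fock_norm \<xi>" if "\<xi> \<in> fock" for \<xi> using V that by (simp add: unitary_op_def)
    ultimately have n: "fock_norm (\<lambda>k. c * V \<phi> k + V \<psi> k) = fock_norm (\<lambda>k. c * \<phi> k + \<psi> k)"
      "fock_norm (V \<phi>) = fock_norm \<phi>" "fock_norm (V \<psi>) = fock_norm \<psi>"
      using fock_linear(1)[OF \<phi> \<psi>, of c] \<phi> \<psi> by metis+
    have "(cmod c)\<^sup>2 * (fock_norm \<phi>)\<^sup>2 + (fock_norm \<psi>)\<^sup>2 + 2 * Re (cnj c * ipf (V \<phi>) (V \<psi>))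
        = (cmod c)\<^sup>2 * (fock_norm \<phi>)\<^sup>2 + (fock_norm \<psi>)\<^sup>2 + 2 * Re (cnj c * ipf \<phi> \<psi>)"
      using fock_linear(2)[OF Vf, of c] unfolding n fock_linear(2)[OF \<phi> \<psi>, of c] by (rule sym)
    then show ?thesis by (simp only: add_left_cancel mult_cancel_left) simp
  qed
  from this[of 1] this[of \<i>] show ?thesis by (simp add: complex_eq_iff)
qed

definition fin_supp :: "nat \<Rightarrow> ('n :: finite) state \<Rightarrow> bool" where
  "fin_supp d \<phi> \<longleftrightarrow> (\<forall>k. d < deg k \<longrightarrow> \<phi> k = 0)"

lemma finite_states_iff: "\<phi> \<in> finite_states \<longleftrightarrow> (\<exists>d. fin_supp d \<phi>)"
proof
  assume "\<phi> \<in> finite_states"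
  then have "finite (deg ` {k. \<phi> k \<noteq> 0})" by (simp add: finite_states_def)
  then obtain d where "\<forall>m\<in>deg ` {k. \<phi> k \<noteq> 0}. m \<le> d" unfolding finite_nat_set_iff_bounded_le by auto
  then have "\<phi> k \<noteq> 0 \<Longrightarrow> deg k \<le> d" for k by blast
  then have "fin_supp d \<phi>" unfolding fin_supp_def by (meson not_le)
  then show "\<exists>d. fin_supp d \<phi>" ..
next
  assume "\<exists>d. fin_supp d \<phi>"
  then obtain d where "fin_supp d \<phi>" ..
  then have "{k. \<phi> k \<noteq> 0} \<subseteq> {k. deg k \<le> d}" unfolding fin_supp_def using not_le by blast
  then show "\<phi> \<in> finite_states" unfolding finite_states_def using finite_subset finite_deg_le by blast
qed

lemma fin_supp_mono: "fin_supp d \<phi> \<Longrightarrow> d \<le> d' \<Longrightarrow> fin_supp d' \<phi>"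
  by (auto simp: fin_supp_def)

lemma fin_supp_fock: assumes "fin_supp d \<phi>" shows "\<phi> \<in> fock" "fock_norm \<phi> = sqrt (\<Sum>k | deg k \<le> d. (cmod (\<phi> k))\<^sup>2)"
proof -
  have "((\<lambda>k. (cmod (\<phi> k))\<^sup>2) has_sum (\<Sum>k | deg k \<le> d. (cmod (\<phi> k))\<^sup>2)) UNIV"
    using has_sum_finite[OF finite_deg_le, of "\<lambda>k. (cmod (\<phi> k))\<^sup>2" d]
    by (rule has_sum_cong_neutral[THEN iffD1, rotated -1]) (use assms in \<open>auto simp: fin_supp_def\<close>)
  then show "\<phi> \<in> fock" "fock_norm \<phi> = sqrt (\<Sum>k | deg k \<le> d. (cmod (\<phi> k))\<^sup>2)"
    by (auto simp: fock_def fock_norm_def infsumI dest: has_sum_imp_summable)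
qed

lemma ipf_fin_supp: assumes "fin_supp d \<phi>" "d < N" shows "ipf \<phi> \<psi> = ip N \<phi> \<psi>"
proof -
  have "ip N \<phi> \<psi> = (\<Sum>k | deg k < N. cnj (\<phi> k) * \<psi> k)"
    by (simp add: ip_def sip_def sum_deg_less)
  also have "\<dots> = (\<Sum>\<^sub>\<infinity>k\<in>{k. deg k < N}. cnj (\<phi> k) * \<psi> k)" by (simp add: finite_deg_less)
  also have "\<dots> = ipf \<phi> \<psi>"
    unfolding ipf_def by (rule infsum_cong_neutral) (use assms in \<open>auto simp: fin_supp_def\<close>)
  finally show ?thesis ..
qed

definition adj :: "('n :: finite) fop \<Rightarrow> 'n fop \<Rightarrow> bool" where
  "adj X Y \<longleftrightarrow> (\<forall>d \<phi>. fin_supp d \<phi> \<longrightarrow>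
     (\<exists>d'. fin_supp d' (app X \<phi>)) \<and> (\<forall>\<psi>. ipf (app X \<phi>) \<psi> = ipf \<phi> (app Y \<psi>)))"

lemma fin_supp_an: "fin_supp d \<phi> \<Longrightarrow> fin_supp d (app (an i) \<phi>)"
  by (auto simp: fin_supp_def app_an annih_def deg_upd_Suc)

lemma fin_supp_cr:
  fixes \<phi> :: "('n :: finite) state"
  shows "fin_supp d \<phi> \<Longrightarrow> fin_supp (Suc d) (app (cr i) \<phi>)"
  unfolding fin_supp_def
proof (intro allI impI)
  fix k :: "'n \<Rightarrow> nat" assume \<phi>: "\<forall>k. d < deg k \<longrightarrow> \<phi> k = 0" and k: "Suc d < deg k"
  show "app (cr i) \<phi> k = 0"
  proof (cases "k i = 0")
    case False
    then have "d < deg (k(i := k i - 1))" using k deg_upd_pred[of k i] by linarith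
    then show ?thesis using \<phi> by (simp add: app_cr creat_def)
  qed (simp add: app_cr creat_def)
qed

lemma adj_an: "adj (an i) (cr i)" for i :: "'n :: finite"
  unfolding adj_def
proof (intro allI impI conjI)
  fix d and \<phi> \<psi> :: "'n state" assume d: "fin_supp d \<phi>"
  show "\<exists>d'. fin_supp d' (app (an i) \<phi>)" using fin_supp_an[OF d] by blast
  show "ipf (app (an i) \<phi>) \<psi> = ipf \<phi> (app (cr i) \<psi>)"
    using ipf_fin_supp[OF fin_supp_an[OF d], of "Suc d"] ipf_fin_supp[OF d, of "Suc (Suc d)"]
    by (simp add: ip_cr)
qed

lemma adj_cr: "adj (cr i) (an i)" for i :: "'n :: finite"
  unfolding adj_def
proof (intro allI impI conjI)
  fix d and \<phi> \<psi> :: "'n state" assume d: "fin_supp d \<phi>"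
  show "\<exists>d'. fin_supp d' (app (cr i) \<phi>)" using fin_supp_cr[OF d] by blast
  have "ipf (app (cr i) \<phi>) \<psi> = cnj (ip (Suc (Suc d)) \<psi> (app (cr i) \<phi>))"
    using ipf_fin_supp[OF fin_supp_cr[OF d], of "Suc (Suc d)"] by (simp add: cnj_ip)
  also have "\<dots> = ip (Suc d) \<phi> (app (an i) \<psi>)" by (simp add: ip_cr cnj_ip)
  also have "\<dots> = ipf \<phi> (app (an i) \<psi>)" using ipf_fin_supp[OF d, of "Suc d"] by simp
  finally show "ipf (app (cr i) \<phi>) \<psi> = ipf \<phi> (app (an i) \<psi>)" .
qed

lemma adj_sc: "adj (sc c :: ('n :: finite) fop) (sc (cnj c))"
  unfolding adj_def
proof (intro allI impI conjI)
  fix d and \<phi> \<psi> :: "'n state" assume d: "fin_supp d \<phi>"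
  have d': "fin_supp d (app (sc c) \<phi>)" using d by (auto simp: fin_supp_def app_sc)
  then show "\<exists>d'. fin_supp d' (app (sc c) \<phi>)" by blast
  show "ipf (app (sc c) \<phi>) \<psi> = ipf \<phi> (app (sc (cnj c)) \<psi>)"
    by (simp add: ipf_def app_sc mult_ac)
qed

lemma adj_mult:
  fixes X X' :: "('n :: finite) fop"
  shows "adj X Y \<Longrightarrow> adj X' Y' \<Longrightarrow> adj (X * X') (Y' * Y)"
  unfolding adj_def app_basic
proof (intro allI impI)
  fix d and \<phi> :: "'n state"
  assume 1: "\<forall>d \<phi>. fin_supp d \<phi> \<longrightarrow> (\<exists>d'. fin_supp d' (app X \<phi>)) \<and> (\<forall>\<psi>. ipf (app X \<phi>) \<psi> = ipf \<phi> (app Y \<psi>))"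
    and 2: "\<forall>d \<phi>. fin_supp d \<phi> \<longrightarrow> (\<exists>d'. fin_supp d' (app X' \<phi>)) \<and> (\<forall>\<psi>. ipf (app X' \<phi>) \<psi> = ipf \<phi> (app Y' \<psi>))"
    and d: "fin_supp d \<phi>"
  from 2 d obtain d' where d': "fin_supp d' (app X' \<phi>)" by blast
  from 1 d' obtain d'' where "fin_supp d'' (app X (app X' \<phi>))" by blast
  moreover have "ipf (app X (app X' \<phi>)) \<psi> = ipf \<phi> (app Y' (app Y \<psi>))" for \<psi>
    using 1 2 d d' by simp
  ultimately show "(\<exists>d'. fin_supp d' (app X (app X' \<phi>))) \<and> (\<forall>\<psi>. ipf (app X (app X' \<phi>)) \<psi> = ipf \<phi> (app Y' (app Y \<psi>)))"
    by blast
qed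

lemma adj_add:
  fixes X Y :: "('n :: finite) fop"
  assumes "adj X Y" "adj X' Y'" shows "adj (X + X') (Y + Y')"
  unfolding adj_def
proof (intro allI impI conjI)
  fix d and \<phi> \<psi> :: "'n state" assume d: "fin_supp d \<phi>"
  obtain d1 where d1: "fin_supp d1 (app X \<phi>)" using assms(1) d unfolding adj_def by blast
  obtain d2 where d2: "fin_supp d2 (app X' \<phi>)" using assms(2) d unfolding adj_def by blast
  have d3: "fin_supp (max d1 d2) (app (X + X') \<phi>)" using d1 d2 by (auto simp: fin_supp_def app_basic)
  then show "\<exists>d'. fin_supp d' (app (X + X') \<phi>)" by blast
  define N where "N = Suc (d + d1 + d2)"
  have "ipf (app (X + X') \<phi>) \<psi> = ip N (app (X + X') \<phi>) \<psi>"
    by (rule ipf_fin_supp[OF d3]) (simp add: N_def max_def)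
  also have "\<dots> = ip N (app X \<phi>) \<psi> + ip N (app X' \<phi>) \<psi>"
    by (simp add: ip_def sip_def app_basic distrib_right sum.distrib)
  also have "ip N (app X \<phi>) \<psi> = ipf (app X \<phi>) \<psi>" by (rule ipf_fin_supp[OF d1, symmetric]) (simp add: N_def max_def)
  also have "ip N (app X' \<phi>) \<psi> = ipf (app X' \<phi>) \<psi>" by (rule ipf_fin_supp[OF d2, symmetric]) (simp add: N_def max_def)
  also have "ipf (app X \<phi>) \<psi> = ipf \<phi> (app Y \<psi>)" using assms(1) d unfolding adj_def by blast
  also have "ipf (app X' \<phi>) \<psi> = ipf \<phi> (app Y' \<psi>)" using assms(2) d unfolding adj_def by blast
  also have "ipf \<phi> (app Y \<psi>) = ip N \<phi> (app Y \<psi>)" by (rule ipf_fin_supp[OF d]) (simp add: N_def max_def)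
  also have "ipf \<phi> (app Y' \<psi>) = ip N \<phi> (app Y' \<psi>)" by (rule ipf_fin_supp[OF d]) (simp add: N_def max_def)
  also have "ip N \<phi> (app Y \<psi>) + ip N \<phi> (app Y' \<psi>) = ip N \<phi> (app (Y + Y') \<psi>)"
    by (simp add: ip_def sip_def app_basic distrib_left sum.distrib)
  also have "\<dots> = ipf \<phi> (app (Y + Y') \<psi>)" by (rule ipf_fin_supp[OF d, symmetric]) (simp add: N_def max_def)
  finally show "ipf (app (X + X') \<phi>) \<psi> = ipf \<phi> (app (Y + Y') \<psi>)" .
qed

lemma adj_sum: assumes "finite S" "\<And>i. i \<in> S \<Longrightarrow> adj (X i) (Y i)" shows "adj (sum X S) (sum Y S)"
  using assms
proof (induction S rule: finite_induct)
  case empty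
  show ?case using adj_sc[of 0] by simp
qed (simp add: adj_add)

lemma adj_gen:
  fixes A B :: "complex^'n^'n"
  assumes A: "transpose A = A" and B: "cnj_mat (transpose B) = B"
  shows "adj (gen A B h) (- gen A B h)"
proof -
  have As: "A $ i $ j = A $ j $ i" for i j using A by (auto simp: vec_eq_iff transpose_def)
  have Bs: "cnj (B $ i $ j) = B $ j $ i" for i j using B by (auto simp: vec_eq_iff transpose_def)
  define Y where "Y = (\<Sum>i\<in>UNIV. \<Sum>j\<in>UNIV. (an j * an i) * sc (cnj (- A $ i $ j / 2)))
    + (\<Sum>i\<in>UNIV. \<Sum>j\<in>UNIV. (cr j * cr i) * sc (cnj (cnj (A $ i $ j) / 2)))
    + (\<Sum>i\<in>UNIV. \<Sum>j\<in>UNIV. (cr j * an i) * sc (cnj (\<i> * B $ i $ j)))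
    + (\<Sum>i\<in>UNIV. an i * sc (cnj (- h $ i)))
    + (\<Sum>i\<in>UNIV. cr i * sc (cnj (cnj (h $ i))))"
  have "adj (gen A B h) Y"
    unfolding gen_def Y_def by (intro adj_add adj_sum adj_mult adj_sc adj_an adj_cr finite_class.finite_UNIV)
  moreover have "Y = - gen A B h"
  proof -
    have r: "app (X * sc c) \<psi> k = c * app X \<psi> k" for X :: "'n fop" and c \<psi> k
      by (simp only: sc_commute app_basic app_sc)
    have 1: "(\<Sum>i\<in>UNIV. \<Sum>j\<in>UNIV. cnj (- A $ i $ j / 2) * app (an j) (app (an i) \<psi>) k)
        = (\<Sum>i\<in>UNIV. \<Sum>j\<in>UNIV. - ((cnj (A $ i $ j) / 2) * app (an i) (app (an j) \<psi>) k))" for \<psi> k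
      by (subst sum.swap) (intro sum.cong refl, subst As, simp)
    have 2: "(\<Sum>i\<in>UNIV. \<Sum>j\<in>UNIV. cnj (cnj (A $ i $ j) / 2) * app (cr j) (app (cr i) \<psi>) k)
        = (\<Sum>i\<in>UNIV. \<Sum>j\<in>UNIV. - ((- A $ i $ j / 2) * app (cr i) (app (cr j) \<psi>) k))" for \<psi> k
      by (subst sum.swap) (intro sum.cong refl, subst As, simp)
    have 3: "(\<Sum>i\<in>UNIV. \<Sum>j\<in>UNIV. cnj (\<i> * B $ i $ j) * app (cr j) (app (an i) \<psi>) k)
        = (\<Sum>i\<in>UNIV. \<Sum>j\<in>UNIV. - ((\<i> * B $ i $ j) * app (cr i) (app (an j) \<psi>) k))" for \<psi> k
      by (subst sum.swap) (intro sum.cong refl, simp add: Bs)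
    show ?thesis
    proof (rule fop_eqI)
      fix \<psi> :: "'n state" and k
      show "app Y \<psi> k = app (- gen A B h) \<psi> k"
        unfolding Y_def app_basic(3,5) app_gen app_sum r
        unfolding app_basic(4) 1 2 3
        by (simp add: sum_negf)
    qed
  qed
  ultimately show ?thesis by simp
qed

lemma fock_norm_diff_tendsto_ipf:
  assumes \<xi>: "\<xi> \<in> fock" and \<eta>: "\<eta> \<in> fock" and f: "\<And>s. f s \<in> fock"
    and lim: "((\<lambda>s. fock_norm (\<lambda>k. f s k - \<eta> k)) \<longlongrightarrow> 0) F"
  shows "((\<lambda>s. ipf (f s) \<xi>) \<longlongrightarrow> ipf \<eta> \<xi>) F"
proof -
  have "((\<lambda>s. ipf (f s) \<xi> - ipf \<eta> \<xi>) \<longlongrightarrow> 0) F"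
  proof (rule Lim_null_comparison)
    have "norm (ipf (f s) \<xi> - ipf \<eta> \<xi>) \<le> fock_norm (\<lambda>k. f s k - \<eta> k) * fock_norm \<xi>" for s
      unfolding ipf_diff_left[OF f \<eta> \<xi>, symmetric] by (rule cmod_ipf[OF fock_diff[OF f \<eta>] \<xi>])
    then show "\<forall>\<^sub>F s in F. norm (ipf (f s) \<xi> - ipf \<eta> \<xi>) \<le> fock_norm (\<lambda>k. f s k - \<eta> k) * fock_norm \<xi>"
      by (intro always_eventually allI)
    show "((\<lambda>s. fock_norm (\<lambda>k. f s k - \<eta> k) * fock_norm \<xi>) \<longlongrightarrow> 0) F"
      using tendsto_mult_left_zero[OF lim] .
  qed
  then show ?thesis by (rule LIM_zero_cancel)
qed

lemma unitary_group_pder: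
  fixes A B :: "complex^'n^'n" and h :: "complex^'n" and U :: "real \<Rightarrow> 'n state \<Rightarrow> 'n state"
  assumes A: "transpose A = A" and B: "cnj_mat (transpose B) = B"
    and U: "generated_by U (hamiltonian A B h)" and \<psi>: "\<psi> \<in> fock"
  shows "pder (\<lambda>t. U t \<psi>) (app (gen A B h) (U t \<psi>)) t"
  unfolding pder_def
proof
  fix k
  have grp: "unitary_group U" using U by (simp add: generated_by_def)
  have un: "unitary_op (U t)" for t using grp by (simp add: unitary_group_def)
  have U0: "\<phi> \<in> fock \<Longrightarrow> U 0 \<phi> = \<phi>" for \<phi> using grp by (simp add: unitary_group_def)
  have Uadd: "\<phi> \<in> fock \<Longrightarrow> U (s + t) \<phi> = U s (U t \<phi>)" for \<phi> s t using grp by (simp add: unitary_group_def)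
  have Uf: "\<phi> \<in> fock \<Longrightarrow> U t \<phi> \<in> fock" for \<phi> t using un[of t] by (auto simp: unitary_op_def)
  define \<delta> :: "'n state" where "\<delta> = (\<lambda>l. if l = k then 1 else 0)"
  define \<eta> where "\<eta> = hamiltonian A B h \<delta>"
  define \<xi> where "\<xi> = U t \<psi>"
  have \<xi>: "\<xi> \<in> fock" unfolding \<xi>_def by (rule Uf[OF \<psi>])
  have \<delta>_fin: "fin_supp (deg k) \<delta>" by (auto simp: fin_supp_def \<delta>_def)
  then have \<delta>: "\<delta> \<in> fock" "\<delta> \<in> finite_states" using fin_supp_fock finite_states_iff by blast+
  have val: "ipf \<delta> \<phi> = \<phi> k" for \<phi>
  proof -
    have "ipf \<delta> \<phi> = (\<Sum>\<^sub>\<infinity>l\<in>{k}. cnj (\<delta> l) * \<phi> l)"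
      unfolding ipf_def by (rule infsum_cong_neutral) (auto simp: \<delta>_def)
    then show ?thesis by (simp add: \<delta>_def)
  qed
  have gen_\<eta>: "app (gen A B h) \<delta> = (\<lambda>l. \<i> * \<eta> l)"
    by (simp add: fun_eq_iff app_gen_hamiltonian \<eta>_def)
  have st: "(\<delta>, \<eta>) \<in> stone_generator U" using U \<delta>(2) by (simp add: generated_by_def \<eta>_def)
  then have \<eta>: "\<eta> \<in> fock" by (simp add: stone_generator_def)
  define E where "E s = (\<lambda>l. (U s \<delta> l - \<delta> l) / (\<i> * of_real s))" for s :: real
  have "((\<lambda>s. fock_norm (\<lambda>l. E s l - \<eta> l)) \<longlongrightarrow> 0) (at 0)"
    using st by (simp add: stone_generator_def E_def)
  moreover have "filterlim uminus (at (0 :: real)) (at (0 :: real))"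
    by (intro filterlim_atI) (auto intro!: tendsto_eq_intros simp: eventually_at_filter)
  ultimately have lim: "((\<lambda>s. fock_norm (\<lambda>l. E (- s) l - \<eta> l)) \<longlongrightarrow> 0) (at 0)"
    by (rule filterlim_compose)
  have Ef: "E s \<in> fock" for s
    using fock_scale[OF fock_diff[OF Uf[OF \<delta>(1)] \<delta>(1)], of "1 / (\<i> * of_real s)" s] by (simp add: E_def)
  have "((\<lambda>s. \<i> * ipf (E (- s)) \<xi>) \<longlongrightarrow> \<i> * ipf \<eta> \<xi>) (at 0)"
    by (intro tendsto_mult_left fock_norm_diff_tendsto_ipf[OF \<xi> \<eta> Ef lim])
  also have "\<i> * ipf \<eta> \<xi> = app (gen A B h) \<xi> k"
  proof -
    have "ipf (\<lambda>l. \<i> * \<eta> l) \<xi> = - \<i> * ipf \<eta> \<xi>" using ipf_scale_left[OF \<eta> \<xi>, of \<i>] by simp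
    moreover have "ipf (app (gen A B h) \<delta>) \<xi> = ipf \<delta> (app (- gen A B h) \<xi>)"
      using adj_gen[OF A B, of h] \<delta>_fin unfolding adj_def by blast
    ultimately show ?thesis by (simp add: gen_\<eta> val app_basic)
  qed
  finally have L: "((\<lambda>s. \<i> * ipf (E (- s)) \<xi>) \<longlongrightarrow> app (gen A B h) \<xi> k) (at 0)" .
  have eq: "(U (t + s) \<psi> k - U t \<psi> k) /\<^sub>R s = \<i> * ipf (E (- s)) \<xi>" if "s \<noteq> 0" for s
  proof -
    have 1: "U (- s) \<delta> \<in> fock" by (rule Uf[OF \<delta>(1)])
    have "ipf (U (- s) \<delta>) \<xi> = ipf (U s (U (- s) \<delta>)) (U s \<xi>)"
      by (rule unitary_op_ipf[OF un 1 \<xi>, symmetric])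
    also have "U s (U (- s) \<delta>) = \<delta>" using Uadd[OF \<delta>(1), of s "- s"] U0[OF \<delta>(1)] by simp
    also have "ipf \<delta> (U s \<xi>) = U (t + s) \<psi> k"
      using Uadd[OF \<psi>, of s t] by (simp add: val \<xi>_def add.commute)
    finally have 2: "ipf (U (- s) \<delta>) \<xi> = U (t + s) \<psi> k" .
    have "E (- s) = (\<lambda>l. (\<i> / of_real s) * (U (- s) \<delta> l - \<delta> l))"
      using that by (simp add: E_def fun_eq_iff field_simps)
    then have "ipf (E (- s)) \<xi> = cnj (\<i> / of_real s) * ipf (\<lambda>l. U (- s) \<delta> l - \<delta> l) \<xi>"
      by (simp only: ipf_scale_left[OF fock_diff[OF 1 \<delta>(1)] \<xi>])
    also have "ipf (\<lambda>l. U (- s) \<delta> l - \<delta> l) \<xi> = U (t + s) \<psi> k - U t \<psi> k"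
      using ipf_diff_left[OF 1 \<delta>(1) \<xi>] 2 val[of \<xi>] by (simp add: \<xi>_def)
    finally have e: "ipf (E (- s)) \<xi> = cnj (\<i> / of_real s) * (U (t + s) \<psi> k - U t \<psi> k)" .
    have "\<i> * (cnj (\<i> / of_real s) * x) = x /\<^sub>R s" for x :: complex
      using that by (simp add: scaleR_conv_of_real divide_inverse mult_ac)
    then show ?thesis by (simp only: e)
  qed
  have "((\<lambda>s. (U (t + s) \<psi> k - U t \<psi> k) /\<^sub>R s) \<longlongrightarrow> app (gen A B h) \<xi> k) (at 0)"
    by (rule Lim_transform_eventually[OF L]) (auto simp: eventually_at_filter eq)
  then show "((\<lambda>t. U t \<psi> k) has_vector_derivative app (gen A B h) (U t \<psi>) k) (at t)"
    unfolding has_vector_derivative_quotient by (subst LIM_offset_zero_iff) (simp_all add: \<xi>_def)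
qed

lemma unitary_group_eqI:
  fixes A B :: "complex^'n^'n" and h :: "complex^'n" and U :: "real \<Rightarrow> 'n state \<Rightarrow> 'n state"
  assumes A: "transpose A = A" and B: "cnj_mat (transpose B) = B"
    and U: "generated_by U (hamiltonian A B h)" and \<psi>: "\<psi> \<in> fock"
    and w: "\<And>t. pder w (app (gen A B h) (w t)) t" "loc_decays w" "w 0 = \<psi>"
  shows "U t \<psi> = w t"
proof -
  have grp: "unitary_group U" using U by (simp add: generated_by_def)
  define v where "v s = (\<lambda>k. U s \<psi> k - w s k)" for s
  have "v t = (\<lambda>k. 0)"
  proof (rule schroedinger_unique[OF A B])
    show "pder v (app (gen A B h) (v t)) t" for t
    proof -
      have "app (gen A B h) (v t) = (\<lambda>k. app (gen A B h) (U t \<psi>) k - app (gen A B h) (w t) k)"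
        by (simp only: v_def fun_eq_iff app_minus_arg) simp
      then show ?thesis
        using unitary_group_pder[OF A B U \<psi>, of t] w(1)[of t]
        by (auto simp: pder_def v_def intro: has_vector_derivative_diff)
    qed
    show "\<exists>M. \<forall>t. \<bar>t\<bar> \<le> T \<longrightarrow> (\<forall>N. (\<Sum>m<N. (sh m (v t))\<^sup>2) \<le> M)" for T
    proof -
      obtain M where M: "\<forall>t. \<bar>t\<bar> \<le> T \<longrightarrow> (\<forall>N. (\<Sum>m<N. (sh m (w t))\<^sup>2) \<le> M)"
        using loc_decays_bounded[OF w(2)] by blast
      have "(\<Sum>m<N. (sh m (v t))\<^sup>2) \<le> 2 * (fock_norm \<psi>)\<^sup>2 + 2 * M" if "\<bar>t\<bar> \<le> T" for t N
      proof -
        have un: "unitary_op (U t)" using grp by (simp add: unitary_group_def)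
        have Uf: "U t \<psi> \<in> fock" "fock_norm (U t \<psi>) = fock_norm \<psi>"
          using un \<psi> by (auto simp: unitary_op_def)
        have "(sh m (v t))\<^sup>2 \<le> 2 * (sh m (U t \<psi>))\<^sup>2 + 2 * (sh m (w t))\<^sup>2" for m
        proof -
          have "v t = (\<lambda>k. U t \<psi> k + (-1) * w t k)" by (simp add: v_def)
          then have "sh m (v t) \<le> sh m (U t \<psi>) + sh m (w t)"
            using sh_add[of m "U t \<psi>" "\<lambda>k. (-1) * w t k"] sh_scale[of m "-1" "w t"] by simp
          then have "(sh m (v t))\<^sup>2 \<le> (sh m (U t \<psi>) + sh m (w t))\<^sup>2" by (intro power_mono) auto
          also have "\<dots> \<le> 2 * (sh m (U t \<psi>))\<^sup>2 + 2 * (sh m (w t))\<^sup>2"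
          proof -
            have "(a + b)\<^sup>2 \<le> 2 * a\<^sup>2 + 2 * b\<^sup>2" for a b :: real
              using sum_squares_bound[of a b] by (simp add: power2_sum)
            then show ?thesis .
          qed
          finally show ?thesis .
        qed
        then have "(\<Sum>m<N. (sh m (v t))\<^sup>2) \<le> (\<Sum>m<N. 2 * (sh m (U t \<psi>))\<^sup>2 + 2 * (sh m (w t))\<^sup>2)"
          by (intro sum_mono)
        also have "\<dots> = 2 * (\<Sum>m<N. (sh m (U t \<psi>))\<^sup>2) + 2 * (\<Sum>m<N. (sh m (w t))\<^sup>2)"
          by (simp add: sum.distrib sum_distrib_left)
        also have "\<dots> \<le> 2 * (fock_norm \<psi>)\<^sup>2 + 2 * M"
          using fock_shells[OF Uf(1), of N] M that by (intro add_mono mult_left_mono) (auto simp: Uf(2))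
        finally show ?thesis .
      qed
      then show ?thesis by blast
    qed
    show "v 0 = (\<lambda>k. 0)" using grp \<psi> w(3) by (simp add: v_def unitary_group_def)
  qed
  then have "v t k = 0" for k by simp
  then show ?thesis by (simp add: v_def fun_eq_iff)
qed

section \<open>Pointwise exponential series\<close>

definition trm :: "('n :: finite) fop \<Rightarrow> nat \<Rightarrow> 'n state \<Rightarrow> 'n state" where
  "trm X m \<psi> = (\<lambda>k. (1 / fact m) * app (X ^ m) \<psi> k)"

definition pexp :: "('n :: finite) fop \<Rightarrow> 'n state \<Rightarrow> 'n state" where
  "pexp X \<psi> = (\<lambda>k. \<Sum>m. trm X m \<psi> k)"

definition conv :: "('n :: finite) fop \<Rightarrow> 'n state \<Rightarrow> bool" where
  "conv X \<psi> \<longleftrightarrow> (\<forall>k. summable (\<lambda>m. trm X m \<psi> k))"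

lemma conv_sums: "conv X \<psi> \<Longrightarrow> (\<lambda>m. trm X m \<psi> k) sums pexp X \<psi> k"
  unfolding conv_def pexp_def by (rule summable_sums) simp

lemma app_of_nat_mult: "app (of_nat m * X) \<psi> k = of_nat m * app X \<psi> k"
  by (induction m) (simp_all add: app_basic distrib_right)

lemma trm_0: "trm X 0 \<psi> = \<psi>"
  by (simp add: trm_def app_basic)

lemma trm_Suc: "trm X (Suc m) \<psi> k = (1 / of_nat (Suc m)) * app X (trm X m \<psi>) k"
proof -
  have "app X (trm X m \<psi>) k = (1 / fact m) * app X (app (X ^ m) \<psi>) k" by (simp only: trm_def app_scale)
  then show ?thesis by (simp add: trm_def app_basic)
qed

lemma app_trm: "app b (trm X m \<psi>) k = (1 / fact m) * app b (app (X ^ m) \<psi>) k"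
  by (simp only: trm_def app_scale)

lemma trm_linear: "trm X m (\<lambda>k. c * \<phi> k + \<psi> k) k = c * trm X m \<phi> k + trm X m \<psi> k"
  unfolding trm_def app_linear by (simp add: distrib_left)

lemma commutator_power:
  fixes X b c :: "'a :: ring_1"
  assumes "b * X = X * b + c" "c * X = X * c"
  shows "b * X ^ Suc m = X ^ Suc m * b + of_nat (Suc m) * (c * X ^ m)"
proof (induction m)
  case (Suc m)
  have "b * X ^ Suc (Suc m) = (b * X) * X ^ Suc m" by (simp add: mult.assoc)
  also have "\<dots> = X * (b * X ^ Suc m) + c * X ^ Suc m" by (simp only: assms(1) distrib_right mult.assoc)
  also have "X * (b * X ^ Suc m) = X * X ^ Suc m * b + X * (of_nat (Suc m) * (c * X ^ m))"
    by (simp only: Suc.IH distrib_left mult.assoc)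
  also have "X * (of_nat (Suc m) * (c * X ^ m)) = of_nat (Suc m) * ((c * X) * X ^ m)"
    by (simp only: assms(2) mult.assoc[symmetric] mult_of_nat_commute[symmetric, of X])
  also have "(c * X) * X ^ m = c * X ^ Suc m" by (simp only: mult.assoc power_Suc)
  finally show ?case by (simp add: distrib_right add.assoc add.commute)
qed (use assms in simp)

lemma trm_intertwine:
  assumes "b * X = X * b + c" "c * X = X * c"
  shows "app b (trm X (Suc m) \<psi>) k = trm X (Suc m) (app b \<psi>) k + app c (trm X m \<psi>) k"
proof -
  have "app (b * X ^ Suc m) \<psi> k = app (X ^ Suc m * b + of_nat (Suc m) * (c * X ^ m)) \<psi> k"
    by (simp only: commutator_power[OF assms])
  then have "app b (app (X ^ Suc m) \<psi>) k = app (X ^ Suc m) (app b \<psi>) k + of_nat (Suc m) * app c (app (X ^ m) \<psi>) k"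
    unfolding app_basic(3) app_of_nat_mult unfolding app_basic(4) .
  moreover have "(1 / fact (Suc m)) * (x + of_nat (Suc m) * y) = (1 / fact (Suc m)) * x + (1 / fact m) * y" for x y :: complex
    by (simp add: distrib_left del: of_nat_Suc)
  ultimately show ?thesis unfolding app_trm by (simp only: trm_def)
qed

lemma pexp_intertwine:
  assumes "b * X = X * b + c" "c * X = X * c" and \<psi>: "conv X \<psi>" and b\<psi>: "conv X (app b \<psi>)"
  shows "app b (pexp X \<psi>) k = pexp X (app b \<psi>) k + app c (pexp X \<psi>) k"
proof -
  have "(\<lambda>m. app b (trm X m \<psi>) k) sums app b (pexp X \<psi>) k"
    by (rule app_sums[OF conv_sums[OF \<psi>]])
  then have "(\<lambda>m. app b (trm X (Suc m) \<psi>) k) sums (app b (pexp X \<psi>) k - app b \<psi> k)"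
    by (subst sums_Suc_iff) (simp add: trm_0)
  moreover have "(\<lambda>m. trm X (Suc m) (app b \<psi>) k) sums (pexp X (app b \<psi>) k - app b \<psi> k)"
    using conv_sums[OF b\<psi>, of k] by (subst sums_Suc_iff) (simp add: trm_0)
  from sums_add[OF this app_sums[OF conv_sums[OF \<psi>], where X = c and k = k]]
  have "(\<lambda>m. app b (trm X (Suc m) \<psi>) k) sums (pexp X (app b \<psi>) k - app b \<psi> k + app c (pexp X \<psi>) k)"
    by (simp only: trm_intertwine[OF assms(1,2)])
  ultimately have "app b (pexp X \<psi>) k - app b \<psi> k = pexp X (app b \<psi>) k - app b \<psi> k + app c (pexp X \<psi>) k"
    by (rule sums_unique2)
  then show ?thesis by (simp add: algebra_simps)
qed

lemma conv_linear: "conv X \<phi> \<Longrightarrow> conv X \<psi> \<Longrightarrow> conv X (\<lambda>k. c * \<phi> k + \<psi> k)"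
  unfolding conv_def trm_linear by (intro allI summable_add summable_mult) auto

lemma pexp_linear:
  assumes "conv X \<phi>" "conv X \<psi>"
  shows "pexp X (\<lambda>k. c * \<phi> k + \<psi> k) k = c * pexp X \<phi> k + pexp X \<psi> k"
  using sums_add[OF sums_mult[OF conv_sums[OF assms(1)], of c k] conv_sums[OF assms(2), of k]]
  unfolding pexp_def[of X "\<lambda>k. c * \<phi> k + \<psi> k"] trm_linear by (rule sums_unique[symmetric])

lemma conv_zero: "conv X (\<lambda>k. 0)" and pexp_zero: "pexp X (\<lambda>k. 0) = (\<lambda>k. 0)"
  by (simp_all add: conv_def pexp_def trm_def app_zero)

lemma conv_pexp_sum:
  assumes "finite S" "\<And>i. i \<in> S \<Longrightarrow> conv X (\<psi> i)"
  shows "conv X (\<lambda>k. \<Sum>i\<in>S. c i * \<psi> i k) \<and> pexp X (\<lambda>k. \<Sum>i\<in>S. c i * \<psi> i k) = (\<lambda>k. \<Sum>i\<in>S. c i * pexp X (\<psi> i) k)"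
  using assms
proof (induction S rule: finite_induct)
  case empty
  then show ?case by (simp add: conv_zero pexp_zero)
next
  case (insert x F)
  then have "conv X (\<lambda>k. \<Sum>i\<in>F. c i * \<psi> i k)" "pexp X (\<lambda>k. \<Sum>i\<in>F. c i * \<psi> i k) = (\<lambda>k. \<Sum>i\<in>F. c i * pexp X (\<psi> i) k)"
    by auto
  then show ?case
    using conv_linear[of X "\<psi> x" "\<lambda>k. \<Sum>i\<in>F. c i * \<psi> i k" "c x"]
      pexp_linear[of X "\<psi> x" "\<lambda>k. \<Sum>i\<in>F. c i * \<psi> i k" "c x"] insert by (simp add: fun_eq_iff)
qed

definition van :: "nat \<Rightarrow> ('n :: finite) state \<Rightarrow> bool" where
  "van N \<psi> \<longleftrightarrow> (\<forall>k. deg k < N \<longrightarrow> \<psi> k = 0)"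

definition raising :: "('n :: finite) fop \<Rightarrow> bool" where
  "raising X \<longleftrightarrow> (\<forall>N \<psi>. van N \<psi> \<longrightarrow> van (Suc N) (app X \<psi>))"

lemma raising_cr: "raising (cr i)" for i :: "'n :: finite"
  unfolding raising_def van_def
proof (intro allI impI)
  fix N and \<psi> :: "'n state" and k :: "'n \<Rightarrow> nat" assume \<psi>: "\<forall>k. deg k < N \<longrightarrow> \<psi> k = 0" and k: "deg k < Suc N"
  show "app (cr i) \<psi> k = 0"
  proof (cases "k i = 0")
    case False
    then have "deg (k(i := k i - 1)) < N" using k deg_upd_pred[of k i] by linarith
    then show ?thesis using \<psi> by (simp add: app_cr creat_def)
  qed (simp add: app_cr creat_def)
qed

lemma raising_mult: assumes "raising X" "raising Y" shows "raising (X * Y)"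
  using assms unfolding raising_def app_basic van_def by (metis less_Suc_eq)

lemma raising_sc_mult: "raising X \<Longrightarrow> raising (sc c * X)"
  by (simp add: raising_def van_def app_basic app_sc)

lemma raising_add: "raising X \<Longrightarrow> raising Y \<Longrightarrow> raising (X + Y)"
  by (simp add: raising_def van_def app_basic)

lemma raising_sum: "(\<And>i. i \<in> S \<Longrightarrow> raising (X i)) \<Longrightarrow> raising (sum X S)"
  by (simp add: raising_def van_def app_sum)

lemma raising_trm: assumes "raising X" "deg k < m" shows "trm X m \<psi> k = 0"
proof -
  have "van m (app (X ^ m) \<psi>)" for m
  proof (induction m)
    case (Suc m)
    then show ?case using assms(1) by (simp add: raising_def app_basic)
  qed (simp add: van_def)
  then show ?thesis using assms(2) by (simp add: van_def trm_def)
qed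

lemma raising_sums:
  assumes "raising X" "deg k \<le> N" shows "(\<lambda>m. trm X m \<psi> k) sums (\<Sum>m\<le>N. trm X m \<psi> k)"
  by (rule sums_finite) (use raising_trm[OF assms(1)] assms(2) in auto)

lemma raising_conv: "raising X \<Longrightarrow> conv X \<psi>"
  unfolding conv_def using raising_sums sums_summable by blast

lemma raising_pexp: "raising X \<Longrightarrow> deg k \<le> N \<Longrightarrow> pexp X \<psi> k = (\<Sum>m\<le>N. trm X m \<psi> k)"
  using raising_sums[of X k N \<psi>] unfolding pexp_def by (simp add: sums_iff)

lemma fock_norm_tendsto_zero_finite:
  fixes f :: "nat \<Rightarrow> ('n :: finite) state"
  assumes "\<And>N. fin_supp d (f N)" "\<And>k. (\<lambda>N. f N k) \<longlonglongrightarrow> 0"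
  shows "(\<lambda>N. fock_norm (f N)) \<longlonglongrightarrow> 0"
proof -
  have "(\<lambda>N. sqrt (\<Sum>k | deg k \<le> d. (cmod (f N k))\<^sup>2)) \<longlonglongrightarrow> sqrt (\<Sum>k :: 'n \<Rightarrow> nat | deg k \<le> d. (cmod 0)\<^sup>2)"
    by (intro tendsto_real_sqrt tendsto_sum tendsto_power tendsto_norm assms(2))
  then show ?thesis by (simp add: fin_supp_fock(2)[OF assms(1)])
qed

lemma op_exp_finite:
  assumes fin: "\<And>m. fin_supp d (trm X m \<psi>)" and c: "conv X \<psi>"
  shows "(\<psi>, pexp X \<psi>) \<in> op_exp (app X)" "fin_supp d (pexp X \<psi>)"
proof -
  have "fin_supp d (app (X ^ m) \<psi>)" for m
    using fin[of m] by (simp add: fin_supp_def trm_def)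
  then have 1: "app (X ^ m) \<psi> \<in> fock" for m using fin_supp_fock by blast
  show 2: "fin_supp d (pexp X \<psi>)"
    using fin by (simp add: fin_supp_def pexp_def)
  have 3: "(\<lambda>N. fock_norm (\<lambda>k. (\<Sum>m<N. trm X m \<psi> k) - pexp X \<psi> k)) \<longlonglongrightarrow> 0"
  proof (rule fock_norm_tendsto_zero_finite)
    show "fin_supp d (\<lambda>k. (\<Sum>m<N. trm X m \<psi> k) - pexp X \<psi> k)" for N
      using fin 2 by (simp add: fin_supp_def)
    show "(\<lambda>N. (\<Sum>m<N. trm X m \<psi> k) - pexp X \<psi> k) \<longlonglongrightarrow> 0" for k
      using conv_sums[OF c, of k] by (simp add: sums_def LIM_zero)
  qed
  then show "(\<psi>, pexp X \<psi>) \<in> op_exp (app X)"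
    using 1 fin_supp_fock(1)[OF 2] by (simp add: op_exp_def trm_def app_power)
qed

text \<open>A geometric bound in the order of the exponential series and in the particle number, which
  is stable under the creation operators.\<close>

definition geo :: "('n :: finite) fop \<Rightarrow> 'n state \<Rightarrow> bool" where
  "geo X \<psi> \<longleftrightarrow> (\<exists>C \<mu>. 0 \<le> C \<and> 0 < \<mu> \<and> \<mu> < 1 \<and> (\<forall>m. decays (C * \<mu> ^ m) \<mu> (trm X m \<psi>)))"

lemma decays_pexp:
  assumes X: "raising X" and \<mu>: "0 < \<mu>" "\<mu> < 1" and C: "0 \<le> C"
    and d: "\<And>m. decays (C * \<mu> ^ m) \<mu> (trm X m \<psi>)"
  shows "decays (C * \<mu> ^ M / (1 - \<mu>)) \<mu> (\<lambda>k. pexp X \<psi> k - (\<Sum>m<M. trm X m \<psi> k))"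
  unfolding decays_def
proof
  fix N
  have tail: "pexp X \<psi> k - (\<Sum>m<M. trm X m \<psi> k) = (\<Sum>m<Suc N. trm X (m + M) \<psi> k)" if "k \<in> shell N" for k
  proof -
    have k: "deg k = N" using that by (simp add: shell_def)
    have "pexp X \<psi> k = (\<Sum>m<M + Suc N. trm X m \<psi> k)"
      using raising_pexp[OF X, of k "M + N" \<psi>] k by (simp add: lessThan_Suc_atMost)
    also have "\<dots> = (\<Sum>m<M. trm X m \<psi> k) + (\<Sum>m<Suc N. trm X (m + M) \<psi> k)"
      by (induction N) (simp_all add: add.commute add.left_commute)
    finally show ?thesis by simp
  qed
  have "sh N (\<lambda>k. pexp X \<psi> k - (\<Sum>m<M. trm X m \<psi> k)) = sh N (\<lambda>k. \<Sum>m<Suc N. trm X (m + M) \<psi> k)"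
    unfolding sh_def by (rule L2_set_cong[OF refl]) (simp only: tail)
  also have "\<dots> \<le> (\<Sum>m<Suc N. sh N (trm X (m + M) \<psi>))" by (rule sh_sum)
  also have "\<dots> \<le> (\<Sum>m<Suc N. C * \<mu> ^ (m + M) * \<mu> ^ N)"
    using d by (intro sum_mono) (simp add: decays_def)
  also have "\<dots> = (C * \<mu> ^ M * \<mu> ^ N) * (\<Sum>m<Suc N. \<mu> ^ m)"
    by (simp only: sum_distrib_left power_add mult_ac)
  also have "\<dots> \<le> (C * \<mu> ^ M * \<mu> ^ N) * (1 / (1 - \<mu>))"
  proof (rule mult_left_mono)
    have "(\<Sum>m<Suc N. \<mu> ^ m) \<le> (\<Sum>m. \<mu> ^ m)"
      using \<mu> by (intro sum_le_suminf summable_geometric) auto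
    then show "(\<Sum>m<Suc N. \<mu> ^ m) \<le> 1 / (1 - \<mu>)" using \<mu> by (simp only: suminf_geometric abs_of_pos real_norm_def)
  qed (use C \<mu> in simp)
  finally show "sh N (\<lambda>k. pexp X \<psi> k - (\<Sum>m<M. trm X m \<psi> k)) \<le> C * \<mu> ^ M / (1 - \<mu>) * \<mu> ^ N" by simp
qed

lemma sh_diff_commute: "sh N (\<lambda>k. \<phi> k - \<psi> k) = sh N (\<lambda>k. \<psi> k - \<phi> k)"
  by (simp add: sh_def norm_minus_commute)

lemma op_exp_geo:
  assumes X: "raising X" and g: "geo X \<psi>"
  shows "(\<psi>, pexp X \<psi>) \<in> op_exp (app X)"
proof -
  obtain C \<mu> where C: "0 \<le> C" and \<mu>: "0 < \<mu>" "\<mu> < 1" and d: "\<And>m. decays (C * \<mu> ^ m) \<mu> (trm X m \<psi>)"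
    using g unfolding geo_def by blast
  have 1: "app (X ^ m) \<psi> \<in> fock" for m
    using fock_scale[OF decays_fock(1)[OF d \<mu>], of "fact m" m] by (simp add: trm_def)
  note dp = decays_pexp[OF X \<mu> C d]
  have 2: "pexp X \<psi> \<in> fock" using decays_fock(1)[OF dp[of 0] \<mu>] by simp
  define D where "D = C / (1 - \<mu>)"
  have D: "0 \<le> D" using C \<mu> by (simp add: D_def)
  have 3: "(\<lambda>N. fock_norm (\<lambda>k. (\<Sum>m<N. trm X m \<psi> k) - pexp X \<psi> k)) \<longlonglongrightarrow> 0"
  proof (rule Lim_null_comparison)
    show "\<forall>\<^sub>F N in sequentially. norm (fock_norm (\<lambda>k. (\<Sum>m<N. trm X m \<psi> k) - pexp X \<psi> k)) \<le> D / sqrt (1 - \<mu>\<^sup>2) * \<mu> ^ N"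
    proof (intro always_eventually allI)
      fix N
      have "decays (D * \<mu> ^ N) \<mu> (\<lambda>k. (\<Sum>m<N. trm X m \<psi> k) - pexp X \<psi> k)"
        using dp[of N] unfolding decays_def by (subst sh_diff_commute) (simp add: D_def)
      then have "(fock_norm (\<lambda>k. (\<Sum>m<N. trm X m \<psi> k) - pexp X \<psi> k))\<^sup>2 \<le> (D * \<mu> ^ N)\<^sup>2 / (1 - \<mu>\<^sup>2)"
        by (rule decays_fock(2)[OF _ \<mu>])
      then have "fock_norm (\<lambda>k. (\<Sum>m<N. trm X m \<psi> k) - pexp X \<psi> k) \<le> sqrt ((D * \<mu> ^ N)\<^sup>2 / (1 - \<mu>\<^sup>2))"
        by (rule real_le_rsqrt)
      also have "\<dots> = D * \<mu> ^ N / sqrt (1 - \<mu>\<^sup>2)" using D \<mu> by (simp add: real_sqrt_divide)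
      finally show "norm (fock_norm (\<lambda>k. (\<Sum>m<N. trm X m \<psi> k) - pexp X \<psi> k)) \<le> D / sqrt (1 - \<mu>\<^sup>2) * \<mu> ^ N" by simp
    qed
    show "(\<lambda>N. D / sqrt (1 - \<mu>\<^sup>2) * \<mu> ^ N) \<longlonglongrightarrow> 0"
      using \<mu> by (intro tendsto_mult_right_zero LIMSEQ_power_zero) simp
  qed
  show ?thesis using 1 2 3 by (simp add: op_exp_def trm_def app_power)
qed

lemma geo_linear:
  assumes "geo X \<phi>" "geo X \<psi>" shows "geo X (\<lambda>k. c * \<phi> k + \<psi> k)"
proof -
  obtain C \<mu> where 1: "0 \<le> C" "0 < \<mu>" "\<mu> < 1" and d1: "\<And>m. decays (C * \<mu> ^ m) \<mu> (trm X m \<phi>)"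
    using assms(1) unfolding geo_def by blast
  obtain D \<nu> where 2: "0 \<le> D" "0 < \<nu>" "\<nu> < 1" and d2: "\<And>m. decays (D * \<nu> ^ m) \<nu> (trm X m \<psi>)"
    using assms(2) unfolding geo_def by blast
  define \<rho> where "\<rho> = max \<mu> \<nu>"
  have \<rho>: "0 < \<rho>" "\<rho> < 1" "\<mu> \<le> \<rho>" "\<nu> \<le> \<rho>" using 1 2 by (auto simp: \<rho>_def)
  have "decays ((cmod c * C + D) * \<rho> ^ m) \<rho> (trm X m (\<lambda>k. c * \<phi> k + \<psi> k))" for m
  proof -
    have "decays (C * \<rho> ^ m) \<rho> (trm X m \<phi>)"
      using 1 \<rho> by (intro decays_mono[OF d1[of m]] mult_left_mono power_mono) auto
    then have a: "decays (cmod c * (C * \<rho> ^ m)) \<rho> (\<lambda>k. c * trm X m \<phi> k)"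
      by (rule decays_scale) (use 1 \<rho> in auto)
    have b: "decays (D * \<rho> ^ m) \<rho> (trm X m \<psi>)"
      using 2 \<rho> by (intro decays_mono[OF d2[of m]] mult_left_mono power_mono) auto
    have "trm X m (\<lambda>k. c * \<phi> k + \<psi> k) = (\<lambda>k. c * trm X m \<phi> k + trm X m \<psi> k)"
      by (simp only: fun_eq_iff trm_linear) simp
    then show ?thesis using decays_add[OF a b] by (simp add: algebra_simps)
  qed
  moreover have "0 \<le> cmod c * C + D" using 1 2 by simp
  ultimately show ?thesis unfolding geo_def using \<rho> by blast
qed

lemma trm_commute: assumes "X * Z = Z * X" shows "trm X m (app Z \<psi>) = app Z (trm X m \<psi>)"
proof -
  have "X ^ m * Z = Z * X ^ m" using assms by (rule power_commuting_commutes)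
  then have "app (X ^ m) (app Z \<psi>) = app Z (app (X ^ m) \<psi>)" by (metis app_basic(4))
  then show ?thesis unfolding fun_eq_iff app_trm by (simp add: trm_def)
qed

lemma geo_cr:
  fixes X :: "('n :: finite) fop"
  assumes "geo X \<psi>" "X * cr i = cr i * X" shows "geo X (app (cr i) \<psi>)"
proof -
  obtain C \<mu> where 1: "0 \<le> C" "0 < \<mu>" "\<mu> < 1" and d1: "\<And>m. decays (C * \<mu> ^ m) \<mu> (trm X m \<psi>)"
    using assms(1) unfolding geo_def by blast
  obtain D \<nu> where 2: "0 < D" "0 < \<nu>" "\<nu> < 1" and d: "\<And>C \<psi> i. 0 \<le> C \<Longrightarrow> decays C \<mu> (\<psi> :: 'n state) \<Longrightarrow>
       decays (D * C) \<nu> \<psi> \<and> decays (D * C) \<nu> (app (an i) \<psi>) \<and> decays (D * C) \<nu> (app (cr i) \<psi>)"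
    using decays_an_cr[OF 1(2,3)] by blast
  define \<rho> where "\<rho> = max \<mu> \<nu>"
  have \<rho>: "0 < \<rho>" "\<rho> < 1" "\<mu> \<le> \<rho>" "\<nu> \<le> \<rho>" using 1 2 by (auto simp: \<rho>_def)
  have "decays ((D * C) * \<rho> ^ m) \<rho> (trm X m (app (cr i) \<psi>))" for m
  proof -
    have "decays (D * (C * \<mu> ^ m)) \<nu> (app (cr i) (trm X m \<psi>))"
      using d[OF _ d1] 1 by simp
    then have "decays (D * (C * \<rho> ^ m)) \<rho> (app (cr i) (trm X m \<psi>))"
      by (rule decays_mono) (use 1 2 \<rho> in \<open>auto intro!: mult_left_mono power_mono\<close>)
    then show ?thesis by (simp add: trm_commute[OF assms(2)] mult.assoc)
  qed
  moreover have "0 \<le> D * C" using 1 2 by simp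
  ultimately show ?thesis unfolding geo_def using \<rho> by blast
qed

definition low :: "nat \<Rightarrow> ('n :: finite) state \<Rightarrow> bool" where
  "low d \<psi> \<longleftrightarrow> (\<forall>k. d \<le> deg k \<longrightarrow> \<psi> k = 0)"

definition lowering :: "('n :: finite) fop \<Rightarrow> bool" where
  "lowering X \<longleftrightarrow> (\<forall>d \<psi>. low d \<psi> \<longrightarrow> low (d - 1) (app X \<psi>))"

lemma lowering_an: "lowering (an i)"
  by (auto simp: lowering_def low_def app_an annih_def deg_upd_Suc)

lemma low_mono: "low d \<psi> \<Longrightarrow> d \<le> d' \<Longrightarrow> low d' \<psi>"
  by (auto simp: low_def)

lemma lowering_mult:
  fixes X Y :: "('n :: finite) fop"
  assumes "lowering X" "lowering Y" shows "lowering (X * Y)"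
  unfolding lowering_def
proof (intro allI impI)
  fix d and \<psi> :: "'n state" assume "low d \<psi>"
  then have "low (d - 1) (app Y \<psi>)" using assms(2) unfolding lowering_def by blast
  then have "low (d - 1 - 1) (app X (app Y \<psi>))" using assms(1) unfolding lowering_def by blast
  then show "low (d - 1) (app (X * Y) \<psi>)" unfolding app_basic by (rule low_mono) simp
qed

lemma lowering_sc_mult: "lowering X \<Longrightarrow> lowering (sc c * X)"
  by (simp add: lowering_def low_def app_basic app_sc)

lemma lowering_add: "lowering X \<Longrightarrow> lowering Y \<Longrightarrow> lowering (X + Y)"
  by (simp add: lowering_def low_def app_basic)

lemma lowering_sum: "(\<And>i. i \<in> S \<Longrightarrow> lowering (X i)) \<Longrightarrow> lowering (sum X S)"
  by (simp add: lowering_def low_def app_sum)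

lemma lowering_trm:
  assumes X: "lowering X" and \<psi>: "fin_supp d \<psi>"
  shows "fin_supp d (trm X m \<psi>)" "d < m \<Longrightarrow> trm X m \<psi> = (\<lambda>k. 0)"
proof -
  have "low (Suc d - m) (app (X ^ m) \<psi>)" for m
  proof (induction m)
    case 0
    then show ?case using \<psi> by (simp add: low_def fin_supp_def app_basic)
  next
    case (Suc m)
    then have "low (Suc d - m - 1) (app X (app (X ^ m) \<psi>))" using X unfolding lowering_def by blast
    then show ?case by (simp add: app_basic)
  qed
  then show "fin_supp d (trm X m \<psi>)" "d < m \<Longrightarrow> trm X m \<psi> = (\<lambda>k. 0)"
    by (auto simp: low_def fin_supp_def trm_def)
qed

lemma lowering_conv: assumes "lowering X" "fin_supp d \<psi>" shows "conv X \<psi>"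
  unfolding conv_def
  by (intro allI summable_finite[of "{..d}"]) (use lowering_trm(2)[OF assms] in auto)

definition num :: "complex^'n^'n \<Rightarrow> ('n :: finite) fop" where
  "num C = (\<Sum>i\<in>UNIV. \<Sum>j\<in>UNIV. sc (C $ i $ j) * (cr i * an j))"

lemma app_num: "app (num C) \<psi> k = (\<Sum>i\<in>UNIV. \<Sum>j\<in>UNIV. C $ i $ j * app (cr i) (app (an j) \<psi>) k)"
  by (simp only: num_def app_sum app_basic app_sc)

lemma sh_cr_an: "sh N (app (cr i) (app (an j) \<psi>)) \<le> real N * sh N \<psi>"
proof (cases N)
  case (Suc M)
  have "sh (Suc M) (app (cr i) (app (an j) \<psi>)) \<le> sqrt (real (Suc M)) * (sqrt (real (Suc M)) * sh (Suc M) \<psi>)"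
    by (rule order_trans[OF sh_cr mult_left_mono[OF sh_an]]) simp
  also have "\<dots> = real (Suc M) * sh (Suc M) \<psi>" by (simp flip: mult.assoc)
  finally show ?thesis by (simp add: Suc)
qed (simp add: sh_cr_0)

lemma sh_num: "sh N (app (num C) \<psi>) \<le> (\<Sum>i\<in>UNIV. \<Sum>j\<in>UNIV. cmod (C $ i $ j)) * real N * sh N \<psi>"
proof -
  have "sh N (app (num C) \<psi>) \<le> (\<Sum>i\<in>UNIV. \<Sum>j\<in>UNIV. sh N (\<lambda>k. C $ i $ j * app (cr i) (app (an j) \<psi>) k))"
    unfolding app_num[abs_def] by (rule order_trans[OF sh_sum sum_mono[OF sh_sum]])
  also have "\<dots> \<le> (\<Sum>i\<in>UNIV. \<Sum>j\<in>UNIV. cmod (C $ i $ j) * (real N * sh N \<psi>))"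
    unfolding sh_scale by (intro sum_mono mult_left_mono sh_cr_an) simp
  finally show ?thesis by (simp add: sum_distrib_right mult.assoc)
qed

lemma cmod_le_sh: "cmod (\<psi> k) \<le> sh (deg k) \<psi>"
  unfolding sh_def by (rule member_le_L2_set) (auto simp: shell_def finite_shell[unfolded shell_def])

lemma sh_num_power:
  obtains q where "0 \<le> q" "\<And>m \<psi>. sh N (app (num C ^ m) \<psi>) \<le> q ^ m * sh N \<psi>"
proof -
  define q where "q = (\<Sum>i\<in>UNIV. \<Sum>j\<in>UNIV. cmod (C $ i $ j)) * real N"
  have q: "0 \<le> q" by (simp add: q_def sum_nonneg)
  have "sh N (app (num C ^ m) \<psi>) \<le> q ^ m * sh N \<psi>" for m \<psi>
  proof (induction m)
    case (Suc m)
    have "sh N (app (num C ^ Suc m) \<psi>) \<le> q * sh N (app (num C ^ m) \<psi>)"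
      using sh_num[of N C "app (num C ^ m) \<psi>"] by (simp add: app_basic q_def)
    also have "\<dots> \<le> q * (q ^ m * sh N \<psi>)" by (rule mult_left_mono[OF Suc.IH q])
    finally show ?case by (simp add: mult.assoc)
  qed (simp add: app_basic)
  then show ?thesis using that q by blast
qed

lemma num_abs_summable: "summable (\<lambda>m. cmod (trm (num C) m \<psi> k))"
proof -
  obtain q where q: "\<And>m \<psi>. sh (deg k) (app (num C ^ m) \<psi>) \<le> q ^ m * sh (deg k) \<psi>"
    by (rule sh_num_power[of "deg k" C]) blast
  have "summable (\<lambda>m. sh (deg k) \<psi> * (q ^ m / fact m))"
    using summable_exp[of q] by (intro summable_mult) (simp add: field_simps)
  then show ?thesis
  proof (rule summable_comparison_test'[of _ 0])
    fix m
    have "cmod (trm (num C) m \<psi> k) = cmod (app (num C ^ m) \<psi> k) / fact m"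
      by (simp add: trm_def norm_divide)
    also have "\<dots> \<le> (q ^ m * sh (deg k) \<psi>) / fact m"
      by (intro divide_right_mono order_trans[OF cmod_le_sh q]) simp
    finally show "norm (cmod (trm (num C) m \<psi> k)) \<le> sh (deg k) \<psi> * (q ^ m / fact m)" by (simp add: mult.commute)
  qed
qed

lemma num_conv: "conv (num C) \<psi>"
  unfolding conv_def by (intro allI) (rule summable_norm_cancel, rule num_abs_summable)

lemma num_fin_supp: "fin_supp d \<psi> \<Longrightarrow> fin_supp d (trm (num C) m \<psi>)"
proof -
  assume \<psi>: "fin_supp d \<psi>"
  have "trm (num C) m \<psi> k = 0" if "d < deg k" for k
  proof -
    obtain q where "\<And>m \<psi>. sh (deg k) (app (num C ^ m) \<psi>) \<le> q ^ m * sh (deg k) \<psi>"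
      by (rule sh_num_power[of "deg k" C]) blast
    moreover have "sh (deg k) \<psi> = 0"
      using \<psi> that by (simp add: sh_def L2_set_def fin_supp_def shell_def)
    ultimately have "sh (deg k) (app (num C ^ m) \<psi>) \<le> 0" by (metis mult_zero_right)
    then have "cmod (app (num C ^ m) \<psi> k) \<le> 0" using cmod_le_sh order_trans by blast
    then show ?thesis by (simp add: trm_def)
  qed
  then show ?thesis by (simp add: fin_supp_def)
qed

lemma abs_summable_app:
  assumes "\<And>k. summable (\<lambda>m. cmod (f m k))" shows "summable (\<lambda>m. cmod (app X (f m) k))"
proof -
  have "summable (\<lambda>m. cmod (g (f m)))" if "finite_functional g" for g
    using that
  proof induction
    case (add g g')
    have "summable (\<lambda>m. cmod (g (f m)) + cmod (g' (f m)))" using add.IH by (rule summable_add)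
    then show ?case by (rule summable_comparison_test'[of _ 0]) (simp add: norm_triangle_ineq)
  next
    case (scale g c)
    then show ?case by (simp add: norm_mult summable_mult)
  qed (use assms in auto)
  from this[OF finite_functional_app] show ?thesis .
qed

lemma trm_num_intertwine:
  fixes b :: "'m :: finite \<Rightarrow> ('n :: finite) fop" and K :: "complex^'m^'m"
  assumes D: "\<And>j. D * b j = b j * D + (\<Sum>i\<in>UNIV. sc (K $ i $ j) * b i)"
  shows "trm D m (app (b j) \<psi>) k = (\<Sum>l\<le>m. \<Sum>i\<in>UNIV. ((1 / fact l) *\<^sub>R mat_pow K l) $ i $ j * app (b i) (trm D (m - l) \<psi>) k)"
proof (induction m arbitrary: k)
  case 0
  have "(\<Sum>i\<in>UNIV. (mat 1 :: complex^'m^'m) $ i $ j * app (b i) \<psi> k) = app (b j) \<psi> k"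
    by (simp add: mat_def if_distrib if_distribR cong: if_cong)
  then show ?case by (simp add: trm_0)
next
  case (Suc m)
  define \<kappa> where "\<kappa> l = (1 / fact l) *\<^sub>R mat_pow K l" for l
  define \<tau> where "\<tau> p = trm D p \<psi>" for p
  have Dt: "app D (\<tau> p) = (\<lambda>k. of_nat (Suc p) * \<tau> (Suc p) k)" for p
    by (simp add: \<tau>_def trm_Suc fun_eq_iff del: of_nat_Suc)
  have Kk: "K ** \<kappa> l = real (Suc l) *\<^sub>R \<kappa> (Suc l)" for l
    by (simp add: \<kappa>_def matrix_ring_simps del: of_nat_Suc)
  have Kk': "(\<Sum>i\<in>UNIV. K $ i' $ i * \<kappa> l $ i $ j) = of_nat (Suc l) * \<kappa> (Suc l) $ i' $ j" for i' l
    using arg_cong[OF Kk, of "\<lambda>X. X $ i' $ j"] 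
    by (simp only: matrix_matrix_mult_def vec_lambda_beta vector_scaleR_component)
      (simp add: scaleR_conv_of_real[where 'a = complex] del: of_nat_Suc)
  define a where "a l p k = (\<Sum>i\<in>UNIV. \<kappa> l $ i $ j * app (b i) (\<tau> p) k)" for l p k
  have Db: "app D (app (b i) (\<tau> p)) k = of_nat (Suc p) * app (b i) (\<tau> (Suc p)) k + (\<Sum>i'\<in>UNIV. K $ i' $ i * app (b i') (\<tau> p) k)" for i p k
  proof -
    have "app (D * b i) (\<tau> p) k = app (b i * D + (\<Sum>i'\<in>UNIV. sc (K $ i' $ i) * b i')) (\<tau> p) k"
      by (simp only: D)
    then show ?thesis by (simp only: app_basic app_sum app_sc Dt app_scale)
  qed
  have Da: "app D (a l p) k = of_nat (Suc p) * a l (Suc p) k + of_nat (Suc l) * a (Suc l) p k" for l p k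
  proof -
    have "app D (a l p) k = (\<Sum>i\<in>UNIV. \<kappa> l $ i $ j * app D (app (b i) (\<tau> p)) k)"
      unfolding a_def[abs_def] by (simp only: app_sum_arg app_scale)
    also have "\<dots> = (\<Sum>i\<in>UNIV. of_nat (Suc p) * (\<kappa> l $ i $ j * app (b i) (\<tau> (Suc p)) k))
        + (\<Sum>i\<in>UNIV. \<Sum>i'\<in>UNIV. K $ i' $ i * \<kappa> l $ i $ j * app (b i') (\<tau> p) k)"
      unfolding Db distrib_left sum.distrib sum_distrib_left by (simp only: mult_ac)
    also have "(\<Sum>i\<in>UNIV. \<Sum>i'\<in>UNIV. K $ i' $ i * \<kappa> l $ i $ j * app (b i') (\<tau> p) k)
        = (\<Sum>i'\<in>UNIV. (\<Sum>i\<in>UNIV. K $ i' $ i * \<kappa> l $ i $ j) * app (b i') (\<tau> p) k)"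
      by (subst sum.swap) (simp only: sum_distrib_right)
    finally show ?thesis
      unfolding Kk' a_def by (simp only: sum_distrib_left mult.assoc)
  qed
  have IH: "trm D m (app (b j) \<psi>) = (\<lambda>k. \<Sum>l\<le>m. a l (m - l) k)"
    by (simp add: fun_eq_iff Suc.IH a_def \<kappa>_def \<tau>_def)
  have "app D (trm D m (app (b j) \<psi>)) k = (\<Sum>l\<le>m. of_nat (Suc (m - l)) * a l (Suc (m - l)) k + of_nat (Suc l) * a (Suc l) (m - l) k)"
    unfolding IH by (simp only: app_sum_arg Da)
  also have "\<dots> = (\<Sum>l\<le>m. of_nat (Suc m - l) * a l (Suc m - l) k) + (\<Sum>l\<le>m. of_nat (Suc l) * a (Suc l) (Suc m - Suc l) k)"
    unfolding sum.distrib by (intro arg_cong2[of _ _ _ _ "(+)"] sum.cong refl) (simp_all add: Suc_diff_le)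
  also have "(\<Sum>l\<le>m. of_nat (Suc m - l) * a l (Suc m - l) k) = (\<Sum>l\<le>Suc m. of_nat (Suc m - l) * a l (Suc m - l) k)"
    by simp
  also have "(\<Sum>l\<le>m. of_nat (Suc l) * a (Suc l) (Suc m - Suc l) k) = (\<Sum>l\<le>Suc m. of_nat l * a l (Suc m - l) k)"
    by (simp only: sum.atMost_Suc_shift of_nat_0 mult_zero_left add_0_left)
  also have "(\<Sum>l\<le>Suc m. of_nat (Suc m - l) * a l (Suc m - l) k) + (\<Sum>l\<le>Suc m. of_nat l * a l (Suc m - l) k)
      = (\<Sum>l\<le>Suc m. of_nat (Suc m) * a l (Suc m - l) k)"
    unfolding sum.distrib[symmetric] by (intro sum.cong refl) (simp flip: distrib_right of_nat_add)
  finally have "app D (trm D m (app (b j) \<psi>)) k = of_nat (Suc m) * (\<Sum>l\<le>Suc m. a l (Suc m - l) k)"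
    by (simp only: sum_distrib_left)
  then have "trm D (Suc m) (app (b j) \<psi>) k = (\<Sum>l\<le>Suc m. a l (Suc m - l) k)"
    by (simp add: trm_Suc del: of_nat_Suc)
  then show ?case by (simp only: a_def \<kappa>_def \<tau>_def)
qed

lemma pexp_num_intertwine:
  fixes b :: "'m :: finite \<Rightarrow> ('n :: finite) fop" and K :: "complex^'m^'m"
  assumes "\<And>j. num C * b j = b j * num C + (\<Sum>i\<in>UNIV. sc (K $ i $ j) * b i)"
  shows "pexp (num C) (app (b j) \<psi>) k = (\<Sum>i\<in>UNIV. mat_exp K $ i $ j * app (b i) (pexp (num C) \<psi>) k)"
proof -
  define a where "a i l = ((1 / fact l) *\<^sub>R mat_pow K l) $ i $ j" for i l
  define t where "t i p = app (b i) (trm (num C) p \<psi>) k" for i p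
  have a_sums: "a i sums (mat_exp K $ i $ j)" for i
    unfolding a_def using bounded_linear.sums[OF bounded_linear_entry mat_exp_sums[of K], of i j] by simp
  have a_abs: "summable (\<lambda>l. norm (a i l))" for i
  proof -
    obtain L r where Lr: "L > 0" "r > 0" "\<And>l. norm (mat_pow K l) \<le> L * r ^ l"
      using norm_mat_pow_bound[of K] by blast
    have "summable (\<lambda>l. L * (r ^ l / fact l))"
      using summable_exp[of r] by (intro summable_mult) (simp add: field_simps)
    then show ?thesis
    proof (rule summable_comparison_test'[of _ 0])
      fix l
      have "norm (mat_pow K l $ i $ j) \<le> norm (mat_pow K l)"
        by (rule order_trans[OF Finite_Cartesian_Product.norm_nth_le Finite_Cartesian_Product.norm_nth_le])
      also have "\<dots> \<le> L * r ^ l" by (rule Lr)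
      finally have "norm (mat_pow K l $ i $ j) / fact l \<le> L * r ^ l / fact l" by (rule divide_right_mono) simp
      then show "norm (norm (a i l)) \<le> L * (r ^ l / fact l)" by (simp add: a_def)
    qed
  qed
  have t_sums: "t i sums app (b i) (pexp (num C) \<psi>) k" for i
    unfolding t_def by (rule app_sums[OF conv_sums[OF num_conv]])
  have t_abs: "summable (\<lambda>p. norm (t i p))" for i
    unfolding t_def by (rule abs_summable_app[OF num_abs_summable])
  have "(\<lambda>m. \<Sum>l\<le>m. a i l * t i (m - l)) sums (mat_exp K $ i $ j * app (b i) (pexp (num C) \<psi>) k)" for i
    using Cauchy_product_sums[OF a_abs[of i] t_abs[of i]] by (simp only: sums_unique[OF a_sums, symmetric] sums_unique[OF t_sums, symmetric])
  then have "(\<lambda>m. \<Sum>i\<in>UNIV. \<Sum>l\<le>m. a i l * t i (m - l)) sums (\<Sum>i\<in>UNIV. mat_exp K $ i $ j * app (b i) (pexp (num C) \<psi>) k)"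
    by (intro sums_sum) 
  moreover have "(\<Sum>i\<in>UNIV. \<Sum>l\<le>m. a i l * t i (m - l)) = trm (num C) m (app (b j) \<psi>) k" for m
    unfolding trm_num_intertwine[OF assms] a_def t_def by (rule sum.swap)
  ultimately have "(\<lambda>m. trm (num C) m (app (b j) \<psi>) k) sums (\<Sum>i\<in>UNIV. mat_exp K $ i $ j * app (b i) (pexp (num C) \<psi>) k)"
    by simp
  then show ?thesis unfolding pexp_def[of "num C" "app (b j) \<psi>"] by (rule sums_unique[symmetric])
qed

section \<open>Linear fields and the evolution of the vacuum\<close>

definition lin :: "complex^'n \<Rightarrow> ('n :: finite) fop" where
  "lin v = (\<Sum>i\<in>UNIV. sc (v $ i) * cr i)"

definition quad :: "complex^'n^'n \<Rightarrow> ('n :: finite) fop" where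
  "quad M = (\<Sum>i\<in>UNIV. \<Sum>j\<in>UNIV. sc (M $ i $ j) * (cr i * cr j))"

definition fld :: "complex^'n \<Rightarrow> complex^'n \<Rightarrow> complex \<Rightarrow> ('n :: finite) fop" where
  "fld p q z = (\<Sum>i\<in>UNIV. sc (p $ i) * an i) + (\<Sum>i\<in>UNIV. sc (q $ i) * cr i) + sc z"

lemma app_lin: "app (lin v) \<psi> k = (\<Sum>i\<in>UNIV. v $ i * app (cr i) \<psi> k)"
  by (simp only: lin_def app_sum app_basic app_sc)

lemma app_quad: "app (quad M) \<psi> k = (\<Sum>i\<in>UNIV. \<Sum>j\<in>UNIV. M $ i $ j * app (cr i) (app (cr j) \<psi>) k)"
  by (simp only: quad_def app_sum app_basic app_sc)

lemma app_fld: "app (fld p q z) \<psi> k =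
    (\<Sum>i\<in>UNIV. p $ i * app (an i) \<psi> k) + (\<Sum>i\<in>UNIV. q $ i * app (cr i) \<psi> k) + z * \<psi> k"
  by (simp only: fld_def app_sum app_basic app_sc)

definition comm :: "'a :: ring_1 \<Rightarrow> 'a \<Rightarrow> 'a" where "comm X Y = X * Y - Y * X"

lemma comm_simps:
  "comm (X + Y) Z = comm X Z + comm Y Z" "comm (X * Y) Z = X * comm Y Z + comm X Z * Y"
  "comm Z (X + Y) = comm Z X + comm Z Y"
  by (simp_all add: comm_def algebra_simps)

lemma comm_sum: "comm (sum f S) Z = (\<Sum>i\<in>S. comm (f i) Z)" "comm Z (sum f S) = (\<Sum>i\<in>S. comm Z (f i))"
  by (simp_all add: comm_def sum_distrib_left sum_distrib_right sum_subtractf)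

lemma comm_sc: "comm (sc c * X) Z = sc c * comm X Z" "comm Z (sc c * X) = sc c * comm Z X" "comm Z (sc c) = 0"
  "comm (sc c) Z = 0"
  unfolding comm_def
  by (simp_all only: sc_left_commute[of Z c X] mult.assoc right_diff_distrib sc_commute[of _ c] diff_self)

lemma comm_an_cr: "comm (an i) (an j) = 0" "comm (cr i) (cr j) = 0"
  "comm (an i) (cr j) = sc (if i = j then 1 else 0)" "comm (cr i) (an j) = sc (if i = j then - 1 else 0)"
  by (simp_all add: comm_def an_an[of i j] cr_cr[of i j] an_cr sc_minus)

lemma sum_sc_delta:
  fixes f :: "'m :: finite \<Rightarrow> complex"
  shows "(\<Sum>i\<in>UNIV. sc (f i) * (X i * sc (if i = j then c else 0))) = sc (c * f j) * X j"
    "(\<Sum>i\<in>UNIV. sc (f i) * (sc (if i = j then c else 0) * X i)) = sc (c * f j) * X j"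
proof -
  have "(\<Sum>i\<in>UNIV. sc (f i) * (X i * sc (if i = j then c else 0))) = (\<Sum>i\<in>UNIV. if i = j then sc (c * f j) * X j else 0)"
  proof (intro sum.cong refl)
    fix i
    have "sc (f j) * (X j * sc c) = sc (f j) * sc c * X j"
      by (simp only: sc_commute[of "X j"] mult.assoc)
    also have "\<dots> = sc (c * f j) * X j" by (simp only: sc_mult[symmetric] mult.commute[of c])
    finally show "sc (f i) * (X i * sc (if i = j then c else 0)) = (if i = j then sc (c * f j) * X j else 0)" by auto
  qed
  then show 1: "(\<Sum>i\<in>UNIV. sc (f i) * (X i * sc (if i = j then c else 0))) = sc (c * f j) * X j" by simp
  then show "(\<Sum>i\<in>UNIV. sc (f i) * (sc (if i = j then c else 0) * X i)) = sc (c * f j) * X j"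
    by (simp only: sc_commute[of "X _", symmetric])
qed

lemma sum_sc_delta':
  fixes f :: "'m :: finite \<Rightarrow> complex"
  shows "(\<Sum>i\<in>UNIV. sc (f i) * sc (if i = j then c else 0)) = sc (c * f j)"
  using sum_sc_delta(1)[of f "\<lambda>_. 1" j c] by simp

lemma vec_nth_has_derivative: "(v has_vector_derivative v') F \<Longrightarrow> ((\<lambda>t. v t $ i) has_vector_derivative v' $ i) F"
  for v :: "real \<Rightarrow> 'a :: euclidean_space ^ 'm"
  by (rule bounded_linear.has_vector_derivative[OF bounded_linear_vec_nth])

lemma oder_fld:
  assumes "(p has_vector_derivative p') (at t)" "(q has_vector_derivative q') (at t)" "(z has_vector_derivative z') (at t)"
  shows "oder (\<lambda>t. fld (p t) (q t) (z t)) (fld p' q' z') t"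
  unfolding fld_def
  by (intro oder_add oder_sum oder_sc_mult oder_sc vec_nth_has_derivative assms)

context squeezing
begin

abbreviation "K \<equiv> gen A B h"

lemma A_swap: "A $ i $ j = A $ j $ i"
  using A_sym by (auto simp: vec_eq_iff transpose_def)

lemma comm_K_an: "comm K (an j) = fld (Bm $ j) (A $ j) (h $ j)"
proof -
  have 1: "comm (\<Sum>i\<in>UNIV. \<Sum>l\<in>UNIV. sc (- A $ i $ l / 2) * (cr i * cr l)) (an j) = (\<Sum>i\<in>UNIV. sc (A $ j $ i) * cr i)"
  proof -
    have "comm (\<Sum>i\<in>UNIV. \<Sum>l\<in>UNIV. sc (- A $ i $ l / 2) * (cr i * cr l)) (an j)
      = (\<Sum>i\<in>UNIV. \<Sum>l\<in>UNIV. sc (- A $ i $ l / 2) * (cr i * sc (if l = j then - 1 else 0)))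
        + (\<Sum>i\<in>UNIV. \<Sum>l\<in>UNIV. sc (- A $ i $ l / 2) * (sc (if i = j then - 1 else 0) * cr l))"
      by (simp only: comm_sum comm_sc comm_simps comm_an_cr distrib_left sum.distrib
          mult_zero_left sum.neutral_const add_0_right)
    also have "(\<Sum>i\<in>UNIV. \<Sum>l\<in>UNIV. sc (- A $ i $ l / 2) * (cr i * sc (if l = j then - 1 else 0)))
        = (\<Sum>i\<in>UNIV. sc (-1 * (- A $ i $ j / 2)) * cr i)"
      by (intro sum.cong refl) (rule sum_sc_delta(1)[where X = "\<lambda>_. cr _"])
    also have "(\<Sum>i\<in>UNIV. \<Sum>l\<in>UNIV. sc (- A $ i $ l / 2) * (sc (if i = j then - 1 else 0) * cr l))
        = (\<Sum>l\<in>UNIV. sc (-1 * (- A $ j $ l / 2)) * cr l)"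
      by (subst sum.swap) (intro sum.cong refl sum_sc_delta(2)[where X = "\<lambda>_. cr _"])
    finally show ?thesis
      by (simp add: A_swap[of _ j] flip: sum.distrib distrib_right sc_add)
  qed
  have 2: "comm (\<Sum>i\<in>UNIV. \<Sum>l\<in>UNIV. sc (cnj (A $ i $ l) / 2) * (an i * an l)) (an j) = 0"
    by (simp only: comm_sum comm_sc comm_simps comm_an_cr) simp
  have 3: "comm (\<Sum>i\<in>UNIV. \<Sum>l\<in>UNIV. sc (\<i> * B $ i $ l) * (cr i * an l)) (an j) = (\<Sum>l\<in>UNIV. sc (Bm $ j $ l) * an l)"
  proof -
    have "comm (\<Sum>i\<in>UNIV. \<Sum>l\<in>UNIV. sc (\<i> * B $ i $ l) * (cr i * an l)) (an j)
      = (\<Sum>i\<in>UNIV. \<Sum>l\<in>UNIV. sc (\<i> * B $ i $ l) * (sc (if i = j then - 1 else 0) * an l))"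
      by (simp only: comm_sum comm_sc comm_simps comm_an_cr mult_zero_left mult_zero_right add_0_left add_0_right)
    also have "\<dots> = (\<Sum>l\<in>UNIV. sc (-1 * (\<i> * B $ j $ l)) * an l)"
      by (subst sum.swap) (intro sum.cong refl sum_sc_delta(2)[where X = "\<lambda>_. an _"])
    finally show ?thesis by (simp add: Bm_def)
  qed
  have 4: "comm (\<Sum>i\<in>UNIV. sc (- h $ i) * cr i) (an j) = sc (h $ j)"
    by (simp only: comm_sum comm_sc comm_an_cr sum_sc_delta') simp
  have 5: "comm (\<Sum>i\<in>UNIV. sc (cnj (h $ i)) * an i) (an j) = 0"
    by (simp only: comm_sum comm_sc comm_an_cr) simp
  show ?thesis
    unfolding gen_def comm_simps(1) 1 2 3 4 5 fld_def by (simp add: add_ac)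
qed

lemma comm_K_cr: "comm K (cr j) = fld (cnj_mat A $ j) (cnj_mat Bm $ j) (cnj (h $ j))"
proof -
  have 1: "comm (\<Sum>i\<in>UNIV. \<Sum>l\<in>UNIV. sc (cnj (A $ i $ l) / 2) * (an i * an l)) (cr j) = (\<Sum>i\<in>UNIV. sc (cnj_mat A $ j $ i) * an i)"
  proof -
    have "comm (\<Sum>i\<in>UNIV. \<Sum>l\<in>UNIV. sc (cnj (A $ i $ l) / 2) * (an i * an l)) (cr j)
      = (\<Sum>i\<in>UNIV. \<Sum>l\<in>UNIV. sc (cnj (A $ i $ l) / 2) * (an i * sc (if l = j then 1 else 0)))
        + (\<Sum>i\<in>UNIV. \<Sum>l\<in>UNIV. sc (cnj (A $ i $ l) / 2) * (sc (if i = j then 1 else 0) * an l))"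
      by (simp only: comm_sum comm_sc comm_simps comm_an_cr distrib_left sum.distrib
          mult_zero_left sum.neutral_const add_0_right)
    also have "(\<Sum>i\<in>UNIV. \<Sum>l\<in>UNIV. sc (cnj (A $ i $ l) / 2) * (an i * sc (if l = j then 1 else 0)))
        = (\<Sum>i\<in>UNIV. sc (1 * (cnj (A $ i $ j) / 2)) * an i)"
      by (intro sum.cong refl) (rule sum_sc_delta(1)[where X = "\<lambda>_. an _"])
    also have "(\<Sum>i\<in>UNIV. \<Sum>l\<in>UNIV. sc (cnj (A $ i $ l) / 2) * (sc (if i = j then 1 else 0) * an l))
        = (\<Sum>l\<in>UNIV. sc (1 * (cnj (A $ j $ l) / 2)) * an l)"
      by (subst sum.swap) (intro sum.cong refl sum_sc_delta(2)[where X = "\<lambda>_. an _"])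
    finally show ?thesis
      by (simp add: A_swap[of _ j] flip: sum.distrib distrib_right sc_add)
  qed
  have 2: "comm (\<Sum>i\<in>UNIV. \<Sum>l\<in>UNIV. sc (- A $ i $ l / 2) * (cr i * cr l)) (cr j) = 0"
    by (simp only: comm_sum comm_sc comm_simps comm_an_cr) simp
  have Bs: "\<i> * B $ i $ j = cnj_mat Bm $ j $ i" for i
    using B_herm by (auto simp: vec_eq_iff transpose_def Bm_def)
  have 3: "comm (\<Sum>i\<in>UNIV. \<Sum>l\<in>UNIV. sc (\<i> * B $ i $ l) * (cr i * an l)) (cr j) = (\<Sum>l\<in>UNIV. sc (cnj_mat Bm $ j $ l) * cr l)"
  proof -
    have "comm (\<Sum>i\<in>UNIV. \<Sum>l\<in>UNIV. sc (\<i> * B $ i $ l) * (cr i * an l)) (cr j)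
      = (\<Sum>i\<in>UNIV. \<Sum>l\<in>UNIV. sc (\<i> * B $ i $ l) * (cr i * sc (if l = j then 1 else 0)))"
      by (simp only: comm_sum comm_sc comm_simps comm_an_cr mult_zero_left mult_zero_right add_0_left add_0_right)
    also have "\<dots> = (\<Sum>i\<in>UNIV. sc (1 * (\<i> * B $ i $ j)) * cr i)"
      by (intro sum.cong refl sum_sc_delta(1)[where X = "\<lambda>_. cr _"])
    finally show ?thesis by (simp only: Bs mult_1_left)
  qed
  have 4: "comm (\<Sum>i\<in>UNIV. sc (- h $ i) * cr i) (cr j) = 0"
    by (simp only: comm_sum comm_sc comm_an_cr) simp
  have 5: "comm (\<Sum>i\<in>UNIV. sc (cnj (h $ i)) * an i) (cr j) = sc (cnj (h $ j))"
    by (simp only: comm_sum comm_sc comm_an_cr sum_sc_delta') simp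
  show ?thesis
    unfolding gen_def comm_simps(1) 1 2 3 4 5 fld_def by (simp add: add_ac)
qed

lemma comm_K_fld:
  "comm K (fld p q z) = fld (p v* Bm + q v* cnj_mat A) (p v* A + q v* cnj_mat Bm)
     ((\<Sum>j\<in>UNIV. p $ j * h $ j) + (\<Sum>j\<in>UNIV. q $ j * cnj (h $ j)))"
proof -
  have *: "comm K (fld p q z) = (\<Sum>j\<in>UNIV. sc (p $ j) * fld (Bm $ j) (A $ j) (h $ j))
      + (\<Sum>j\<in>UNIV. sc (q $ j) * fld (cnj_mat A $ j) (cnj_mat Bm $ j) (cnj (h $ j)))"
    by (simp only: fld_def[of p q z] comm_simps comm_sum comm_sc comm_K_an comm_K_cr add_0_right)
  show ?thesis
    by (rule fop_eqI)
       (simp only: * app_basic app_sum app_sc app_fld distrib_left sum.distrib sum_vector_matrix vector_add_component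
          distrib_right sum_distrib_right mult.assoc add_ac)
qed

lemma fld_flow:
  assumes p: "\<And>t. (p has_vector_derivative p t v* Bm + q t v* cnj_mat A) (at t)"
    and q: "\<And>t. (q has_vector_derivative p t v* A + q t v* cnj_mat Bm) (at t)"
    and z: "\<And>t. (z has_vector_derivative (\<Sum>j\<in>UNIV. p t $ j * h $ j) + (\<Sum>j\<in>UNIV. q t $ j * cnj (h $ j))) (at t)"
    and w: "pder w w' t"
  shows "pder (\<lambda>t. app (fld (p t) (q t) (z t)) (w t))
    (\<lambda>k. app (fld (p t) (q t) (z t)) (\<lambda>k. w' k - app K (w t) k) k + app K (app (fld (p t) (q t) (z t)) (w t)) k) t"
proof -
  have "app (comm K (fld (p t) (q t) (z t))) (w t) k =
      app K (app (fld (p t) (q t) (z t)) (w t)) k - app (fld (p t) (q t) (z t)) (app K (w t)) k" for k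
    by (simp add: comm_def app_diff app_basic)
  then have eq: "app (fld (p t) (q t) (z t)) w' k + app (comm K (fld (p t) (q t) (z t))) (w t) k
     = app (fld (p t) (q t) (z t)) (\<lambda>k. w' k - app K (w t) k) k + app K (app (fld (p t) (q t) (z t)) (w t)) k" for k
    by (simp add: app_minus_arg)
  have "oder (\<lambda>t. fld (p t) (q t) (z t)) (comm K (fld (p t) (q t) (z t))) t"
    unfolding comm_K_fld by (intro oder_fld p q z)
  then have "pder (\<lambda>t. app (fld (p t) (q t) (z t)) (w t))
    (\<lambda>k. app (fld (p t) (q t) (z t)) w' k + app (comm K (fld (p t) (q t) (z t))) (w t) k) t"
    using w unfolding oder_def by blast
  then show ?thesis by (simp only: eq)
qed

text \<open>\<open>\<beta>\<close> and \<open>b\<close> are the conjugates \<open>U\<^sub>t a U\<^sub>t\<^sup>-\<^sup>1\<close> and \<open>U\<^sub>t a\<^sup>\<dagger> U\<^sub>t\<^sup>-\<^sup>1\<close>.\<close>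

definition "\<beta> l t = fld (\<Phi> t $ l) (\<Psi> t $ l) (hp t $ l)"
definition "b l t = fld (cnj_mat (\<Psi> t) $ l) (cnj_mat (\<Phi> t) $ l) (cnj (hp t $ l))"

lemma beta_b_pder:
  assumes "pder w w' t"
  shows "pder (\<lambda>t. app (\<beta> l t) (w t)) (\<lambda>k. app (\<beta> l t) (\<lambda>k. w' k - app K (w t) k) k + app K (app (\<beta> l t) (w t)) k) t"
    and "pder (\<lambda>t. app (b l t) (w t)) (\<lambda>k. app (b l t) (\<lambda>k. w' k - app K (w t) k) k + app K (app (b l t) (w t)) k) t"
proof -
  have \<Phi>: "((\<lambda>t. \<Phi> t $ l) has_vector_derivative \<Phi> t $ l v* Bm + \<Psi> t $ l v* cnj_mat A) (at t)"
    and \<Psi>: "((\<lambda>t. \<Psi> t $ l) has_vector_derivative \<Phi> t $ l v* A + \<Psi> t $ l v* cnj_mat Bm) (at t)" for t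
    using vec_nth_has_derivative[OF Phi_Psi_has_vector_derivative(1), of l t]
      vec_nth_has_derivative[OF Phi_Psi_has_vector_derivative(2), of l t]
    by (simp_all only: vector_add_component row_mult)
  have hd: "((\<lambda>t. hp t $ l) has_vector_derivative (\<Sum>j\<in>UNIV. \<Phi> t $ l $ j * h $ j) + (\<Sum>j\<in>UNIV. \<Psi> t $ l $ j * cnj (h $ j))) (at t)" for t
    using vec_nth_has_derivative[OF h_path_has_vector_derivative, of l t] by (simp add: matrix_vector_mult_def)
  have cj: "bounded_linear (\<lambda>v :: complex^'n. cnj_vec v)"
    by (rule linear_conv_bounded_linear[THEN iffD1], rule linearI) (auto simp: vec_eq_iff)
  have row: "cnj_mat X $ l = cnj_vec (X $ l)" for X :: "complex^'n^'n" by (simp add: vec_eq_iff)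
  have cv: "cnj_vec (x v* Y) = cnj_vec x v* cnj_mat Y" for x and Y :: "complex^'n^'n"
    by (simp add: vec_eq_iff vector_matrix_mult_def)
  have \<Phi>': "((\<lambda>t. cnj_mat (\<Phi> t) $ l) has_vector_derivative cnj_mat (\<Psi> t) $ l v* A + cnj_mat (\<Phi> t) $ l v* cnj_mat Bm) (at t)"
    and \<Psi>': "((\<lambda>t. cnj_mat (\<Psi> t) $ l) has_vector_derivative cnj_mat (\<Psi> t) $ l v* Bm + cnj_mat (\<Phi> t) $ l v* cnj_mat A) (at t)" for t
    using bounded_linear.has_vector_derivative[OF cj \<Phi>, of t] bounded_linear.has_vector_derivative[OF cj \<Psi>, of t]
    by (simp_all only: row cv cnj_vec_simps cnj_mat_simps add.commute)
  have hd': "((\<lambda>t. cnj (hp t $ l)) has_vector_derivative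
      (\<Sum>j\<in>UNIV. cnj_mat (\<Psi> t) $ l $ j * h $ j) + (\<Sum>j\<in>UNIV. cnj_mat (\<Phi> t) $ l $ j * cnj (h $ j))) (at t)" for t
    using bounded_linear.has_vector_derivative[OF bounded_linear_cnj hd, of t] by (simp add: add.commute)
  show "pder (\<lambda>t. app (\<beta> l t) (w t)) (\<lambda>k. app (\<beta> l t) (\<lambda>k. w' k - app K (w t) k) k + app K (app (\<beta> l t) (w t)) k) t"
    unfolding \<beta>_def by (rule fld_flow[OF \<Phi> \<Psi> hd assms])
  show "pder (\<lambda>t. app (b l t) (w t)) (\<lambda>k. app (b l t) (\<lambda>k. w' k - app K (w t) k) k + app K (app (b l t) (w t)) k) t"
    unfolding b_def by (rule fld_flow[OF \<Psi>' \<Phi>' hd' assms])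
qed

end

lemma comm_mult_right: "comm Z (X * Y) = comm Z X * Y + X * comm Z Y"
  by (simp add: comm_def algebra_simps)

lemma comm_an_lin: "comm (an l) (lin v) = sc (v $ l)"
  unfolding lin_def comm_sum comm_sc comm_an_cr eq_commute[of l] sum_sc_delta' by simp

lemma comm_an_quad: "comm (an l) (quad M) = lin (M $ l) + lin (transpose M $ l)"
proof -
  have "comm (an l) (quad M) = (\<Sum>i\<in>UNIV. \<Sum>j\<in>UNIV. sc (M $ i $ j) * (sc (if i = l then 1 else 0) * cr j))
      + (\<Sum>i\<in>UNIV. \<Sum>j\<in>UNIV. sc (M $ i $ j) * (cr i * sc (if j = l then 1 else 0)))"
    unfolding quad_def comm_sum comm_sc comm_mult_right comm_an_cr distrib_left sum.distrib eq_commute[of l] by simp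
  also have "(\<Sum>i\<in>UNIV. \<Sum>j\<in>UNIV. sc (M $ i $ j) * (sc (if i = l then 1 else 0) * cr j)) = (\<Sum>j\<in>UNIV. sc (1 * M $ l $ j) * cr j)"
    by (subst sum.swap) (intro sum.cong refl sum_sc_delta(2)[where X = "\<lambda>_. cr _"])
  also have "(\<Sum>i\<in>UNIV. \<Sum>j\<in>UNIV. sc (M $ i $ j) * (cr i * sc (if j = l then 1 else 0))) = (\<Sum>i\<in>UNIV. sc (1 * M $ i $ l) * cr i)"
    by (intro sum.cong refl sum_sc_delta(1)[where X = "\<lambda>_. cr _"])
  finally show ?thesis by (simp add: lin_def transpose_def)
qed

lemma comm_cr_lin: "comm (cr l) (lin v) = 0"
  unfolding lin_def comm_sum comm_sc comm_an_cr by simp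

lemma comm_cr_quad: "comm (cr l) (quad M) = 0"
  unfolding quad_def comm_sum comm_sc comm_mult_right comm_an_cr by simp

lemma comm_lin_left: "(\<And>l. comm (cr l) Z = 0) \<Longrightarrow> comm (lin v) Z = 0"
  unfolding lin_def comm_sum comm_sc by simp

lemma lin_add: "lin (u + v) = lin u + lin v"
  by (simp add: lin_def sc_add distrib_right sum.distrib)

lemma raising_quad: "raising (quad M)" and raising_lin: "raising (lin v)"
  unfolding quad_def lin_def by (intro raising_sum raising_sc_mult raising_mult raising_cr)+

lemma oder_lin: "(v has_vector_derivative v') (at t) \<Longrightarrow> oder (\<lambda>t. lin (v t)) (lin v') t"
  unfolding lin_def by (intro oder_sum oder_sc_mult vec_nth_has_derivative)

lemma oder_quad: "(M has_vector_derivative M') (at t) \<Longrightarrow> oder (\<lambda>t. quad (M t)) (quad M') t"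
  unfolding quad_def by (intro oder_sum oder_sc_mult vec_nth_has_derivative)

lemma oder_power_ex: "oder X X' t \<Longrightarrow> \<exists>D. oder (\<lambda>t. X t ^ m) D t"
proof (induction m)
  case 0
  show ?case using oder_const[of 1 t] by auto
next
  case (Suc m)
  then obtain D where "oder (\<lambda>t. X t ^ m) D t" by blast
  from oder_mult[OF Suc.prems this] show ?case by auto
qed

lemma pder_const: "pder (\<lambda>t. \<psi>) (\<lambda>k. 0) t"
  by (simp add: pder_def)

lemma vac_0: "vac (\<lambda>_. 0) = 1" by (simp add: vac_def)

lemma shell_0: "shell 0 = {\<lambda>_. 0}" by (auto simp: shell_def deg_eq_0)

context squeezing
begin

definition "Xo t = quad ((- 1 / 2) *\<^sub>R R t) + lin (- g t)"
definition "co l t = lin (- (R t $ l)) + sc (- g t $ l)"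
definition "\<eta> t = pexp (Xo t) vac"

lemma app_co: "app (co l t) \<psi> k = - (\<Sum>j\<in>UNIV. R t $ l $ j * app (cr j) \<psi> k) - g t $ l * \<psi> k"
  by (simp add: co_def app_basic app_lin app_sc sum_negf)

lemma an_Xo: "an l * Xo t = Xo t * an l + co l t"
proof -
  have T: "transpose ((- 1 / 2) *\<^sub>R R t) = (- 1 / 2) *\<^sub>R R t" by (simp only: transpose_scalar R_sym)
  have "((- 1 / 2) *\<^sub>R R t) $ l + ((- 1 / 2) *\<^sub>R R t) $ l = - (R t $ l)"
    by (simp add: vec_eq_iff)
  then have "comm (an l) (Xo t) = co l t"
    unfolding Xo_def co_def comm_simps comm_an_quad comm_an_lin T lin_add[symmetric] by simp
  then show ?thesis by (simp add: comm_def algebra_simps)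
qed

lemma cr_Xo: "cr l * Xo t = Xo t * cr l"
proof -
  have "comm (cr l) (Xo t) = 0" unfolding Xo_def comm_simps comm_cr_quad comm_cr_lin by simp
  then show ?thesis by (simp add: comm_def)
qed

lemma co_Xo: "co l t * Xo t = Xo t * co l t"
proof -
  have "comm (cr l) (Xo t) = 0" for l by (simp add: comm_def cr_Xo)
  from comm_lin_left[OF this] have "comm (co l t) (Xo t) = 0"
    unfolding co_def comm_simps(1) comm_sc by simp
  then show ?thesis by (simp add: comm_def)
qed

lemma raising_Xo: "raising (Xo t)"
  unfolding Xo_def by (intro raising_add raising_quad raising_lin)

lemma an_eta: "app (an l) (\<eta> t) k = app (co l t) (\<eta> t) k"
  using pexp_intertwine[OF an_Xo co_Xo raising_conv[OF raising_Xo] raising_conv[OF raising_Xo], of l t vac k]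
  by (simp add: \<eta>_def an_vac pexp_zero)

lemma eta_0: "\<eta> t (\<lambda>_. 0) = 1"
  unfolding \<eta>_def using raising_pexp[OF raising_Xo, of "\<lambda>_. 0" 0] by (simp add: deg_zero trm_0 vac_0)

lemma eta_time_0: "\<eta> 0 = vac"
proof -
  have "Xo 0 = 0" by (simp add: Xo_def R_0 g_0 quad_def lin_def)
  then have "trm (Xo 0) (Suc m) vac k = 0" for m k by (simp add: trm_def app_basic)
  then show ?thesis
    unfolding \<eta>_def by (intro ext) (simp add: raising_pexp[OF raising_Xo order_refl] sum.atMost_shift trm_0)
qed

lemma beta_eq: "app (\<beta> l t) \<psi> k = (\<Sum>j\<in>UNIV. \<Phi> t $ l $ j * (app (an j) \<psi> k - app (co j t) \<psi> k))"
proof -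
  have 1: "\<Psi> t = \<Phi> t ** R t" by (simp add: R_eq matrix_mul_assoc Phi_inverse)
  have "\<Phi> t *v g t = hp t" by (simp add: g_eq matrix_vector_mul_assoc Phi_inverse)
  then have 2: "hp t $ l = (\<Sum>j\<in>UNIV. \<Phi> t $ l $ j * g t $ j)"
    by (simp add: matrix_vector_mult_def vec_eq_iff)
  have "app (\<beta> l t) \<psi> k = (\<Sum>j\<in>UNIV. \<Phi> t $ l $ j * app (an j) \<psi> k)
      + (\<Sum>j\<in>UNIV. \<Phi> t $ l $ j * (\<Sum>m\<in>UNIV. R t $ j $ m * app (cr m) \<psi> k)) + (\<Sum>j\<in>UNIV. \<Phi> t $ l $ j * g t $ j) * \<psi> k"
    unfolding \<beta>_def app_fld 2 unfolding 1 sum_vector_matrix row_mult[symmetric] ..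
  moreover have "\<Phi> t $ l $ j * (app (an j) \<psi> k - app (co j t) \<psi> k) = \<Phi> t $ l $ j * app (an j) \<psi> k
      + \<Phi> t $ l $ j * (\<Sum>m\<in>UNIV. R t $ j $ m * app (cr m) \<psi> k) + \<Phi> t $ l $ j * g t $ j * \<psi> k" for j
    unfolding app_co by (simp only: right_diff_distrib mult_minus_right diff_minus_eq_add diff_diff_eq2 mult.assoc add.assoc)
      (simp only: distrib_left mult.assoc add_ac)
  ultimately show ?thesis by (simp only: sum.distrib sum_distrib_right)
qed

lemma beta_zero_imp:
  assumes "\<And>l. app (\<beta> l t) \<psi> k = 0" shows "app (an j) \<psi> k = app (co j t) \<psi> k"
proof -
  define d where "d = (\<chi> j. app (an j) \<psi> k - app (co j t) \<psi> k)"
  have "\<Phi> t *v d = 0" using assms by (simp add: vec_eq_iff matrix_vector_mult_def beta_eq d_def)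
  then have "\<Theta> t *v (\<Phi> t *v d) = 0" by simp
  then have "d = 0" by (simp add: matrix_vector_mul_assoc Phi_inverse)
  then have "d $ j = 0" by simp
  then show ?thesis by (simp add: d_def)
qed

lemma co_unique:
  assumes an: "\<And>j k. app (an j) \<psi> k = app (co j t) \<psi> k" and 0: "\<psi> (\<lambda>_. 0) = 0"
  shows "\<psi> k = 0"
proof -
  have "van N \<psi>" for N
  proof (induction N)
    case (Suc N)
    have "\<psi> k = 0" if k: "deg k = N" for k
    proof (cases "k = (\<lambda>_. 0)")
      case False
      then obtain i where i: "k i \<noteq> 0" by (auto simp: fun_eq_iff)
      define k' where "k' = k(i := k i - 1)"
      have k': "Suc (deg k') = N" using deg_upd_pred[of k i] i k by (simp add: k'_def)
      have "van (Suc N) (app (lin (- (R t $ i))) \<psi>)"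
        using raising_lin Suc.IH unfolding raising_def by blast
      then have "app (co i t) \<psi> k' = 0"
        using k' Suc.IH by (simp add: co_def app_basic app_sc van_def)
      then have "app (an i) \<psi> k' = 0" by (simp add: an)
      then show ?thesis using i by (simp add: app_an annih_def k'_def)
    qed (simp add: 0)
    then show ?case using Suc.IH by (auto simp: van_def less_Suc_eq)
  qed (simp add: van_def)
  then show ?thesis unfolding van_def by (meson lessI)
qed

lemma eta_differentiable: "\<exists>\<eta>'. pder \<eta> \<eta>' t"
proof -
  obtain R' where R': "(R has_vector_derivative R') (at t)" using R_has_vector_derivative by blast
  obtain g' where g': "(g has_vector_derivative g') (at t)" using g_has_vector_derivative by blast
  have "oder Xo (quad ((- 1 / 2) *\<^sub>R R') + lin (- g')) t"
    unfolding Xo_def[abs_def]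
    by (intro oder_add oder_quad oder_lin has_vector_derivative_minus g'
        bounded_linear.has_vector_derivative[OF bounded_linear_scaleR_right] R')
  then have "\<exists>D. oder (\<lambda>t. Xo t ^ m) D t" for m by (rule oder_power_ex)
  then have "\<exists>d. pder (\<lambda>t. app (Xo t ^ m) vac) d t" for m
    unfolding oder_def using pder_const by blast
  then obtain d where d: "\<And>m. pder (\<lambda>t. app (Xo t ^ m) vac) (d m) t" by metis
  have "((\<lambda>t. \<eta> t k) has_vector_derivative (\<Sum>m\<le>deg k. (1 / fact m) * d m k)) (at t)" for k
  proof -
    have "\<eta> t k = (\<Sum>m\<le>deg k. (1 / fact m) * app (Xo t ^ m) vac k)" for t
      unfolding \<eta>_def raising_pexp[OF raising_Xo order_refl] trm_def ..
    moreover have "((\<lambda>t. \<Sum>m\<le>deg k. (1 / fact m) * app (Xo t ^ m) vac k) has_vector_derivative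
        (\<Sum>m\<le>deg k. (1 / fact m) * d m k)) (at t)"
      by (intro has_vector_derivative_sum bounded_linear.has_vector_derivative[OF bounded_linear_mult_right]
          d[unfolded pder_def, rule_format])
    ultimately show ?thesis by simp
  qed
  then show ?thesis unfolding pder_def by (intro exI[of _ "\<lambda>k. \<Sum>m\<le>deg k. (1 / fact m) * d m k"] allI)
qed

text \<open>The derivative of \<open>\<eta>\<close> differs from \<open>K \<eta>\<close> by a vector which satisfies the same recursion
  in the particle number as \<open>\<eta>\<close> and hence is a multiple of \<open>\<eta>\<close>. This replaces the Riccati
  equation for \<open>R\<close>.\<close>

lemma eta_pder: "pder \<eta> (\<lambda>k. app K (\<eta> t) k - app K (\<eta> t) (\<lambda>_. 0) * \<eta> t k) t"
proof -
  obtain \<eta>' where \<eta>': "pder \<eta> \<eta>' t" using eta_differentiable by blast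
  define c where "c = app K (\<eta> t) (\<lambda>_. 0)"
  define \<psi> where "\<psi> k = c * \<eta> t k + (\<eta>' k - app K (\<eta> t) k)" for k
  have b0: "app (\<beta> l s) (\<eta> s) = (\<lambda>k. 0)" for l s
    by (simp add: fun_eq_iff beta_eq an_eta)
  have "app (\<beta> l t) (\<lambda>k. \<eta>' k - app K (\<eta> t) k) k = 0" for l k
  proof -
    have "pder (\<lambda>t. app (\<beta> l t) (\<eta> t))
       (\<lambda>k. app (\<beta> l t) (\<lambda>k. \<eta>' k - app K (\<eta> t) k) k + app K (app (\<beta> l t) (\<eta> t)) k) t"
      by (rule beta_b_pder(1)[OF \<eta>'])
    then have "((\<lambda>t. 0) has_vector_derivative app (\<beta> l t) (\<lambda>k. \<eta>' k - app K (\<eta> t) k) k) (at t)"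
      by (simp add: b0 app_zero pder_def)
    moreover have "((\<lambda>t :: real. 0 :: complex) has_vector_derivative 0) (at t)" by simp
    ultimately show ?thesis by (rule vector_derivative_unique_at)
  qed
  then have "app (\<beta> l t) \<psi> k = 0" for l k
    unfolding \<psi>_def[abs_def] app_linear by (simp add: b0)
  from beta_zero_imp[OF this] have an: "app (an j) \<psi> k = app (co j t) \<psi> k" for j k .
  have "((\<lambda>t. \<eta> t (\<lambda>_. 0)) has_vector_derivative \<eta>' (\<lambda>_. 0)) (at t)"
    using \<eta>' by (simp add: pder_def)
  then have "((\<lambda>t :: real. 1 :: complex) has_vector_derivative \<eta>' (\<lambda>_. 0)) (at t)" by (simp only: eta_0)
  moreover have "((\<lambda>t :: real. 1 :: complex) has_vector_derivative 0) (at t)" by simp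
  ultimately have "\<eta>' (\<lambda>_. 0) = 0" by (rule vector_derivative_unique_at)
  then have "\<psi> (\<lambda>_. 0) = 0" by (simp add: \<psi>_def eta_0 c_def)
  from co_unique[OF an this] have "\<psi> k = 0" for k .
  then have "\<eta>' = (\<lambda>k. app K (\<eta> t) k - c * \<eta> t k)"
    by (simp add: \<psi>_def fun_eq_iff) (metis add.commute add_diff_cancel_right' diff_0 diff_diff_eq2 minus_diff_eq)
  then show ?thesis using \<eta>' by (simp add: c_def)
qed

lemma ex_phase:
  obtains s :: "real \<Rightarrow> complex" where "s 0 = 0" "continuous_on UNIV s"
    "\<And>t. pder (\<lambda>t k. exp (s t) * \<eta> t k) (app K (\<lambda>k. exp (s t) * \<eta> t k)) t"
proof -
  define \<sigma> where "\<sigma> t = app K (\<eta> t) (\<lambda>_. 0)" for t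
  have "continuous_on UNIV \<sigma>"
  proof (intro continuous_at_imp_continuous_on ballI)
    fix t
    have "((\<lambda>t. app K (\<eta> t) (\<lambda>_. 0)) has_vector_derivative
        app K (\<lambda>k. app K (\<eta> t) k - app K (\<eta> t) (\<lambda>_. 0) * \<eta> t k) (\<lambda>_. 0)) (at t)"
      using pder_app[OF eta_pder, of K t] by (simp add: pder_def)
    then show "isCont \<sigma> t" unfolding \<sigma>_def by (rule has_vector_derivative_continuous)
  qed
  then obtain F where F: "\<And>t. (F has_vector_derivative \<sigma> t) (at t)" using ex_antiderivative by blast
  define s where "s t = F t - F 0" for t
  have sd: "(s has_vector_derivative \<sigma> t) (at t)" for t
    unfolding s_def[abs_def] using F[of t] by (auto intro!: derivative_eq_intros)
  have "pder (\<lambda>t k. exp (s t) * \<eta> t k) (app K (\<lambda>k. exp (s t) * \<eta> t k)) t" for t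
    unfolding pder_def
  proof
    fix k
    have e: "((\<lambda>t. exp (s t)) has_vector_derivative \<sigma> t * exp (s t)) (at t)"
      using field_vector_diff_chain_at[OF sd, of exp "exp (s t)"] by (simp add: o_def DERIV_exp)
    have d: "((\<lambda>t. \<eta> t k) has_vector_derivative app K (\<eta> t) k - \<sigma> t * \<eta> t k) (at t)"
      using eta_pder[of t] by (simp add: pder_def \<sigma>_def)
    show "((\<lambda>t. exp (s t) * \<eta> t k) has_vector_derivative app K (\<lambda>k. exp (s t) * \<eta> t k) k) (at t)"
      using has_vector_derivative_mult[OF e d] by (simp add: app_scale algebra_simps)
  qed
  moreover have "continuous_on UNIV s"
    using has_vector_derivative_continuous[OF sd] by (intro continuous_at_imp_continuous_on) blast
  ultimately show ?thesis using that[of s] by (simp add: s_def)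
qed

lemma bounded_on_compact:
  fixes f :: "real \<Rightarrow> 'a :: real_normed_vector"
  assumes "\<And>t. \<exists>D. (f has_vector_derivative D) (at t)"
  obtains L where "L \<ge> 1" "\<And>t. \<bar>t\<bar> \<le> T \<Longrightarrow> norm (f t) \<le> L"
proof -
  have "continuous_on {- T..T} f"
    using assms has_vector_derivative_continuous by (intro continuous_at_imp_continuous_on) blast
  then have "bounded (f ` {- T..T})" by (intro compact_imp_bounded compact_continuous_image) auto
  then obtain L where L: "\<forall>x\<in>f ` {- T..T}. norm x \<le> L" by (auto simp: bounded_iff)
  have "norm (f t) \<le> max 1 L" if "\<bar>t\<bar> \<le> T" for t
  proof -
    have "t \<in> {- T..T}" using that by auto
    then show ?thesis using L by force
  qed
  then show ?thesis using that[of "max 1 L"] by auto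
qed

lemma trm_vac_decays:
  "\<exists>C \<mu>. 0 \<le> C \<and> 0 < \<mu> \<and> \<mu> < 1 \<and> (\<forall>t. \<bar>t\<bar> \<le> T \<longrightarrow> (\<forall>m. decays (C * \<mu> ^ m) \<mu> (trm (Xo t) m vac)))"
proof -
  obtain K0 where K0: "K0 > 0" "\<And>(M :: complex^'n^'n) (y :: complex^'n). norm (M *v y) \<le> norm M * norm y * K0"
    using mv.pos_bounded by blast
  have tr: "bounded_linear (transpose :: complex^'n^'n \<Rightarrow> complex^'n^'n)"
    by (rule linear_conv_bounded_linear[THEN iffD1], rule linearI) (auto simp: transpose_def vec_eq_iff)
  obtain L where L: "L \<ge> 1" "\<And>t. \<bar>t\<bar> \<le> T \<Longrightarrow> norm (transpose (\<Phi> t)) \<le> L"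
    using bounded_on_compact[of "\<lambda>t. transpose (\<Phi> t)" T]
      bounded_linear.has_vector_derivative[OF tr Phi_Psi_has_vector_derivative(1)] by blast
  obtain \<gamma> where \<gamma>: "\<gamma> \<ge> 1" "\<And>t. \<bar>t\<bar> \<le> T \<Longrightarrow> norm (g t) \<le> \<gamma>"
    using bounded_on_compact[of g T] g_has_vector_derivative by blast
  define \<kappa> where "\<kappa> = L * K0 + 1"
  have "0 \<le> L * K0" using L(1) K0(1) by simp
  then have \<kappa>: "1 \<le> \<kappa>" by (simp add: \<kappa>_def)
  have \<kappa>b: "norm (transpose (\<Phi> t) *v y) \<le> \<kappa> * norm y" if "\<bar>t\<bar> \<le> T" for t y
  proof -
    have "norm (transpose (\<Phi> t) *v y) \<le> norm (transpose (\<Phi> t)) * norm y * K0" by (rule K0)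
    also have "\<dots> \<le> L * norm y * K0" using L(2)[OF that] K0(1) by (intro mult_right_mono) auto
    also have "\<dots> \<le> \<kappa> * norm y" by (simp add: \<kappa>_def algebra_simps)
    finally show ?thesis .
  qed
  define r where "r = sqrt (1 - 1 / \<kappa>\<^sup>2)"
  have k2: "1 \<le> \<kappa>\<^sup>2" using \<kappa> by simp
  then have "0 < \<kappa>\<^sup>2" by linarith
  then have "1 / \<kappa>\<^sup>2 \<le> 1" "0 < 1 / \<kappa>\<^sup>2" using k2 by (simp_all add: divide_le_eq_1)
  then have r: "0 \<le> r" "r < 1" by (simp_all add: r_def)
  have "0 \<le> \<gamma>" "CARD('n) \<ge> 1" using \<gamma>(1) by (auto simp: Suc_le_eq)
  from ex_decay_constants[OF r this] obtain C \<mu> where C: "0 < C" "0 < \<mu>" "\<mu> < 1" and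
    x: "\<forall>x :: nat \<Rightarrow> nat \<Rightarrow> real.
     (\<forall>m N. 0 \<le> x m N) \<longrightarrow> x 0 0 \<le> 1 \<longrightarrow> (\<forall>N. x 0 (Suc N) = 0) \<longrightarrow> (\<forall>m. x (Suc m) 0 = 0) \<longrightarrow>
     (\<forall>m N. sqrt (real (Suc N)) * x (Suc m) (Suc N) \<le>
        r * (if N = 0 then 0 else sqrt (real (N - 1 + CARD('n))) * x m (N - 1)) + \<gamma> * x m N) \<longrightarrow>
     (\<forall>m N. x m N \<le> C * \<mu> ^ N * \<mu> ^ m)" by blast
  have "decays (C * \<mu> ^ m) \<mu> (trm (Xo t) m vac)" if t: "\<bar>t\<bar> \<le> T" for t m
  proof -
    define x where "x m N = sh N (trm (Xo t) m vac)" for m N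
    have "x m N \<le> C * \<mu> ^ N * \<mu> ^ m" for m N
    proof (rule x[rule_format])
      show "0 \<le> x m N" for m N by (simp add: x_def)
      show "x 0 0 \<le> 1" by (simp add: x_def trm_0 sh_def shell_0 vac_0)
      show "x 0 (Suc N) = 0" for N
      proof -
        have "sh (Suc N) (vac :: 'n state) = sh (Suc N) (\<lambda>k :: 'n \<Rightarrow> nat. 0 :: complex)"
          unfolding sh_def by (rule L2_set_cong) (auto simp: vac_def shell_def deg_zero)
        then show ?thesis by (simp add: x_def trm_0 sh_zero)
      qed
      show "x (Suc m) 0 = 0" for m
        using raising_trm[OF raising_Xo] by (simp add: x_def sh_def shell_0 deg_zero)
      show "sqrt (real (Suc N)) * x (Suc m) (Suc N) \<le>
        r * (if N = 0 then 0 else sqrt (real (N - 1 + CARD('n))) * x m (N - 1)) + \<gamma> * x m N" for m N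
      proof -
        have "sqrt (real (Suc N)) * x (Suc m) (Suc N) \<le>
          r * (if N = 0 then 0 else sqrt (real (N - 1 + CARD('n))) * x m (N - 1)) + norm (g t) * x m N"
          unfolding x_def
        proof (rule annihilation_recursion)
          show "norm (R t *v y) \<le> r * norm y" for y
            unfolding r_def by (rule norm_R_less[OF \<kappa>b[OF t] \<kappa>])
          show "app (an i) (trm (Xo t) (Suc m) vac) k =
            - (\<Sum>j\<in>UNIV. R t $ i $ j * app (cr j) (trm (Xo t) m vac) k) - g t $ i * trm (Xo t) m vac k" for i k
            unfolding trm_intertwine[OF an_Xo co_Xo] an_vac app_co by (simp add: trm_def app_zero)
        qed (rule r)
        also have "norm (g t) * x m N \<le> \<gamma> * x m N" using \<gamma>(2)[OF t] by (intro mult_right_mono) (auto simp: x_def)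
        finally show ?thesis by simp
      qed
    qed
    then show ?thesis unfolding decays_def x_def by (simp add: mult_ac)
  qed
  moreover have "0 \<le> C" using C by simp
  ultimately show ?thesis using C(2,3) by blast
qed

lemma geo_vac: "geo (Xo t) vac"
  using trm_vac_decays[of "\<bar>t\<bar>"] unfolding geo_def by blast

lemma loc_decays_eta: "loc_decays \<eta>"
  unfolding loc_decays_def
proof
  fix T
  obtain C \<mu> where C: "0 \<le> C" "0 < \<mu>" "\<mu> < 1" and
    d: "\<And>t m. \<bar>t\<bar> \<le> T \<Longrightarrow> decays (C * \<mu> ^ m) \<mu> (trm (Xo t) m vac)"
    using trm_vac_decays[of T] by blast
  have "decays (C / (1 - \<mu>)) \<mu> (\<eta> t)" if "\<bar>t\<bar> \<le> T" for t
    using decays_pexp[OF raising_Xo C(2,3,1) d[OF that], of 0] by (simp add: \<eta>_def)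
  moreover have "0 \<le> C / (1 - \<mu>)" using C by simp
  ultimately show "\<exists>C \<mu>. 0 \<le> C \<and> 0 < \<mu> \<and> \<mu> < 1 \<and> (\<forall>t. \<bar>t\<bar> \<le> T \<longrightarrow> decays C \<mu> (\<eta> t))"
    using C by blast
qed

end

section \<open>The normally ordered product\<close>

lemma finite_states_induct [consumes 1, case_names vac cr linear]:
  assumes fin: "fin_supp d \<psi>"
    and vac: "P vac"
    and cr: "\<And>i \<psi> d. fin_supp d \<psi> \<Longrightarrow> P \<psi> \<Longrightarrow> P (app (cr i) \<psi>)"
    and linear: "\<And>c \<phi> \<psi> d. fin_supp d \<phi> \<Longrightarrow> fin_supp d \<psi> \<Longrightarrow> P \<phi> \<Longrightarrow> P \<psi> \<Longrightarrow> P (\<lambda>k. c * \<phi> k + \<psi> k)"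
  shows "P (\<psi> :: ('n :: finite) state)"
proof -
  define \<delta> :: "('n \<Rightarrow> nat) \<Rightarrow> 'n state" where "\<delta> k = (\<lambda>l. if l = k then 1 else 0)" for k
  have vac_fin: "fin_supp d (vac :: 'n state)" for d
    by (auto simp: fin_supp_def vac_def deg_zero)
  have \<delta>_fin: "fin_supp (deg k) (\<delta> k)" for k by (auto simp: fin_supp_def \<delta>_def)
  have P0: "P (\<lambda>k. 0)" using linear[OF vac_fin vac_fin vac vac, of "-1"] by simp
  have \<delta>: "P (\<delta> k)" for k
  proof (induction "deg k" arbitrary: k)
    case 0
    then have "\<delta> k = vac" by (simp add: deg_eq_0 \<delta>_def vac_def fun_eq_iff)
    then show ?case using vac by simp
  next
    case (Suc N)
    have "k \<noteq> (\<lambda>_. 0)" using Suc.hyps(2) by (auto simp: deg_zero)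
    then obtain i where i: "k i \<noteq> 0" by (auto simp: fun_eq_iff)
    define k' where "k' = k(i := k i - 1)"
    have k': "deg k' = N" using deg_upd_pred[of k i] i Suc.hyps(2) by (simp add: k'_def)
    have "P (app (cr i) (\<delta> k'))" by (rule cr[OF \<delta>_fin]) (rule Suc.hyps(1)[OF k'[symmetric]])
    moreover have "fin_supp (deg k) (app (cr i) (\<delta> k'))"
      using fin_supp_cr[OF \<delta>_fin[of k'], of i] k' Suc.hyps(2) by simp
    moreover have "fin_supp (deg k) (\<lambda>k. 0 :: complex)" by (simp add: fin_supp_def)
    ultimately have "P (\<lambda>l. (1 / of_real (sqrt (real (k i)))) * app (cr i) (\<delta> k') l + 0)"
      using P0 linear by blast
    moreover have "(\<lambda>l. (1 / of_real (sqrt (real (k i)))) * app (cr i) (\<delta> k') l + 0) = \<delta> k"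
    proof
      fix l
      have "l = k \<longleftrightarrow> l i \<noteq> 0 \<and> l(i := l i - 1) = k'"
      proof
        assume "l i \<noteq> 0 \<and> l(i := l i - 1) = k'"
        then have li: "l i \<noteq> 0" and lk: "l(i := l i - 1) = k'" by auto
        have "l j = k j" for j
          using fun_cong[OF lk, of j] li i by (cases "j = i") (auto simp: k'_def)
        then show "l = k" by (rule ext)
      qed (use i in \<open>auto simp: k'_def\<close>)
      then show "(1 / of_real (sqrt (real (k i)))) * app (cr i) (\<delta> k') l + 0 = \<delta> k l"
        using i by (auto simp: app_cr creat_def \<delta>_def)
    qed
    ultimately show ?case by simp
  qed
  have "P (\<lambda>l. if l \<in> S then \<psi> l else 0)" if "finite S" "S \<subseteq> {k. deg k \<le> d}" for S
    using that
  proof (induction S rule: finite_induct)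
    case empty
    then show ?case using P0 by simp
  next
    case (insert k S)
    have "fin_supp d (\<delta> k)" using insert.prems fin_supp_mono[OF \<delta>_fin, of k d] by simp
    moreover have "fin_supp d (\<lambda>l. if l \<in> S then \<psi> l else 0)" using insert.prems by (auto simp: fin_supp_def)
    ultimately have "P (\<lambda>l. \<psi> k * \<delta> k l + (if l \<in> S then \<psi> l else 0))"
      using linear[OF _ _ \<delta> insert.IH] insert.prems by simp
    moreover have "(\<lambda>l. \<psi> k * \<delta> k l + (if l \<in> S then \<psi> l else 0)) = (\<lambda>l. if l \<in> insert k S then \<psi> l else 0)"
      using insert.hyps by (intro ext) (auto simp: \<delta>_def)
    ultimately show ?case by simp
  qed
  from this[OF finite_deg_le order_refl] have "P (\<lambda>l. if deg l \<le> d then \<psi> l else 0)" by simp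
  moreover have "(\<lambda>l. if deg l \<le> d then \<psi> l else 0) = \<psi>" using fin by (auto simp: fin_supp_def fun_eq_iff)
  ultimately show ?thesis by simp
qed

lemma pexp_fld:
  assumes "\<And>i. conv X (app (an i) \<psi>)" "\<And>i. conv X (app (cr i) \<psi>)" "conv X \<psi>"
  shows "pexp X (app (fld p q z) \<psi>) k = (\<Sum>i\<in>UNIV. p $ i * pexp X (app (an i) \<psi>) k)
    + (\<Sum>i\<in>UNIV. q $ i * pexp X (app (cr i) \<psi>) k) + z * pexp X \<psi> k"
proof -
  let ?a = "\<lambda>k. \<Sum>i\<in>UNIV. p $ i * app (an i) \<psi> k" and ?c = "\<lambda>k. \<Sum>i\<in>UNIV. q $ i * app (cr i) \<psi> k"
  have a: "conv X ?a" "pexp X ?a = (\<lambda>k. \<Sum>i\<in>UNIV. p $ i * pexp X (app (an i) \<psi>) k)"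
    using conv_pexp_sum[of UNIV X "\<lambda>i. app (an i) \<psi>" "\<lambda>i. p $ i"] assms(1) by auto
  have c: "conv X ?c" "pexp X ?c = (\<lambda>k. \<Sum>i\<in>UNIV. q $ i * pexp X (app (cr i) \<psi>) k)"
    using conv_pexp_sum[of UNIV X "\<lambda>i. app (cr i) \<psi>" "\<lambda>i. q $ i"] assms(2) by auto
  have "app (fld p q z) \<psi> = (\<lambda>k. z * \<psi> k + (1 * ?a k + ?c k))"
    by (simp add: fun_eq_iff app_fld add_ac)
  then show ?thesis
    using pexp_linear[OF a(1) c(1), of 1 k] conv_linear[OF a(1) c(1), of 1]
      pexp_linear[OF assms(3), of "\<lambda>k. 1 * ?a k + ?c k" z k]
    by (simp add: a(2) c(2) add_ac)
qed

lemma transpose_mat_exp: "transpose (mat_exp M) = mat_exp (transpose M)"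
proof (rule mat_exp_image)
  show "linear (transpose :: complex^'n^'n \<Rightarrow> complex^'n^'n)"
    by (rule linearI) (auto simp: transpose_def vec_eq_iff)
  show "transpose (mat_pow M k) = mat_pow (transpose M) k" for k
  proof (induction k)
    case (Suc k)
    show ?case unfolding mat_pow_Suc2[of "transpose M"] by (simp add: matrix_transpose_mul Suc)
  qed simp
qed

lemma pexp_num_cr: "pexp (num C) (app (cr j) \<psi>) k = (\<Sum>i\<in>UNIV. mat_exp C $ i $ j * app (cr i) (pexp (num C) \<psi>) k)"
proof (rule pexp_num_intertwine)
  fix j
  have "comm (num C) (cr j) = (\<Sum>i\<in>UNIV. \<Sum>l\<in>UNIV. sc (C $ i $ l) * (cr i * sc (if l = j then 1 else 0)))"
    unfolding num_def comm_sum comm_sc comm_simps comm_an_cr by simp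
  also have "\<dots> = (\<Sum>i\<in>UNIV. sc (1 * C $ i $ j) * cr i)"
    by (intro sum.cong refl sum_sc_delta(1)[where X = "\<lambda>_. cr _"])
  finally show "num C * cr j = cr j * num C + (\<Sum>i\<in>UNIV. sc (C $ i $ j) * cr i)"
    by (simp add: comm_def algebra_simps)
qed

lemma pexp_num_an: "pexp (num C) (app (an j) \<psi>) k = (\<Sum>i\<in>UNIV. mat_exp (- C) $ j $ i * app (an i) (pexp (num C) \<psi>) k)"
proof -
  have "pexp (num C) (app (an j) \<psi>) k = (\<Sum>i\<in>UNIV. mat_exp (- transpose C) $ i $ j * app (an i) (pexp (num C) \<psi>) k)"
  proof (rule pexp_num_intertwine)
    fix j
    have "comm (num C) (an j) = (\<Sum>i\<in>UNIV. \<Sum>l\<in>UNIV. sc (C $ i $ l) * (sc (if i = j then - 1 else 0) * an l))"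
      unfolding num_def comm_sum comm_sc comm_simps comm_an_cr by simp
    also have "\<dots> = (\<Sum>l\<in>UNIV. sc (-1 * C $ j $ l) * an l)"
      by (subst sum.swap) (intro sum.cong refl sum_sc_delta(2)[where X = "\<lambda>_. an _"])
    finally show "num C * an j = an j * num C + (\<Sum>i\<in>UNIV. sc ((- transpose C) $ i $ j) * an i)"
      by (simp add: comm_def algebra_simps transpose_def)
  qed
  moreover have "mat_exp (- transpose C) = transpose (mat_exp (- C))"
    by (simp add: transpose_mat_exp transpose_simps)
  ultimately show ?thesis by (simp add: transpose_def)
qed

lemma pexp_vac: assumes "app X vac = (\<lambda>k. 0)" shows "pexp X vac = vac"
proof
  fix k
  have "trm X (Suc m) vac k = 0" for m
    using assms by (simp add: trm_def power_Suc2 app_basic app_zero del: power_Suc)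
  then have "trm X m vac k = 0" if "m \<notin> {0}" for m using that by (cases m) auto
  then have "(\<lambda>m. trm X m vac k) sums (\<Sum>m\<in>{0}. trm X m vac k)" by (intro sums_finite) auto
  then have "(\<lambda>m. trm X m vac k) sums trm X 0 vac k" by simp
  then show "pexp X vac k = vac k" by (simp add: pexp_def sums_iff trm_0)
qed

definition ann :: "complex^'n^'n \<Rightarrow> complex^'n \<Rightarrow> ('n :: finite) fop" where
  "ann S v = (\<Sum>i\<in>UNIV. \<Sum>j\<in>UNIV. sc (S $ i $ j / 2) * (an i * an j)) + (\<Sum>i\<in>UNIV. sc (v $ i) * an i)"

lemma app_ann: "app (ann S v) \<psi> k = (\<Sum>i\<in>UNIV. \<Sum>j\<in>UNIV. S $ i $ j / 2 * app (an i) (app (an j) \<psi>) k)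
    + (\<Sum>i\<in>UNIV. v $ i * app (an i) \<psi> k)"
  by (simp only: ann_def app_basic app_sum app_sc)

lemma lowering_ann: "lowering (ann S v)"
  unfolding ann_def by (intro lowering_add lowering_sum lowering_sc_mult lowering_mult lowering_an)

lemma pexp_ann_cr:
  assumes S: "transpose S = S" and \<psi>: "fin_supp d \<psi>"
  shows "pexp (ann S v) (app (cr l) \<psi>) k = app (fld (S $ l) (axis l 1) (v $ l)) (pexp (ann S v) \<psi>) k"
proof -
  define c where "c = fld (- (S $ l)) 0 (- v $ l)"
  have Ss: "S $ i $ l = S $ l $ i" for i using S by (auto simp: vec_eq_iff transpose_def)
  have "comm (cr l) (ann S v) = (\<Sum>i\<in>UNIV. \<Sum>j\<in>UNIV. sc (S $ i $ j / 2) * (sc (if i = l then - 1 else 0) * an j))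
      + (\<Sum>i\<in>UNIV. \<Sum>j\<in>UNIV. sc (S $ i $ j / 2) * (an i * sc (if j = l then - 1 else 0)))
      + (\<Sum>i\<in>UNIV. sc (v $ i) * sc (if i = l then - 1 else 0))"
    unfolding ann_def comm_simps(3) comm_sum comm_sc comm_mult_right comm_an_cr distrib_left sum.distrib eq_commute[of l] by simp
  also have "(\<Sum>i\<in>UNIV. \<Sum>j\<in>UNIV. sc (S $ i $ j / 2) * (sc (if i = l then - 1 else 0) * an j)) = (\<Sum>j\<in>UNIV. sc (-1 * (S $ l $ j / 2)) * an j)"
    by (subst sum.swap) (intro sum.cong refl sum_sc_delta(2)[where X = "\<lambda>_. an _"])
  also have "(\<Sum>i\<in>UNIV. \<Sum>j\<in>UNIV. sc (S $ i $ j / 2) * (an i * sc (if j = l then - 1 else 0))) = (\<Sum>i\<in>UNIV. sc (-1 * (S $ i $ l / 2)) * an i)"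
    by (intro sum.cong refl sum_sc_delta(1)[where X = "\<lambda>_. an _"])
  also have "(\<Sum>i\<in>UNIV. sc (v $ i) * sc (if i = l then - 1 else 0)) = sc (-1 * v $ l)" by (rule sum_sc_delta')
  finally have "comm (cr l) (ann S v) = c"
    unfolding Ss sum.distrib[symmetric] distrib_right[symmetric] sc_add[symmetric] c_def fld_def by simp
  then have 1: "cr l * ann S v = ann S v * cr l + c" by (simp add: comm_def algebra_simps)
  have "comm (an j) (ann S v) = 0" for j
    unfolding ann_def comm_simps(3) comm_sum comm_sc comm_mult_right comm_an_cr by simp
  then have "comm c (ann S v) = 0"
    unfolding c_def fld_def comm_simps(1) comm_sum(1) comm_sc by simp
  then have 2: "c * ann S v = ann S v * c" by (simp add: comm_def)
  have "app (cr l) (pexp (ann S v) \<psi>) k = pexp (ann S v) (app (cr l) \<psi>) k + app c (pexp (ann S v) \<psi>) k"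
    by (rule pexp_intertwine[OF 1 2 lowering_conv[OF lowering_ann \<psi>] lowering_conv[OF lowering_ann fin_supp_cr[OF \<psi>]]])
  moreover have "(\<Sum>i\<in>UNIV. axis l (1 :: complex) $ i * f i) = f l" for f
    by (simp add: axis_def if_distrib if_distribR cong: if_cong)
  ultimately show ?thesis by (simp add: c_def app_fld sum_negf)
qed

lemma loc_bounded_if_derivative:
  fixes c :: "real \<Rightarrow> complex"
  assumes "\<And>t. \<exists>D. (c has_vector_derivative D) (at t)" shows "loc_bounded c"
proof (rule loc_bounded_continuous)
  show "continuous_on UNIV c"
    using assms has_vector_derivative_continuous by (intro continuous_at_imp_continuous_on) blast
qed

context squeezing
begin

definition "Yo t = ann (rb t) (cnj_vec (f_coeff A B h t))"

definition "prodn t C \<psi> = pexp (Xo t) (pexp (num C) (pexp (Yo t) \<psi>))"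

lemma mat_exp_C: assumes "mat_exp (- C) = \<Phi> t" shows "mat_exp C = \<Theta> t"
proof -
  have "mat_exp C ** (mat_exp (- C) ** \<Theta> t) = \<Theta> t" by (simp add: matrix_mul_assoc mat_exp_minus)
  then show ?thesis by (simp add: assms Phi_inverse)
qed

lemma pexp_num_fld:
  assumes C: "mat_exp (- C) = \<Phi> t"
  shows "pexp (num C) (app (fld p q z) \<psi>) k = app (fld (p v* \<Phi> t) (\<Theta> t *v q) z) (pexp (num C) \<psi>) k"
proof -
  define y where "y = pexp (num C) \<psi>"
  have "(\<Sum>j\<in>UNIV. q $ j * (\<Sum>i\<in>UNIV. \<Theta> t $ i $ j * app (cr i) y k)) = (\<Sum>i\<in>UNIV. (\<Theta> t *v q) $ i * app (cr i) y k)"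
  proof -
    have "(\<Sum>j\<in>UNIV. q $ j * (\<Sum>i\<in>UNIV. \<Theta> t $ i $ j * app (cr i) y k)) = (\<Sum>j\<in>UNIV. \<Sum>i\<in>UNIV. \<Theta> t $ i $ j * q $ j * app (cr i) y k)"
      by (simp only: sum_distrib_left mult_ac)
    also have "\<dots> = (\<Sum>i\<in>UNIV. \<Sum>j\<in>UNIV. \<Theta> t $ i $ j * q $ j * app (cr i) y k)" by (rule sum.swap)
    finally show ?thesis by (simp only: matrix_vector_mult_def vec_lambda_beta sum_distrib_right)
  qed
  then show ?thesis
    unfolding pexp_fld[OF num_conv num_conv num_conv] pexp_num_cr pexp_num_an C mat_exp_C[OF C] app_fld y_def sum_vector_matrix by simp
qed

lemma pexp_Xo_fld:
  "pexp (Xo t) (app (fld p q z) \<psi>) k =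
     app (fld p (q + p v* R t) (z + (\<Sum>j\<in>UNIV. p $ j * g t $ j))) (pexp (Xo t) \<psi>) k"
proof -
  define y where "y = pexp (Xo t) \<psi>"
  note cv = raising_conv[OF raising_Xo]
  have an: "pexp (Xo t) (app (an i) \<psi>) k = app (an i) y k + (\<Sum>j\<in>UNIV. R t $ i $ j * app (cr j) y k) + g t $ i * y k" for i
    using pexp_intertwine[OF an_Xo co_Xo cv cv, of i t \<psi> k] by (simp add: app_co y_def algebra_simps)
  have cr: "pexp (Xo t) (app (cr i) \<psi>) k = app (cr i) y k" for i
    using pexp_intertwine[of "cr i" "Xo t" 0 \<psi> k] cr_Xo cv by (simp add: y_def app_basic)
  show ?thesis
    unfolding pexp_fld[OF cv cv cv] an cr app_fld y_def[symmetric] distrib_left sum.distrib sum_vector_matrix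
      vector_add_component distrib_right sum_distrib_right
    by (simp add: mult.assoc add_ac)
qed

lemma prodn_cr:
  assumes C: "mat_exp (- C) = \<Phi> t" and \<psi>: "fin_supp d \<psi>"
  shows "prodn t C (app (cr l) \<psi>) = app (b l t) (prodn t C \<psi>)"
proof
  fix k
  define v where "v = cnj_vec (f_coeff A B h t)"
  have 1: "pexp (Yo t) (app (cr l) \<psi>) = app (fld (rb t $ l) (axis l 1) (v $ l)) (pexp (Yo t) \<psi>)"
    unfolding Yo_def v_def by (intro ext pexp_ann_cr[OF rb_sym \<psi>])
  have 2: "rb t $ l v* \<Phi> t = cnj_mat (\<Psi> t) $ l" by (simp only: row_mult[symmetric] rb_Phi)
  have 3: "(\<Theta> t *v axis l 1) + cnj_mat (\<Psi> t) $ l v* R t = cnj_mat (\<Phi> t) $ l"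
  proof -
    have "(\<Theta> t *v axis l 1) = transpose (\<Theta> t) $ l"
      by (simp add: vec_eq_iff matrix_vector_mult_def axis_def transpose_def if_distrib cong: if_cong)
    then show ?thesis by (simp only: row_mult[symmetric] vector_add_component[symmetric] Phi_cnj_eq)
  qed
  have 4: "v $ l + (\<Sum>j\<in>UNIV. cnj_mat (\<Psi> t) $ l $ j * g t $ j) = cnj (hp t $ l)"
  proof -
    have "(\<Sum>j\<in>UNIV. cnj_mat (\<Psi> t) $ l $ j * g t $ j) = (cnj_mat (\<Psi> t) *v g t) $ l"
      by (simp add: matrix_vector_mult_def)
    then show ?thesis by (simp add: v_def f_eq Psi_g)
  qed
  have num: "pexp (num C) (app (fld (rb t $ l) (axis l 1) (v $ l)) y)
      = app (fld (cnj_mat (\<Psi> t) $ l) (\<Theta> t *v axis l 1) (v $ l)) (pexp (num C) y)" for y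
    by (intro ext) (simp only: pexp_num_fld[OF C] 2)
  show "prodn t C (app (cr l) \<psi>) k = app (b l t) (prodn t C \<psi>) k"
    unfolding prodn_def 1 num pexp_Xo_fld 3 4 b_def ..
qed

lemma pexp_Yo_fin: assumes "fin_supp d \<psi>" shows "fin_supp d (pexp (Yo t) \<psi>)" "(\<psi>, pexp (Yo t) \<psi>) \<in> op_exp (app (Yo t))"
  unfolding Yo_def
  using op_exp_finite[OF lowering_trm(1)[OF lowering_ann assms] lowering_conv[OF lowering_ann assms]] by auto

lemma prodn_linear:
  assumes "fin_supp d \<phi>" "fin_supp d \<psi>"
  shows "prodn t C (\<lambda>k. c * \<phi> k + \<psi> k) = (\<lambda>k. c * prodn t C \<phi> k + prodn t C \<psi> k)"
proof -
  have "pexp (Yo t) (\<lambda>k. c * \<phi> k + \<psi> k) = (\<lambda>k. c * pexp (Yo t) \<phi> k + pexp (Yo t) \<psi> k)"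
    unfolding Yo_def by (intro ext pexp_linear lowering_conv[OF lowering_ann assms(1)] lowering_conv[OF lowering_ann assms(2)])
  moreover have "pexp (num C) (\<lambda>k. c * \<phi> k + \<psi> k) = (\<lambda>k. c * pexp (num C) \<phi> k + pexp (num C) \<psi> k)" for \<phi> \<psi>
    by (intro ext pexp_linear num_conv)
  moreover have "pexp (Xo t) (\<lambda>k. c * \<phi> k + \<psi> k) = (\<lambda>k. c * pexp (Xo t) \<phi> k + pexp (Xo t) \<psi> k)" for \<phi> \<psi>
    by (intro ext pexp_linear raising_conv raising_Xo)
  ultimately show ?thesis by (simp only: prodn_def)
qed

lemma prodn_vac: "prodn t C vac = \<eta> t"
proof -
  have "app (Yo t) vac = (\<lambda>k. 0)" by (simp add: fun_eq_iff Yo_def app_ann an_vac app_zero)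
  moreover have "app (num C) vac = (\<lambda>k. 0)" by (simp add: fun_eq_iff app_num an_vac app_zero)
  ultimately show ?thesis by (simp add: prodn_def pexp_vac \<eta>_def)
qed

lemma geo_finite: assumes "fin_supp d \<psi>" shows "geo (Xo t) \<psi>"
  using assms
proof (induction rule: finite_states_induct)
  case vac
  show ?case by (rule geo_vac)
next
  case (cr i \<psi> d)
  then show ?case by (intro geo_cr cr_Xo[symmetric])
next
  case (linear c \<phi> \<psi> d)
  then show ?case by (intro geo_linear)
qed

lemma prodn_normal_product:
  assumes "fin_supp d \<psi>"
  shows "(\<psi>, prodn t C \<psi>) \<in> normal_product (R t) (g t) C (cnj_mat (rho_coeff A B t)) (cnj_vec (f_coeff A B h t))"
proof -
  have 1: "(\<lambda>\<psi> k. bilin_op annih (cnj_mat (rho_coeff A B t)) annih \<psi> k / 2 + lin_op annih (cnj_vec (f_coeff A B h t)) \<psi> k) = app (Yo t)"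
    by (simp add: fun_eq_iff Yo_def app_ann rb_eq bilin_op_def lin_op_def app_an sum_divide_distrib)
  have 2: "bilin_op creat C annih = app (num C)"
    by (simp add: fun_eq_iff app_num bilin_op_def app_an app_cr)
  have 3: "(\<lambda>\<psi> k. - bilin_op creat (R t) creat \<psi> k / 2 - lin_op creat (g t) \<psi> k) = app (Xo t)"
    by (simp add: fun_eq_iff Xo_def app_basic app_quad app_lin bilin_op_def lin_op_def app_cr sum_divide_distrib sum_negf
        scaleR_conv_of_real[where 'a = complex])
  note y = pexp_Yo_fin[OF assms, of t]
  note n = op_exp_finite[OF num_fin_supp[OF y(1)] num_conv, of C]
  have "(pexp (num C) (pexp (Yo t) \<psi>), prodn t C \<psi>) \<in> op_exp (app (Xo t))"
    unfolding prodn_def by (rule op_exp_geo[OF raising_Xo geo_finite[OF n(2)]])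
  then show ?thesis unfolding normal_product_def 1 2 3 using y(2) n(1) by blast
qed

lemma loc_decays_b:
  assumes "loc_decays w" shows "loc_decays (\<lambda>t. app (b l t) (w t))"
proof -
  have c: "bounded_linear (\<lambda>X :: complex^'n^'n. cnj (X $ i $ j))" for i j
    by (rule bounded_linear_compose[OF bounded_linear_cnj bounded_linear_entry])
  have c': "bounded_linear (\<lambda>x :: complex^'n. cnj (x $ j))" for j
    by (rule bounded_linear_compose[OF bounded_linear_cnj bounded_linear_vec_nth])
  have "loc_bounded (\<lambda>t. cnj_mat (\<Psi> t) $ l $ i)" "loc_bounded (\<lambda>t. cnj_mat (\<Phi> t) $ l $ i)" "loc_bounded (\<lambda>t. cnj (hp t $ l))" for i
    using bounded_linear.has_vector_derivative[OF c Phi_Psi_has_vector_derivative(1)]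
      bounded_linear.has_vector_derivative[OF c Phi_Psi_has_vector_derivative(2)]
      bounded_linear.has_vector_derivative[OF c' h_path_has_vector_derivative]
    by (intro loc_bounded_if_derivative; simp; blast)+
  then have "loc_decays (\<lambda>t k. (\<Sum>i\<in>UNIV. cnj_mat (\<Psi> t) $ l $ i * app (an i) (w t) k)
      + (\<Sum>i\<in>UNIV. cnj_mat (\<Phi> t) $ l $ i * app (cr i) (w t) k) + cnj (hp t $ l) * w t k)"
    by (intro loc_decays_add loc_decays_sum loc_decays_scale loc_decays_an_cr assms finite_class.finite_UNIV)
  moreover have "(\<lambda>t. app (b l t) (w t)) = (\<lambda>t k. (\<Sum>i\<in>UNIV. cnj_mat (\<Psi> t) $ l $ i * app (an i) (w t) k)
      + (\<Sum>i\<in>UNIV. cnj_mat (\<Phi> t) $ l $ i * app (cr i) (w t) k) + cnj (hp t $ l) * w t k)"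
    by (simp only: fun_eq_iff b_def app_fld) simp
  ultimately show ?thesis by simp
qed

lemma b_0: "app (b l 0) \<psi> = app (cr l) \<psi>"
proof
  fix k
  have "(\<Sum>i\<in>UNIV. cnj_mat (mat 1) $ l $ i * f i) = f l" for f :: "'n \<Rightarrow> complex"
    by (simp add: mat_def if_distrib if_distribR cong: if_cong)
  then show "app (b l 0) \<psi> k = app (cr l) \<psi> k"
    by (simp add: b_def app_fld Phi_0 Psi_0 h_path_0)
qed

lemma decomposition:
  assumes U: "generated_by U (hamiltonian A B h)"
  shows "\<exists>s :: real \<Rightarrow> complex. s 0 = 0 \<and> (\<forall>t C. mat_exp (- C) = \<Phi> t \<longrightarrow>
    (\<forall>\<psi>\<in>finite_states. U t \<psi> = (\<lambda>k. exp (s t) * prodn t C \<psi> k)))"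
proof -
  obtain s :: "real \<Rightarrow> complex" where s0: "s 0 = 0" and sc: "continuous_on UNIV s"
    and v: "\<And>t. pder (\<lambda>t k. exp (s t) * \<eta> t k) (app K (\<lambda>k. exp (s t) * \<eta> t k)) t"
    using ex_phase by blast
  have ex: "\<exists>w. (\<forall>t. pder w (app K (w t)) t) \<and> loc_decays w \<and> w 0 = \<psi> \<and>
      (\<forall>t C. mat_exp (- C) = \<Phi> t \<longrightarrow> (\<lambda>k. exp (s t) * prodn t C \<psi> k) = w t)" if "fin_supp d \<psi>" for d \<psi>
    using that
  proof (induction rule: finite_states_induct)
    case vac
    have "loc_decays (\<lambda>t k. exp (s t) * \<eta> t k)"
      by (intro loc_decays_scale loc_decays_eta loc_bounded_continuous continuous_intros sc)
    moreover have "(\<lambda>k. exp (s 0) * \<eta> 0 k) = vac" by (simp add: s0 eta_time_0)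
    ultimately show ?case
      using v by (intro exI[of _ "\<lambda>t k. exp (s t) * \<eta> t k"]) (auto simp: prodn_vac)
  next
    case (cr l \<psi> d)
    then obtain w where w: "\<And>t. pder w (app K (w t)) t" "loc_decays w" "w 0 = \<psi>"
      and wp: "\<And>t C. mat_exp (- C) = \<Phi> t \<Longrightarrow> (\<lambda>k. exp (s t) * prodn t C \<psi> k) = w t" by blast
    have "pder (\<lambda>t. app (b l t) (w t)) (app K (app (b l t) (w t))) t" for t
      using beta_b_pder(2)[OF w(1)[of t], of l] by (simp add: app_zero)
    moreover have "app (b l 0) (w 0) = app (cr l) \<psi>" by (simp add: b_0 w(3))
    moreover have "(\<lambda>k. exp (s t) * prodn t C (app (cr l) \<psi>) k) = app (b l t) (w t)" if "mat_exp (- C) = \<Phi> t" for t C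
      unfolding prodn_cr[OF that cr.hyps] wp[OF that, symmetric] by (simp add: fun_eq_iff app_scale)
    ultimately show ?case using loc_decays_b[OF w(2), of l]
      by (intro exI[of _ "\<lambda>t. app (b l t) (w t)"]) auto
  next
    case (linear c \<phi> \<psi> d)
    obtain v where v: "\<And>t. pder v (app K (v t)) t" "loc_decays v" "v 0 = \<phi>"
      and vp: "\<And>t C. mat_exp (- C) = \<Phi> t \<Longrightarrow> (\<lambda>k. exp (s t) * prodn t C \<phi> k) = v t" using linear.IH(1) by blast
    obtain w where w: "\<And>t. pder w (app K (w t)) t" "loc_decays w" "w 0 = \<psi>"
      and wp: "\<And>t C. mat_exp (- C) = \<Phi> t \<Longrightarrow> (\<lambda>k. exp (s t) * prodn t C \<psi> k) = w t" using linear.IH(2) by blast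
    define u where "u t k = c * v t k + w t k" for t k
    have "pder u (app K (u t)) t" for t
      unfolding pder_def u_def app_linear
      by (intro allI has_vector_derivative_add bounded_linear.has_vector_derivative[OF bounded_linear_mult_right]
          v(1)[unfolded pder_def, rule_format] w(1)[unfolded pder_def, rule_format])
    moreover have "loc_decays u"
      unfolding u_def[abs_def] by (intro loc_decays_add loc_decays_scale v(2) w(2) loc_bounded_continuous continuous_intros)
    moreover have "u 0 = (\<lambda>k. c * \<phi> k + \<psi> k)" by (simp add: u_def[abs_def] v(3) w(3))
    moreover have "(\<lambda>k. exp (s t) * prodn t C (\<lambda>k. c * \<phi> k + \<psi> k) k) = u t" if "mat_exp (- C) = \<Phi> t" for t C
      unfolding prodn_linear[OF linear.hyps] u_def[abs_def] vp[OF that, symmetric] wp[OF that, symmetric]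
      by (simp add: algebra_simps)
    ultimately show ?case by (intro exI[of _ u]) auto
  qed
  have "U t \<psi> = (\<lambda>k. exp (s t) * prodn t C \<psi> k)" if C: "mat_exp (- C) = \<Phi> t" and \<psi>: "\<psi> \<in> finite_states" for t C \<psi>
  proof -
    obtain d where d: "fin_supp d \<psi>" using \<psi> finite_states_iff by blast
    obtain w where w: "\<And>t. pder w (app K (w t)) t" "loc_decays w" "w 0 = \<psi>"
      and wp: "\<And>t C. mat_exp (- C) = \<Phi> t \<Longrightarrow> (\<lambda>k. exp (s t) * prodn t C \<psi> k) = w t" using ex[OF d] by blast
    have "U t \<psi> = w t" by (rule unitary_group_eqI[OF A_sym B_herm U fin_supp_fock(1)[OF d] w])
    then show ?thesis by (simp only: wp[OF C])
  qed
  then show ?thesis using s0 by blast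
qed

end

theorem theorem1:
  fixes A B :: "complex^'n^'n" and h :: "complex^'n"
  assumes "transpose A = A"
    and "cnj_mat (transpose B) = B"
  shows
    "(\<forall>t. mat_exp (t *\<^sub>R G_mat A B) =
          block_mat (Phi A B t) (Psi A B t) (cnj_mat (Psi A B t)) (cnj_mat (Phi A B t)))
     \<and> (\<forall>t. invertible (Phi A B t))
     \<and> (\<forall>t. (\<lambda>k. (t ^ Suc k / fact (Suc k)) *\<^sub>R mat_pow (G_mat A B) k)
              sums exp_quotient (G_mat A B) t
          \<and> interval_lebesgue_integrable lborel 0 (ereal t) (\<lambda>\<tau>. mat_exp (\<tau> *\<^sub>R G_mat A B))
          \<and> (LBINT \<tau>=0..t. mat_exp (\<tau> *\<^sub>R G_mat A B)) = exp_quotient (G_mat A B) t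
          \<and> G_mat A B ** exp_quotient (G_mat A B) t = mat_exp (t *\<^sub>R G_mat A B) - mat 1
          \<and> (invertible (G_mat A B) \<longrightarrow> exp_quotient (G_mat A B) t =
                matrix_inv (G_mat A B) ** (mat_exp (t *\<^sub>R G_mat A B) - mat 1)))
     \<and> (\<forall>t. block_vec (h_path A B h t) (cnj_vec (h_path A B h t)) =
              (LBINT \<tau>=0..t. mat_exp (\<tau> *\<^sub>R G_mat A B) *v block_vec h (cnj_vec h))
          \<and> block_vec (h_path A B h t) (cnj_vec (h_path A B h t)) =
              exp_quotient (G_mat A B) t *v block_vec h (cnj_vec h))
     \<and> (\<forall>t. \<exists>C. mat_exp (- C) = Phi A B t)
     \<and> (\<forall>U. generated_by U (hamiltonian A B h) \<longrightarrow>
          (\<exists>s :: real \<Rightarrow> complex. s 0 = 0 \<and>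
            (\<forall>t C. mat_exp (- C) = Phi A B t \<longrightarrow>
              (\<forall>\<psi>\<in>finite_states. \<exists>\<phi>.
                 (\<psi>, \<phi>) \<in> normal_product (R_coeff A B t) (g_coeff A B h t) C
                           (cnj_mat (rho_coeff A B t)) (cnj_vec (f_coeff A B h t))
                 \<and> U t \<psi> = (\<lambda>k. exp (s t) * \<phi> k)))))"
proof -
  interpret squeezing A B h using assms by unfold_locales
  have U: "\<exists>s :: real \<Rightarrow> complex. s 0 = 0 \<and> (\<forall>t C. mat_exp (- C) = Phi A B t \<longrightarrow>
      (\<forall>\<psi>\<in>finite_states. \<exists>\<phi>. (\<psi>, \<phi>) \<in> normal_product (R_coeff A B t) (g_coeff A B h t) C
         (cnj_mat (rho_coeff A B t)) (cnj_vec (f_coeff A B h t)) \<and> U t \<psi> = (\<lambda>k. exp (s t) * \<phi> k)))"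
    if U: "generated_by U (hamiltonian A B h)" for U
  proof -
    obtain s :: "real \<Rightarrow> complex" where s0: "s 0 = 0" and s: "\<And>t C \<psi>. mat_exp (- C) = Phi A B t \<Longrightarrow>
      \<psi> \<in> finite_states \<Longrightarrow> U t \<psi> = (\<lambda>k. exp (s t) * prodn t C \<psi> k)"
      using decomposition[OF U] by blast
    have "(\<psi>, prodn t C \<psi>) \<in> normal_product (R_coeff A B t) (g_coeff A B h t) C
         (cnj_mat (rho_coeff A B t)) (cnj_vec (f_coeff A B h t))" if "\<psi> \<in> finite_states" for t C \<psi>
      using that prodn_normal_product finite_states_iff by blast
    then show ?thesis using s0 s by blast
  qed
  show ?thesis
    by (intro conjI allI impI U mat_exp_G_block invertible_Phi exp_quotient_sums interval_integrable_mat_exp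
        interval_integral_mat_exp matrix_mult_exp_quotient exp_quotient_invertible block_h_path ex_mat_log)
      (simp_all only: interval_integral_mat_exp_vec block_h_path)
qed

end
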